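(* Let $1\le p<\infty$, let $\omega$ be a modulus of continuity with $\lim_{t\to0^+}\omega(t)/t=+\infty$, and let $\nu=\{\nu(k)\}_{k\ge1}$ be a modulus of variation such that $\{\nu(k)^p\}$ is also concave, $\nu(k)\uparrow\infty$, and $\nu(k)/k^{1/p}$ is nonincreasing and tends to $0$. With $\rho,\theta,\sigma,\tau,\eta$ as defined in the context, the following are equivalent: (i) the Fourier series of every function in $H^\omega\cap V_p[\nu]$ converges uniformly; (ii) $\lim_{n\to\infty}\sigma(n)=0$; (iii) $\lim_{n\to\infty}\rho(n)=0$; (iv) $\lim_{n\to\infty}\tau(n)=0$; (v) $\lim_{n\to\infty}\eta(n)=0$.
   Context: A modulus of continuity is a continuous, subadditive, nondecreasing function $\omega$ on $[0,\infty)$ with $\omega(0)=0$. For a $2\pi$-periodic $f$, $\omega(f,\delta)=\sup_{0\le h\le\delta}\sup_{x}|f(x+h)-f(x)|$, and $H^\omega$ is the class of $2\pi$-periodic functions $f$ with $\omega(f,\delta)\le C\omega(\delta)$ for some $C$ and all sufficiently small $\delta>0$. A modulus of variation is a nondecreasing concave sequence of positive numbers $\nu(1),\nu(2),\dots$ (concave: $\nu(k+1)+\nu(k-1)\le2\nu(k)$), with the convention $\nu(0)=0$. For a function $f$ and integer $n\ge1$, $\upsilon_p(n,f)=\sup(\sum_{j=1}^n|f(I_j)|^p)^{1/p}$ over collections of $n$ nonoverlapping subintervals $I_j$ of $[0,2\pi]$, with $f(I)=f(\sup I)-f(\inf I)$. $V_p[\nu]$ is the class of bounded $2\pi$-periodic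 $f$ with $\upsilon_p(n,f)\le C\nu(n)$ for all $n$ and some $C$. Set $\varepsilon_p(k)=(\nu(k)^p-\nu(k-1)^p)^{1/p}$ and $\Delta(\gamma_k)=\gamma_k-\gamma_{k+1}$. Define $\rho(n)=\min_{1\le r\le n-1}\{\omega(1/n)\sum_{k=1}^r\frac1k+\sum_{k=r+1}^{n-1}\frac{\nu(k)}{k^{1+1/p}}\}$, let $\theta=\theta(n)$ be the smallest $r$ attaining this minimum, and $\sigma(n)=\omega(1/n)\sum_{k=1}^{\theta}\frac1k+\sum_{k=\theta+1}^{n-1}\frac{\varepsilon_p(k)}{k}$, $\tau(n)=\omega(1/n)\sum_{k=1}^{\theta}\frac1k+\sum_{k=\theta+1}^{n-1}\frac{\nu(k)-\nu(k-1)}{k^{1/p}}$, $\eta(n)=\omega(1/n)\sum_{k=1}^{\theta}\frac1k+\sum_{k=\theta+1}^{n-1}\Delta(k^{-1/p})\,\nu(k)$. *)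

theory Defs
  imports "HOL-Analysis.Analysis"
begin

definition modulus_of_continuity :: "(real \<Rightarrow> real) \<Rightarrow> bool" where
  "modulus_of_continuity \<omega> \<longleftrightarrow>
     continuous_on {0..} \<omega> \<and> \<omega> 0 = 0 \<and>
     (\<forall>s t. 0 \<le> s \<longrightarrow> s \<le> t \<longrightarrow> \<omega> s \<le> \<omega> t) \<and>
     (\<forall>s t. 0 \<le> s \<longrightarrow> 0 \<le> t \<longrightarrow> \<omega> (s + t) \<le> \<omega> s + \<omega> t)"

definition modulus_of_variation :: "(nat \<Rightarrow> real) \<Rightarrow> bool" where
  "modulus_of_variation \<nu> \<longleftrightarrow>
     \<nu> 0 = 0 \<and> (\<forall>k\<ge>1. 0 < \<nu> k) \<and> (\<forall>k\<ge>1. \<nu> k \<le> \<nu> (Suc k)) \<and>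
     (\<forall>k\<ge>2. \<nu> (k + 1) + \<nu> (k - 1) \<le> 2 * \<nu> k)"

definition periodic_2pi :: "(real \<Rightarrow> real) \<Rightarrow> bool" where
  "periodic_2pi f \<longleftrightarrow> (\<forall>x. f (x + 2 * pi) = f x)"

text \<open>H^omega: omega(f,delta) <= C omega(delta) for all sufficiently small delta > 0,
  with omega(f,delta) = sup_{0<=h<=delta} sup_x |f(x+h) - f(x)| (unfolded).\<close>
definition H_omega :: "(real \<Rightarrow> real) \<Rightarrow> (real \<Rightarrow> real) set" where
  "H_omega \<omega> = {f. periodic_2pi f \<and>
     (\<exists>C \<delta>0. 0 < \<delta>0 \<and> (\<forall>\<delta>. 0 < \<delta> \<and> \<delta> \<le> \<delta>0 \<longrightarrow>
        (\<forall>h x. 0 \<le> h \<and> h \<le> \<delta> \<longrightarrow> \<bar>f (x + h) - f x\<bar> \<le> C * \<omega> \<delta>)))}"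

definition nonoverlapping_intervals :: "nat \<Rightarrow> (nat \<Rightarrow> real) \<Rightarrow> (nat \<Rightarrow> real) \<Rightarrow> bool" where
  "nonoverlapping_intervals n a b \<longleftrightarrow>
     (\<forall>j<n. 0 \<le> a j \<and> a j \<le> b j \<and> b j \<le> 2 * pi) \<and>
     (\<forall>i<n. \<forall>j<n. i \<noteq> j \<longrightarrow> b i \<le> a j \<or> b j \<le> a i)"

definition upsilon :: "real \<Rightarrow> nat \<Rightarrow> (real \<Rightarrow> real) \<Rightarrow> real" where
  "upsilon p n f = (SUP ab \<in> {(a, b). nonoverlapping_intervals n a b}.
       (\<Sum>j<n. \<bar>f (snd ab j) - f (fst ab j)\<bar> powr p) powr (1 / p))"

definition V_p :: "real \<Rightarrow> (nat \<Rightarrow> real) \<Rightarrow> (real \<Rightarrow> real) set" where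
  "V_p p \<nu> = {f. periodic_2pi f \<and> bounded (range f) \<and>
     (\<exists>C. \<forall>n\<ge>1. upsilon p n f \<le> C * \<nu> n)}"

definition fourier_a :: "(real \<Rightarrow> real) \<Rightarrow> nat \<Rightarrow> real" where
  "fourier_a f k = integral {0..2*pi} (\<lambda>t. f t * cos (real k * t)) / pi"

definition fourier_b :: "(real \<Rightarrow> real) \<Rightarrow> nat \<Rightarrow> real" where
  "fourier_b f k = integral {0..2*pi} (\<lambda>t. f t * sin (real k * t)) / pi"

definition fourier_partial_sum :: "(real \<Rightarrow> real) \<Rightarrow> nat \<Rightarrow> real \<Rightarrow> real" where
  "fourier_partial_sum f n x = fourier_a f 0 / 2 +
     (\<Sum>k=1..n. fourier_a f k * cos (real k * x) + fourier_b f k * sin (real k * x))"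

definition rho_term :: "(real \<Rightarrow> real) \<Rightarrow> (nat \<Rightarrow> real) \<Rightarrow> real \<Rightarrow> nat \<Rightarrow> nat \<Rightarrow> real" where
  "rho_term \<omega> \<nu> p n r = \<omega> (1 / real n) * (\<Sum>k=1..r. 1 / real k) +
     (\<Sum>k=r+1..n-1. \<nu> k / real k powr (1 + 1 / p))"

definition rho :: "(real \<Rightarrow> real) \<Rightarrow> (nat \<Rightarrow> real) \<Rightarrow> real \<Rightarrow> nat \<Rightarrow> real" where
  "rho \<omega> \<nu> p n = Min (rho_term \<omega> \<nu> p n ` {1..n-1})"

definition theta :: "(real \<Rightarrow> real) \<Rightarrow> (nat \<Rightarrow> real) \<Rightarrow> real \<Rightarrow> nat \<Rightarrow> nat" where
  "theta \<omega> \<nu> p n = (LEAST r. r \<in> {1..n-1} \<and> rho_term \<omega> \<nu> p n r = rho \<omega> \<nu> p n)"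

definition eps_p :: "(nat \<Rightarrow> real) \<Rightarrow> real \<Rightarrow> nat \<Rightarrow> real" where
  "eps_p \<nu> p k = (\<nu> k powr p - \<nu> (k - 1) powr p) powr (1 / p)"

definition sigma :: "(real \<Rightarrow> real) \<Rightarrow> (nat \<Rightarrow> real) \<Rightarrow> real \<Rightarrow> nat \<Rightarrow> real" where
  "sigma \<omega> \<nu> p n = \<omega> (1 / real n) * (\<Sum>k=1..theta \<omega> \<nu> p n. 1 / real k) +
     (\<Sum>k=theta \<omega> \<nu> p n + 1..n-1. eps_p \<nu> p k / real k)"

definition tau :: "(real \<Rightarrow> real) \<Rightarrow> (nat \<Rightarrow> real) \<Rightarrow> real \<Rightarrow> nat \<Rightarrow> real" where
  "tau \<omega> \<nu> p n = \<omega> (1 / real n) * (\<Sum>k=1..theta \<omega> \<nu> p n. 1 / real k) +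
     (\<Sum>k=theta \<omega> \<nu> p n + 1..n-1. (\<nu> k - \<nu> (k - 1)) / real k powr (1 / p))"

definition eta :: "(real \<Rightarrow> real) \<Rightarrow> (nat \<Rightarrow> real) \<Rightarrow> real \<Rightarrow> nat \<Rightarrow> real" where
  "eta \<omega> \<nu> p n = \<omega> (1 / real n) * (\<Sum>k=1..theta \<omega> \<nu> p n. 1 / real k) +
     (\<Sum>k=theta \<omega> \<nu> p n + 1..n-1.
        (real k powr (- 1 / p) - real (k + 1) powr (- 1 / p)) * \<nu> k)"

end

theory Submission
  imports Defs
begin

text \<open>
  The four numerical conditions are compared termwise: concavity of \<open>\<nu>\<^sup>p\<close> makes \<open>eps_p \<nu> p\<close>
  nonincreasing, hence \<open>(\<nu> k - \<nu> (k - 1)) / k powr (1 / p) \<le> eps_p \<nu> p k / k \<le> \<nu> k / k powr (1 + 1 / p)\<close>,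
  and summation by parts closes the circle, because \<open>\<theta> n\<close> is the place where \<open>\<nu> k / k powr (1 / p)\<close>
  drops below \<open>\<omega> (1 / n)\<close>.

  For convergence, \<open>f (x + t) - f x\<close> is integrated against the Dirichlet kernel over the \<open>2 * n + 1\<close>
  cells between its zeros. Pairing neighbouring cells leaves a sum of increments of \<open>f\<close> weighted by
  \<open>1 / j\<close>; the first \<open>\<theta> n\<close> increments are bounded by \<open>\<omega>\<close>, the others by Hoelder's
  inequality and \<open>\<nu>\<close>.

  Conversely, a train of sinusoidal bumps with heights \<open>\<omega> (1 / n)\<close> for \<open>j \<le> \<theta> n\<close> and
  \<open>eps_p \<nu> p j\<close> for \<open>\<theta> n < j < n\<close> lies in both classes with a constant independent of \<open>n\<close>,
  and its \<open>n\<close>-th partial sum at \<open>0\<close> is at least \<open>sigma n / (6 * pi)\<close>. A sparse sum of such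
  trains gives a divergent series if \<open>sigma\<close> does not tend to zero.
\<close>

subsection \<open>Inequalities for powers and sums\<close>

text \<open>The upper estimate for a function in both classes produces \<open>rho\<close>, whereas a
  train can be built only with \<open>sigma\<close>, the smaller of the two; the detour through
  \<open>tau\<close> and \<open>eta\<close> makes the two bounds meet. All four sums share their
  first part, so only the tails differ. One train gives one large partial sum. Infinitely many must
  be added without leaving either class, although each may already use up a fixed multiple of
  \<omega> and of \<nu>. The way out is that a single train is Lipschitz with finitely many bumps:
  as \<omega>(t)/t tends to infinity it is negligible against \<omega> at small scales, and as \<nu>
  is unbounded it is negligible against \<nu> for many intervals. A later train is so low that it
  matters only at scales, or for numbers of intervals, where the earlier ones no longer do. In the
  deviation estimate the decay of the kernel is paired with a bound
  \<open>e + K * \<bar>x - y\<bar>\<close> instead of \<omega>: \<open>e\<close> can be made as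
  small as desired, while the \<open>K\<close>-part contributes only the order of log n / n. The
  choice \<open>e = 0\<close> then also covers single trains.\<close>

lemma powr_diff_ge:
  fixes a b p :: real
  assumes "1 \<le> p" "0 \<le> b" "b \<le> a"
  shows "(a - b) * a powr (p - 1) \<le> a powr p - b powr p"
proof -
  have *: "x powr p = x * x powr (p - 1)" if "0 \<le> x" for x :: real
    using that by (cases "x = 0") (auto simp: powr_diff)
  have "b powr (p - 1) \<le> a powr (p - 1)"
    using assms by (intro powr_mono2) auto
  then have "b * b powr (p - 1) \<le> b * a powr (p - 1)"
    using assms by (intro mult_left_mono) auto
  then show ?thesis
    using *[of a] *[of b] assms by (simp add: algebra_simps)
qed

text \<open>Follows from \<open>powr_diff_ge\<close> by enlarging
  \<open>(a - b) powr (p - 1)\<close> to \<open>a powr (p - 1)\<close>. It replaces the p-th power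
  of an increment of a nonnegative function by the increment of its p-th power, which can then be
  truncated.\<close>

lemma powr_diff_superadditive:
  fixes a b p :: real
  assumes "1 \<le> p" "0 \<le> b" "b \<le> a"
  shows "(a - b) powr p \<le> a powr p - b powr p"
proof -
  have "(a - b) powr p = (a - b) * (a - b) powr (p - 1)"
    using assms by (cases "a = b") (auto simp: powr_diff)
  also have "\<dots> \<le> (a - b) * a powr (p - 1)"
    using assms by (intro mult_left_mono powr_mono2) auto
  also have "\<dots> \<le> a powr p - b powr p"
    using assms by (rule powr_diff_ge)
  finally show ?thesis .
qed

text \<open>The endpoint 0 is included because increments may vanish; there convexity reduces to
  \<open>s powr p \<le> s\<close> for \<open>0 < s < 1\<close>.\<close>

lemma powr_convex_nonneg:
  fixes p :: real
  assumes "1 \<le> p"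
  shows "convex_on {0..} (\<lambda>x. x powr p)"
proof (rule convex_onI)
  fix t x y :: real
  assume t: "0 < t" "t < 1" and "x \<in> {0..}" "y \<in> {0..}"
  have *: "((s::real) * z) powr p \<le> s * z powr p" if "0 < s" "s < 1" "0 \<le> z" for s z
  proof -
    have "s powr p \<le> s powr 1"
      using that assms by (intro powr_mono') auto
    then show ?thesis
      using that by (auto simp: powr_mult intro!: mult_right_mono)
  qed
  show "((1 - t) *\<^sub>R x + t *\<^sub>R y) powr p \<le> (1 - t) * x powr p + t * y powr p"
  proof (cases "x = 0 \<or> y = 0")
    case True
    then show ?thesis
      using *[of t y] *[of "1 - t" x] t \<open>x \<in> {0..}\<close> \<open>y \<in> {0..}\<close> by auto
  next
    case False
    then show ?thesis
      using convex_onD[OF powr_convex[OF assms], of t x y] t \<open>x \<in> {0..}\<close> \<open>y \<in> {0..}\<close> by auto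
  qed
qed simp

text \<open>Jensen's inequality for the mean of the \<open>x i\<close>. This is Hoelder's inequality
  against the constant 1, in a form without conjugate exponent that includes
  \<open>p = 1\<close>.\<close>

lemma sum_le_card_powr_sum:
  fixes x :: "'a \<Rightarrow> real" and p :: real
  assumes p: "1 \<le> p" and A: "finite A" and x: "\<And>i. i \<in> A \<Longrightarrow> 0 \<le> x i"
  shows "(\<Sum>i\<in>A. x i) \<le> real (card A) powr (1 - 1 / p) * (\<Sum>i\<in>A. x i powr p) powr (1 / p)"
proof (cases "A = {}")
  case False
  define m where "m = real (card A)"
  have m: "m > 0"
    using False A by (auto simp: m_def card_gt_0_iff)
  have "(\<Sum>i\<in>A. (1 / m) *\<^sub>R x i) powr p \<le> (\<Sum>i\<in>A. (1 / m) * x i powr p)"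
    using A False powr_convex_nonneg[OF p] x m
    by (intro convex_on_sum[where f="\<lambda>x. x powr p" and C="{0..}"])
      (auto simp: m_def)
  then have le: "((\<Sum>i\<in>A. x i) / m) powr p \<le> (\<Sum>i\<in>A. x i powr p) / m"
    by (simp add: sum_divide_distrib)
  have nn: "0 \<le> (\<Sum>i\<in>A. x i)"
    using x by (intro sum_nonneg)
  have "(\<Sum>i\<in>A. x i) / m = (((\<Sum>i\<in>A. x i) / m) powr p) powr (1 / p)"
    using p m nn by (simp add: powr_powr)
  also have "\<dots> \<le> ((\<Sum>i\<in>A. x i powr p) / m) powr (1 / p)"
    using p le by (intro powr_mono2) auto
  also have "\<dots> = (\<Sum>i\<in>A. x i powr p) powr (1 / p) / m powr (1 / p)"
    using m by (subst powr_divide) (auto intro!: sum_nonneg)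
  finally show ?thesis
    using m by (simp add: field_simps powr_diff m_def)
qed auto

lemma Minkowski_sum:
  fixes x y :: "'a \<Rightarrow> real" and p :: real
  assumes p: "1 \<le> p" and A: "finite A"
  shows "(\<Sum>i\<in>A. \<bar>x i + y i\<bar> powr p) powr (1 / p)
    \<le> (\<Sum>i\<in>A. \<bar>x i\<bar> powr p) powr (1 / p) + (\<Sum>i\<in>A. \<bar>y i\<bar> powr p) powr (1 / p)"
proof -
  define X where "X = (\<Sum>i\<in>A. \<bar>x i\<bar> powr p) powr (1 / p)"
  define Y where "Y = (\<Sum>i\<in>A. \<bar>y i\<bar> powr p) powr (1 / p)"
  have Xp: "X powr p = (\<Sum>i\<in>A. \<bar>x i\<bar> powr p)" and Yp: "Y powr p = (\<Sum>i\<in>A. \<bar>y i\<bar> powr p)"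
    unfolding X_def Y_def using p by (simp_all add: powr_powr sum_nonneg)
  have *: "\<forall>i\<in>A. z i = 0" if "(\<Sum>i\<in>A. \<bar>z i\<bar> powr p) powr (1 / p) = 0" for z :: "'a \<Rightarrow> real"
    using that A by (simp add: sum_nonneg_eq_0_iff)
  show ?thesis
  proof (cases "X = 0 \<or> Y = 0")
    case True
    then show ?thesis
    proof
      assume "X = 0"
      then have "\<forall>i\<in>A. x i = 0"
        using * unfolding X_def by blast
      then show ?thesis by simp
    next
      assume "Y = 0"
      then have "\<forall>i\<in>A. y i = 0"
        using * unfolding Y_def by blast
      then show ?thesis by simp
    qed
  next
    case False
    then have XY: "X > 0" "Y > 0"
      by (auto simp: X_def Y_def less_le)
    \<comment> \<open>With this weight \<open>(\<bar>x i\<bar> + \<bar>y i\<bar>) / (X + Y)\<close>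
      is a convex combination of the normalised terms \<open>\<bar>x i\<bar> / X\<close> and
      \<open>\<bar>y i\<bar> / Y\<close>, whose p-th powers sum to 1.\<close>
    define t where "t = Y / (X + Y)"
    have t: "0 \<le> t" "t \<le> 1" and t': "1 - t = X / (X + Y)"
      using XY by (auto simp: t_def field_simps)
    have pt: "(\<bar>x i + y i\<bar> / (X + Y)) powr p \<le> (1 - t) * (\<bar>x i\<bar> powr p / X powr p) + t * (\<bar>y i\<bar> powr p / Y powr p)" for i
    proof -
      have "\<bar>x i + y i\<bar> / (X + Y) \<le> (1 - t) * (\<bar>x i\<bar> / X) + t * (\<bar>y i\<bar> / Y)"
      proof -
        have "(1 - t) * (\<bar>x i\<bar> / X) + t * (\<bar>y i\<bar> / Y) = (\<bar>x i\<bar> + \<bar>y i\<bar>) / (X + Y)"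
          using XY unfolding t' unfolding t_def by (simp add: add_divide_distrib)
        then show ?thesis
          using XY by (simp add: divide_right_mono)
      qed
      then have "(\<bar>x i + y i\<bar> / (X + Y)) powr p \<le> ((1 - t) * (\<bar>x i\<bar> / X) + t * (\<bar>y i\<bar> / Y)) powr p"
        using p XY by (intro powr_mono2) auto
      also have "\<dots> \<le> (1 - t) * (\<bar>x i\<bar> / X) powr p + t * (\<bar>y i\<bar> / Y) powr p"
        using convex_onD[OF powr_convex_nonneg[OF p], of t "\<bar>x i\<bar> / X" "\<bar>y i\<bar> / Y"] t XY by auto
      finally show ?thesis
        using XY by (simp add: powr_divide)
    qed
    have "(\<Sum>i\<in>A. \<bar>x i + y i\<bar> powr p) / (X + Y) powr p = (\<Sum>i\<in>A. (\<bar>x i + y i\<bar> / (X + Y)) powr p)"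
      using XY by (simp add: powr_divide sum_divide_distrib)
    also have "\<dots> \<le> (\<Sum>i\<in>A. (1 - t) * (\<bar>x i\<bar> powr p / X powr p) + t * (\<bar>y i\<bar> powr p / Y powr p))"
      by (intro sum_mono pt)
    also have "\<dots> = (1 - t) * ((\<Sum>i\<in>A. \<bar>x i\<bar> powr p) / X powr p) + t * ((\<Sum>i\<in>A. \<bar>y i\<bar> powr p) / Y powr p)"
      by (simp add: sum.distrib sum_distrib_left sum_divide_distrib)
    also have "\<dots> = 1"
      using XY by (simp flip: Xp Yp)
    finally have "(\<Sum>i\<in>A. \<bar>x i + y i\<bar> powr p) \<le> (X + Y) powr p"
      using XY by simp
    then have "(\<Sum>i\<in>A. \<bar>x i + y i\<bar> powr p) powr (1 / p) \<le> ((X + Y) powr p) powr (1 / p)"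
      using p by (intro powr_mono2) (auto intro: sum_nonneg)
    then show ?thesis
      using p XY by (simp add: powr_powr X_def Y_def)
  qed
qed

lemma Minkowski_sum_sum:
  fixes x :: "nat \<Rightarrow> 'a \<Rightarrow> real" and p :: real
  assumes p: "1 \<le> p" and A: "finite A"
  shows "(\<Sum>i\<in>A. \<bar>\<Sum>k<n. x k i\<bar> powr p) powr (1 / p) \<le> (\<Sum>k<n. (\<Sum>i\<in>A. \<bar>x k i\<bar> powr p) powr (1 / p))"
proof (induction n)
  case (Suc n)
  have "(\<Sum>i\<in>A. \<bar>\<Sum>k<Suc n. x k i\<bar> powr p) powr (1 / p)
    \<le> (\<Sum>i\<in>A. \<bar>\<Sum>k<n. x k i\<bar> powr p) powr (1 / p) + (\<Sum>i\<in>A. \<bar>x n i\<bar> powr p) powr (1 / p)"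
    using Minkowski_sum[OF p A, of "\<lambda>i. \<Sum>k<n. x k i" "x n"] by simp
  with Suc show ?case by simp
qed simp

lemma sum_by_parts_nat:
  fixes d w :: "nat \<Rightarrow> real"
  assumes "r \<le> m"
  shows "(\<Sum>k=r+1..m. (d k - d (k - 1)) * w k)
    = (\<Sum>k=r+1..m. d k * (w k - w (k + 1))) + d m * w (m + 1) - d r * w (r + 1)"
  using assms
proof (induction m rule: dec_induct)
  case (step m)
  then show ?case
    by (simp add: sum.atLeastAtMost_shift_0 algebra_simps)
qed simp

text \<open>At most one index can exceed its geometric bound; it contributes at most
  \<open>C\<close> and all others together at most 2. The summands will be the contributions of
  single trains relative to \<open>\<omega> t\<close> or to \<open>\<nu> m\<close>.\<close>

lemma sum_one_exceptional_le:
  fixes a :: "nat \<Rightarrow> real"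
  assumes nn: "\<And>i. 0 \<le> a i" and C: "\<And>i. a i \<le> C"
    and ex: "\<And>i j. i < j \<Longrightarrow> a i \<le> (1/2) ^ i \<or> a j \<le> (1/2) ^ j"
  shows "(\<Sum>i<n. a i) \<le> C + 2"
proof -
  have geo: "(\<Sum>i<n. (1/2) ^ i) \<le> (2::real)"
    using sum_gp_strict[of "1/2::real" n] by simp
  have C0: "0 \<le> C" using nn[of 0] C[of 0] by linarith
  show ?thesis
  proof (cases "\<exists>e<n. a e > (1/2) ^ e")
    case True
    then obtain e where e: "e < n" "a e > (1/2) ^ e" by blast
    have "(\<Sum>i<n. a i) = a e + (\<Sum>i\<in>{..<n} - {e}. a i)"
      using e by (simp add: sum.remove)
    also have "\<dots> \<le> C + (\<Sum>i\<in>{..<n} - {e}. (1/2) ^ i)"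
    proof (intro add_mono C sum_mono)
      fix i assume "i \<in> {..<n} - {e}"
      then show "a i \<le> (1/2) ^ i"
        using ex[of i e] ex[of e i] e by (cases i e rule: linorder_cases) auto
    qed
    also have "(\<Sum>i\<in>{..<n} - {e}. (1/2) ^ i) \<le> (\<Sum>i<n. (1/2) ^ i :: real)"
      by (intro sum_mono2) auto
    finally show ?thesis using geo by simp
  next
    case False
    then have "(\<Sum>i<n. a i) \<le> (\<Sum>i<n. (1/2) ^ i)"
      by (intro sum_mono) (meson lessThan_iff not_le)
    with geo C0 show ?thesis by linarith
  qed
qed


subsection \<open>Comparison of the numerical conditions\<close>

locale moduli =
  fixes p :: real and \<omega> :: "real \<Rightarrow> real" and \<nu> :: "nat \<Rightarrow> real"
  assumes p: "1 \<le> p"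
    and \<omega>: "modulus_of_continuity \<omega>"
    and \<omega>_lim: "filterlim (\<lambda>t. \<omega> t / t) at_top (at_right 0)"
    and \<nu>: "modulus_of_variation \<nu>"
    and \<nu>p_concave: "\<forall>k\<ge>2. \<nu> (k + 1) powr p + \<nu> (k - 1) powr p \<le> 2 * \<nu> k powr p"
    and \<nu>_inf: "filterlim \<nu> at_top sequentially"
    and \<nu>_dec: "\<forall>k\<ge>1. \<nu> (Suc k) / real (Suc k) powr (1 / p) \<le> \<nu> k / real k powr (1 / p)"
    and \<nu>_zero: "(\<lambda>k. \<nu> k / real k powr (1 / p)) \<longlonglongrightarrow> 0"
begin

abbreviation \<theta> :: "nat \<Rightarrow> nat" where "\<theta> \<equiv> theta \<omega> \<nu> p"

section \<open>Elementary consequences of the hypotheses on both moduli\<close>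

lemma p_pos: "0 < p"
  using p by simp

lemma \<nu>_0 [simp]: "\<nu> 0 = 0"
  using \<nu> by (simp add: modulus_of_variation_def)

lemma \<nu>_pos: "1 \<le> k \<Longrightarrow> 0 < \<nu> k"
  using \<nu> by (simp add: modulus_of_variation_def)

lemma \<nu>_nonneg: "0 \<le> \<nu> k"
  using \<nu>_pos[of k] by (cases k) auto

lemma \<nu>_mono: "j \<le> k \<Longrightarrow> \<nu> j \<le> \<nu> k"
proof (induction k rule: dec_induct)
  case (step k)
  moreover have "\<nu> k \<le> \<nu> (Suc k)"
    using \<nu> \<nu>_nonneg[of 1] by (cases k) (auto simp: modulus_of_variation_def)
  ultimately show ?case by linarith
qed simp

lemma \<nu>_ratio_antimono:
  assumes "1 \<le> j" "j \<le> k"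
  shows "\<nu> k / real k powr (1 / p) \<le> \<nu> j / real j powr (1 / p)"
  using assms(2)
proof (induction k rule: dec_induct)
  case (step k)
  then show ?case using \<nu>_dec[rule_format, of k] assms(1) by linarith
qed simp

lemma \<omega>_0 [simp]: "\<omega> 0 = 0"
  using \<omega> by (simp add: modulus_of_continuity_def)

lemma \<omega>_mono: "0 \<le> s \<Longrightarrow> s \<le> t \<Longrightarrow> \<omega> s \<le> \<omega> t"
  using \<omega> by (simp add: modulus_of_continuity_def)

lemma \<omega>_nonneg: "0 \<le> t \<Longrightarrow> 0 \<le> \<omega> t"
  using \<omega>_mono[of 0 t] by simp

lemma \<omega>_mult: "0 \<le> t \<Longrightarrow> \<omega> (real n * t) \<le> real n * \<omega> t"
proof (induction n)
  case (Suc n)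
  have "\<omega> (real (Suc n) * t) = \<omega> (real n * t + t)"
    by (simp add: algebra_simps)
  also have "\<dots> \<le> \<omega> (real n * t) + \<omega> t"
    using \<omega> Suc.prems by (simp add: modulus_of_continuity_def)
  finally show ?case using Suc by (simp add: algebra_simps)
qed simp

text \<open>At small scales \<omega> beats every Lipschitz constant. This will make a fixed train
  negligible there.\<close>

lemma \<omega>_ge_linear: "\<exists>d>0. \<forall>t. 0 < t \<and> t \<le> d \<longrightarrow> K * t \<le> \<omega> t"
proof -
  have "eventually (\<lambda>t. K \<le> \<omega> t / t) (at_right 0)"
    using \<omega>_lim by (simp add: filterlim_at_top)
  then obtain b where b: "b > 0" "\<And>t. 0 < t \<Longrightarrow> t < b \<Longrightarrow> K \<le> \<omega> t / t"
    by (auto simp: eventually_at_right_field)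
  then have "K * t \<le> \<omega> t" if "0 < t" "t \<le> b / 2" for t
    using that b(2)[of t] by (auto simp: field_simps)
  with b(1) show ?thesis
    by (intro exI[of _ "b / 2"]) auto
qed

lemma \<omega>_pos: "0 < t \<Longrightarrow> 0 < \<omega> t"
proof -
  assume t: "0 < t"
  obtain d where d: "d > 0" "\<And>t. 0 < t \<Longrightarrow> t \<le> d \<Longrightarrow> 1 * t \<le> \<omega> t"
    using \<omega>_ge_linear[of 1] by blast
  have "min t d \<le> \<omega> (min t d)"
    using d(2)[of "min t d"] d(1) t by auto
  also have "\<dots> \<le> \<omega> t"
    using t d by (intro \<omega>_mono) auto
  finally show ?thesis using t d by auto
qed

lemma \<omega>_tendsto_0: "(\<lambda>n. \<omega> (1 / real n)) \<longlonglongrightarrow> 0"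
proof -
  have "(\<omega> \<longlongrightarrow> \<omega> 0) (at 0 within {0..})"
    using \<omega> unfolding modulus_of_continuity_def continuous_on_def by (metis atLeast_iff order_refl)
  moreover have "filterlim (\<lambda>n. 1 / real n) (at 0 within {0..}) sequentially"
    unfolding filterlim_at by (auto intro!: lim_1_over_n eventually_sequentiallyI[of 1])
  ultimately show ?thesis
    using filterlim_compose by fastforce
qed

text \<open>Subadditivity alone does not make \<omega>(t)/t nonincreasing; it does so up to a factor
  2, the price of rounding \<open>t / s\<close> up to an integer.\<close>

lemma \<omega>_ratio_le: "0 < s \<Longrightarrow> s \<le> t \<Longrightarrow> s * \<omega> t \<le> 2 * t * \<omega> s"
proof -
  assume st: "0 < s" "s \<le> t"
  define m where "m = nat \<lceil>t / s\<rceil>"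
  have m1: "t / s \<le> real m" and m2: "real m \<le> t / s + 1"
    using st by (auto simp: m_def)
  have "\<omega> t \<le> \<omega> (real m * s)"
    using m1 st by (intro \<omega>_mono) (auto simp: field_simps)
  also have "\<dots> \<le> real m * \<omega> s"
    using st by (intro \<omega>_mult) auto
  also have "\<dots> \<le> (2 * t / s) * \<omega> s"
  proof (intro mult_right_mono \<omega>_nonneg)
    have "1 \<le> t / s" using st by simp
    then show "real m \<le> 2 * t / s" using m2 by linarith
  qed (use st in auto)
  finally show ?thesis using st by (simp add: field_simps)
qed

section \<open>Monotonicity and size of \<open>eps_p\<close>\<close>

lemma \<nu>_powr_step: "k \<ge> 1 \<Longrightarrow> \<nu> (k + 1) powr p - \<nu> k powr p \<le> \<nu> k powr p - \<nu> (k - 1) powr p"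
proof (cases "k = 1")
  \<comment> \<open>Concavity of the p-th powers is assumed from index 2 on. At index 1, where
    \<open>\<nu> 0 = 0\<close>, the inequality says
    \<open>\<nu> 2 powr p \<le> 2 * \<nu> 1 powr p\<close>, which is the monotonicity of the
    ratio.\<close>
  case True
  have "\<nu> 2 / 2 powr (1 / p) \<le> \<nu> 1"
    using \<nu>_ratio_antimono[of 1 2] by simp
  then have "(\<nu> 2 / 2 powr (1 / p)) powr p \<le> \<nu> 1 powr p"
    using \<nu>_nonneg p by (intro powr_mono2) auto
  then have "\<nu> 2 powr p / 2 \<le> \<nu> 1 powr p"
    using p \<nu>_nonneg by (simp add: powr_divide powr_powr)
  then show ?thesis
    using True by (simp add: numeral_2_eq_2)
qed (use \<nu>p_concave in \<open>auto simp: algebra_simps\<close>)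

lemma eps_p_powr: "eps_p \<nu> p k powr p = \<nu> k powr p - \<nu> (k - 1) powr p"
proof -
  have "\<nu> (k - 1) powr p \<le> \<nu> k powr p"
    using p \<nu>_mono \<nu>_nonneg by (intro powr_mono2) auto
  then show ?thesis
    using p by (simp add: eps_p_def powr_powr)
qed

lemma eps_p_nonneg: "0 \<le> eps_p \<nu> p k"
  by (simp add: eps_p_def)

lemma eps_p_Suc_le: "k \<ge> 1 \<Longrightarrow> eps_p \<nu> p (Suc k) \<le> eps_p \<nu> p k"
proof -
  assume k: "k \<ge> 1"
  have "\<nu> k powr p \<le> \<nu> (Suc k) powr p"
    using p \<nu>_mono \<nu>_nonneg by (intro powr_mono2) auto
  then show ?thesis
    unfolding eps_p_def using \<nu>_powr_step[OF k] p by (intro powr_mono2) auto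
qed

lemma eps_p_antimono:
  assumes "1 \<le> j" "j \<le> k"
  shows "eps_p \<nu> p k \<le> eps_p \<nu> p j"
  using assms(2)
proof (induction k rule: dec_induct)
  case (step k)
  then show ?case using eps_p_Suc_le[of k] assms(1) by linarith
qed simp

lemma sum_eps_p_powr: "j \<le> m \<Longrightarrow> (\<Sum>k=j+1..m. eps_p \<nu> p k powr p) = \<nu> m powr p - \<nu> j powr p"
  by (induction m rule: dec_induct) (auto simp: eps_p_powr)

text \<open>The p-th powers of \<open>eps_p\<close> telescope to \<open>\<nu> k powr p\<close>, and
  the last of these k terms is the smallest.\<close>

lemma eps_p_le: "k \<ge> 1 \<Longrightarrow> eps_p \<nu> p k \<le> \<nu> k / real k powr (1 / p)"
proof -
  assume k: "k \<ge> 1"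
  have "real k * eps_p \<nu> p k powr p = (\<Sum>j=1..k. eps_p \<nu> p k powr p)"
    by simp
  also have "\<dots> \<le> (\<Sum>j=1..k. eps_p \<nu> p j powr p)"
    using p eps_p_nonneg eps_p_antimono by (intro sum_mono powr_mono2) auto
  also have "\<dots> = \<nu> k powr p"
    using sum_eps_p_powr[of 0 k] p by simp
  finally have "eps_p \<nu> p k powr p \<le> \<nu> k powr p / real k"
    using k by (simp add: field_simps)
  then have "(eps_p \<nu> p k powr p) powr (1 / p) \<le> (\<nu> k powr p / real k) powr (1 / p)"
    using p by (intro powr_mono2) auto
  then show ?thesis
    using p eps_p_nonneg \<nu>_nonneg by (simp add: powr_divide powr_powr)
qed

text \<open>\<open>powr_diff_ge\<close> bounds the increment of \<nu> times
  \<open>\<nu> k powr (p - 1)\<close> by \<open>e powr p\<close>. Since \<open>\<nu> k\<close> is at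
  least \<open>e * q\<close>, it may be replaced by that product, after which the powers of
  \<open>e\<close> cancel; this is why \<open>e = 0\<close> is treated apart.\<close>

lemma \<nu>_diff_le_eps_p: "k \<ge> 1 \<Longrightarrow> (\<nu> k - \<nu> (k - 1)) / real k powr (1 / p) \<le> eps_p \<nu> p k / real k"
proof -
  assume k: "k \<ge> 1"
  define e where "e = eps_p \<nu> p k"
  define q where "q = real k powr (1 / p)"
  have q: "q > 0" and qp: "q powr p = real k"
    using k p by (auto simp: q_def powr_powr)
  have e: "e \<ge> 0" and eq: "e * q \<le> \<nu> k"
    using eps_p_nonneg eps_p_le[OF k] q by (auto simp: e_def q_def field_simps)
  have 1: "(\<nu> k - \<nu> (k - 1)) * \<nu> k powr (p - 1) \<le> e powr p"
    using powr_diff_ge[OF p \<nu>_nonneg \<nu>_mono] by (simp add: e_def eps_p_powr)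
  have dn: "0 \<le> \<nu> k - \<nu> (k - 1)"
    using \<nu>_mono by simp
  have "(\<nu> k - \<nu> (k - 1)) / q \<le> e / real k"
  proof (cases "e = 0")
    case True
    then have "(\<nu> k - \<nu> (k - 1)) * \<nu> k powr (p - 1) \<le> 0"
      using 1 p by simp
    then have "\<nu> k - \<nu> (k - 1) = 0"
      using dn \<nu>_pos[OF k] by (simp add: mult_le_0_iff)
    then show ?thesis using True by simp
  next
    case False
    then have e': "e > 0" using e by simp
    have "(\<nu> k - \<nu> (k - 1)) * (e * q) powr (p - 1) \<le> e powr p"
      using 1 dn mult_left_mono[OF powr_mono2[of "p - 1" "e * q" "\<nu> k"] dn] eq e q p by auto
    then have "(\<nu> k - \<nu> (k - 1)) * (e powr p / e * (real k / q)) \<le> e powr p"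
      using e' q by (simp add: powr_mult powr_diff qp)
    then have "((\<nu> k - \<nu> (k - 1)) * real k / (e * q)) * e powr p \<le> 1 * e powr p"
      by (simp add: mult_ac)
    then have "(\<nu> k - \<nu> (k - 1)) * real k / (e * q) \<le> 1"
      using e' by (subst (asm) mult_le_cancel_right_pos) auto
    then show ?thesis
      using e' q k by (simp add: field_simps)
  qed
  then show ?thesis by (simp add: e_def q_def)
qed

section \<open>Position of the minimising index\<close>

lemma theta_minimal:
  assumes "n \<ge> 2"
  shows theta_ge: "1 \<le> \<theta> n" and theta_le: "\<theta> n \<le> n - 1"
    and rho_eq: "rho \<omega> \<nu> p n = rho_term \<omega> \<nu> p n (\<theta> n)"
    and rho_term_ge: "\<And>r. 1 \<le> r \<Longrightarrow> r \<le> n - 1 \<Longrightarrow> rho_term \<omega> \<nu> p n (\<theta> n) \<le> rho_term \<omega> \<nu> p n r"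
proof -
  have "rho \<omega> \<nu> p n \<in> rho_term \<omega> \<nu> p n ` {1..n-1}"
    unfolding rho_def using assms by (intro Min_in) auto
  then have "\<exists>r. r \<in> {1..n-1} \<and> rho_term \<omega> \<nu> p n r = rho \<omega> \<nu> p n"
    by auto
  from LeastI_ex[OF this] have *: "\<theta> n \<in> {1..n-1}" "rho_term \<omega> \<nu> p n (\<theta> n) = rho \<omega> \<nu> p n"
    unfolding theta_def by blast+
  then show "1 \<le> \<theta> n" "\<theta> n \<le> n - 1" "rho \<omega> \<nu> p n = rho_term \<omega> \<nu> p n (\<theta> n)"
    by auto
  show "rho_term \<omega> \<nu> p n (\<theta> n) \<le> rho_term \<omega> \<nu> p n r" if "1 \<le> r" "r \<le> n - 1" for r
    using that unfolding *(2) rho_def by (intro Min_le) auto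
qed

text \<open>The sign of this step compares \<open>\<omega> (1 / real n)\<close> with a nonincreasing
  ratio, so it changes at most once, and minimality of \<open>\<theta> n\<close> locates the
  crossing.\<close>

lemma rho_term_Suc:
  assumes "Suc r \<le> n - 1"
  shows "rho_term \<omega> \<nu> p n (Suc r) - rho_term \<omega> \<nu> p n r
    = (\<omega> (1 / real n) - \<nu> (Suc r) / real (Suc r) powr (1 / p)) / real (Suc r)"
proof -
  have "(\<Sum>k=r+1..n-1. \<nu> k / real k powr (1 + 1 / p))
    = \<nu> (Suc r) / real (Suc r) powr (1 + 1 / p) + (\<Sum>k=Suc r+1..n-1. \<nu> k / real k powr (1 + 1 / p))"
    using assms by (simp add: sum.atLeast_Suc_atMost)
  then show ?thesis
    by (simp add: rho_term_def powr_add algebra_simps diff_divide_distrib)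
qed

lemma \<nu>_ratio_le_\<omega>:
  assumes "n \<ge> 2" "\<theta> n < k" "k \<le> n - 1"
  shows "\<nu> k / real k powr (1 / p) \<le> \<omega> (1 / real n)"
proof -
  have "rho_term \<omega> \<nu> p n (Suc (\<theta> n)) - rho_term \<omega> \<nu> p n (\<theta> n) \<ge> 0"
    using rho_term_ge[OF assms(1), of "Suc (\<theta> n)"] assms by auto
  then have "\<nu> (Suc (\<theta> n)) / real (Suc (\<theta> n)) powr (1 / p) \<le> \<omega> (1 / real n)"
    using assms by (subst (asm) rho_term_Suc) (auto simp: zero_le_divide_iff)
  moreover have "\<nu> k / real k powr (1 / p) \<le> \<nu> (Suc (\<theta> n)) / real (Suc (\<theta> n)) powr (1 / p)"
    using assms by (intro \<nu>_ratio_antimono) auto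
  ultimately show ?thesis by linarith
qed

text \<open>The minimum is taken over \<open>r \<ge> 1\<close>, so for \<open>\<theta> n = 1\<close>
  there is no step from below to compare with; the assumption
  \<open>\<omega> (1 / real n) \<le> \<nu> 1\<close>, true for large \<open>n\<close>, covers that
  case.\<close>

lemma \<omega>_le_\<nu>_ratio:
  assumes "n \<ge> 2" "1 \<le> k" "k \<le> \<theta> n" "\<omega> (1 / real n) \<le> \<nu> 1"
  shows "\<omega> (1 / real n) \<le> \<nu> k / real k powr (1 / p)"
proof -
  have "\<omega> (1 / real n) \<le> \<nu> (\<theta> n) / real (\<theta> n) powr (1 / p)"
  proof (cases "\<theta> n = 1")
    case False
    then obtain r where r: "\<theta> n = Suc r" "1 \<le> r"
      using theta_ge[OF assms(1)] by (cases "\<theta> n") auto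
    have "rho_term \<omega> \<nu> p n (Suc r) - rho_term \<omega> \<nu> p n r \<le> 0"
      using rho_term_ge[OF assms(1), of r] r theta_le[OF assms(1)] by auto
    then show ?thesis
      using r theta_le[OF assms(1)] by (subst (asm) rho_term_Suc) (auto simp: divide_le_0_iff)
  qed (use assms in simp)
  also have "\<dots> \<le> \<nu> k / real k powr (1 / p)"
    using assms by (intro \<nu>_ratio_antimono) auto
  finally show ?thesis .
qed

section \<open>The cycle of estimates among the four sequences\<close>

lemma tau_le_sigma: "tau \<omega> \<nu> p n \<le> sigma \<omega> \<nu> p n"
  unfolding tau_def sigma_def by (intro add_left_mono sum_mono \<nu>_diff_le_eps_p) auto

lemma sigma_le_rho:
  assumes "n \<ge> 2"
  shows "sigma \<omega> \<nu> p n \<le> rho \<omega> \<nu> p n"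
  unfolding rho_eq[OF assms] sigma_def rho_term_def
proof (intro add_left_mono sum_mono)
  fix k assume "k \<in> {\<theta> n + 1..n - 1}"
  then show "eps_p \<nu> p k / real k \<le> \<nu> k / real k powr (1 + 1 / p)"
    using eps_p_le[of k] by (auto simp: powr_add divide_right_mono field_simps)
qed

text \<open>The mean value theorem at a point \<open>z < k + 1 \<le> 2 * k\<close>: the derivative
  supplies the factor \<open>p\<close>, and replacing \<open>z\<close> by \<open>2 * k\<close> costs
  the power of 2.\<close>

lemma powr_step_bounds:
  assumes "k \<ge> 1"
  shows "0 \<le> real k powr (- 1 / p) - real (k + 1) powr (- 1 / p)"
    and "1 / real k powr (1 + 1 / p) \<le> 2 powr (1 + 1 / p) * p * (real k powr (- 1 / p) - real (k + 1) powr (- 1 / p))"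
proof -
  show "0 \<le> real k powr (- 1 / p) - real (k + 1) powr (- 1 / p)"
    using assms p powr_mono2'[of "- 1 / p" "real k" "real (k + 1)"] by simp
  have "\<exists>z. real k < z \<and> z < real k + 1 \<and> (real k + 1) powr (- 1 / p) - real k powr (- 1 / p)
      = (real k + 1 - real k) * ((- 1 / p) * z powr (- 1 / p - 1))"
    using assms by (intro MVT2) (auto intro!: derivative_eq_intros simp: powr_diff)
  then obtain z where z: "real k < z" "z < real k + 1"
    "real k powr (- 1 / p) - (real k + 1) powr (- 1 / p) = z powr (- 1 / p - 1) / p"
    by (auto simp: algebra_simps)
  have z_exp: "- 1 / p - 1 = - (1 + 1 / p)"
    by simp
  have "(2 * real k) powr (- (1 + 1 / p)) \<le> z powr (- (1 + 1 / p))"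
    using z assms p by (intro powr_mono2') (auto intro: order_trans[of _ 0])
  then have "1 / real k powr (1 + 1 / p) \<le> 2 powr (1 + 1 / p) * z powr (- (1 + 1 / p))"
    using powr_minus_divide[of "2 * real k" "1 + 1 / p"] by (simp add: powr_mult divide_le_eq mult_ac)
  then show "1 / real k powr (1 + 1 / p) \<le> 2 powr (1 + 1 / p) * p * (real k powr (- 1 / p) - real (k + 1) powr (- 1 / p))"
    using p z(3) unfolding z_exp by (simp add: add.commute)
qed

lemma rho_le_eta:
  assumes "n \<ge> 2"
  shows "rho \<omega> \<nu> p n \<le> 2 powr (1 + 1 / p) * p * eta \<omega> \<nu> p n"
proof -
  define C where "C = 2 powr (1 + 1 / p) * p"
  \<comment> \<open>The constant must be at least 1 because it also multiplies the first part, which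
    both sides share.\<close>
  have "1 \<le> 2 powr (1 + 1 / p)"
    using p by (intro ge_one_powr_ge_zero) auto
  then have C: "1 \<le> C"
    using p mult_mono[of 1 "2 powr (1 + 1 / p)" 1 p] by (simp add: C_def)
  have "0 \<le> \<omega> (1 / real n) * (\<Sum>k=1..\<theta> n. 1 / real k)"
    by (intro mult_nonneg_nonneg \<omega>_nonneg sum_nonneg) auto
  then have "\<omega> (1 / real n) * (\<Sum>k=1..\<theta> n. 1 / real k) \<le> C * (\<omega> (1 / real n) * (\<Sum>k=1..\<theta> n. 1 / real k))"
    using C by (simp add: mult_le_cancel_right1)
  moreover have "(\<Sum>k=\<theta> n+1..n-1. \<nu> k / real k powr (1 + 1 / p))
    \<le> C * (\<Sum>k=\<theta> n+1..n-1. (real k powr (- 1 / p) - real (k + 1) powr (- 1 / p)) * \<nu> k)"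
    unfolding sum_distrib_left
  proof (intro sum_mono)
    fix k assume "k \<in> {\<theta> n+1..n-1}"
    then show "\<nu> k / real k powr (1 + 1 / p) \<le> C * ((real k powr (- 1 / p) - real (k + 1) powr (- 1 / p)) * \<nu> k)"
      using mult_right_mono[OF powr_step_bounds(2)[of k] \<nu>_nonneg[of k]] by (simp add: C_def mult.assoc)
  qed
  ultimately show ?thesis
    unfolding rho_eq[OF assms] eta_def rho_term_def C_def by (simp add: algebra_simps)
qed

lemma tau_nonneg: "0 \<le> tau \<omega> \<nu> p n"
  unfolding tau_def
  by (intro add_nonneg_nonneg mult_nonneg_nonneg \<omega>_nonneg sum_nonneg divide_nonneg_nonneg) (auto intro: \<nu>_mono)

lemma eta_nonneg: "0 \<le> eta \<omega> \<nu> p n"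
  unfolding eta_def
  by (intro add_nonneg_nonneg mult_nonneg_nonneg \<omega>_nonneg sum_nonneg powr_step_bounds(1) \<nu>_nonneg) auto

text \<open>Summation by parts turns the tail of \<open>tau\<close> into that of \<open>eta\<close>
  plus two boundary terms. The upper one has the right sign. The lower one is at most
  \<open>\<omega> (1 / real n)\<close> if the tail is nonempty; if \<open>\<theta> n = n - 1\<close>
  it is at most the last ratio. Both tend to 0, so the error is harmless.\<close>

lemma eta_le_tau:
  assumes "n \<ge> 2"
  shows "eta \<omega> \<nu> p n \<le> tau \<omega> \<nu> p n + \<omega> (1 / real n) + \<nu> (n - 1) / real (n - 1) powr (1 / p)"
proof -
  define w where "w k = real k powr (- 1 / p)" for k
  have w: "w k = 1 / real k powr (1 / p)" for k
    by (simp add: w_def powr_minus_divide)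
  have "(\<Sum>k=\<theta> n+1..n-1. (\<nu> k - \<nu> (k - 1)) * w k) =
     (\<Sum>k=\<theta> n+1..n-1. \<nu> k * (w k - w (k + 1))) + \<nu> (n - 1) * w n - \<nu> (\<theta> n) * w (\<theta> n + 1)"
    using sum_by_parts_nat[OF theta_le[OF assms], of \<nu> w] assms by simp
  moreover have "\<nu> (\<theta> n) * w (\<theta> n + 1) \<le> \<omega> (1 / real n) + \<nu> (n - 1) / real (n - 1) powr (1 / p)"
  proof (cases "\<theta> n + 1 \<le> n - 1")
    case True
    have "\<nu> (\<theta> n) * w (\<theta> n + 1) \<le> \<nu> (\<theta> n + 1) / real (\<theta> n + 1) powr (1 / p)"
      using \<nu>_mono[of "\<theta> n" "\<theta> n + 1"] unfolding w by (simp add: divide_right_mono)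
    also have "\<dots> \<le> \<omega> (1 / real n)"
      using assms True by (intro \<nu>_ratio_le_\<omega>) auto
    finally show ?thesis
      using \<nu>_nonneg[of "n - 1"] by (smt (verit) divide_nonneg_nonneg powr_ge_zero)
  next
    case False
    then have th: "\<theta> n = n - 1"
      using theta_le[OF assms] by linarith
    have "w n \<le> w (n - 1)"
      using assms p powr_step_bounds(1)[of "n - 1"] by (simp add: w_def)
    then have "\<nu> (\<theta> n) * w (\<theta> n + 1) \<le> \<nu> (n - 1) / real (n - 1) powr (1 / p)"
      using th assms mult_left_mono[OF _ \<nu>_nonneg[of "n - 1"]] unfolding w by fastforce
    then show ?thesis using \<omega>_nonneg[of "1 / real n"] by simp
  qed
  moreover have "0 \<le> \<nu> (n - 1) * w n"
    using \<nu>_nonneg by (simp add: w)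
  moreover have "tau \<omega> \<nu> p n = \<omega> (1 / real n) * (\<Sum>k=1..\<theta> n. 1 / real k) + (\<Sum>k=\<theta> n+1..n-1. (\<nu> k - \<nu> (k - 1)) * w k)"
    by (simp add: tau_def w)
  moreover have "eta \<omega> \<nu> p n = \<omega> (1 / real n) * (\<Sum>k=1..\<theta> n. 1 / real k) + (\<Sum>k=\<theta> n+1..n-1. \<nu> k * (w k - w (k + 1)))"
    by (simp add: eta_def w_def mult.commute)
  ultimately show ?thesis by linarith
qed

lemma \<nu>_pred_ratio_tendsto_0: "(\<lambda>n. \<nu> (n - 1) / real (n - 1) powr (1 / p)) \<longlonglongrightarrow> 0"
  using \<nu>_zero by (subst filterlim_sequentially_Suc[symmetric]) simp

lemma rho_tendsto_0_imp_sigma: "rho \<omega> \<nu> p \<longlonglongrightarrow> 0 \<Longrightarrow> sigma \<omega> \<nu> p \<longlonglongrightarrow> 0"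
  by (rule tendsto_sandwich[where f="\<lambda>_. 0"])
    (auto intro!: eventually_sequentiallyI[of 2] sigma_le_rho order_trans[OF tau_nonneg tau_le_sigma])

lemma sigma_tendsto_0_imp_tau: "sigma \<omega> \<nu> p \<longlonglongrightarrow> 0 \<Longrightarrow> tau \<omega> \<nu> p \<longlonglongrightarrow> 0"
  by (rule tendsto_sandwich[where f="\<lambda>_. 0"]) (auto intro!: always_eventually tau_nonneg tau_le_sigma)

lemma tau_tendsto_0_imp_eta: "tau \<omega> \<nu> p \<longlonglongrightarrow> 0 \<Longrightarrow> eta \<omega> \<nu> p \<longlonglongrightarrow> 0"
proof (rule tendsto_sandwich[where f="\<lambda>_. 0"])
  assume "tau \<omega> \<nu> p \<longlonglongrightarrow> 0"
  then have "(\<lambda>n. tau \<omega> \<nu> p n + \<omega> (1 / real n) + \<nu> (n - 1) / real (n - 1) powr (1 / p)) \<longlonglongrightarrow> 0 + 0 + 0"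
    by (intro tendsto_add \<omega>_tendsto_0 \<nu>_pred_ratio_tendsto_0)
  then show "(\<lambda>n. tau \<omega> \<nu> p n + \<omega> (1 / real n) + \<nu> (n - 1) / real (n - 1) powr (1 / p)) \<longlonglongrightarrow> 0"
    by simp
qed (use eta_le_tau in \<open>auto intro!: eventually_sequentiallyI[of 2] eta_nonneg simp del: of_nat_diff\<close>)

lemma eta_tendsto_0_imp_rho: "eta \<omega> \<nu> p \<longlonglongrightarrow> 0 \<Longrightarrow> rho \<omega> \<nu> p \<longlonglongrightarrow> 0"
proof (rule tendsto_sandwich[where f="\<lambda>_. 0"])
  assume "eta \<omega> \<nu> p \<longlonglongrightarrow> 0"
  then show "(\<lambda>n. 2 powr (1 + 1 / p) * p * eta \<omega> \<nu> p n) \<longlonglongrightarrow> 0"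
    by (rule tendsto_mult_right_zero)
qed (auto intro!: eventually_sequentiallyI[of 2] rho_le_eta
      order_trans[OF order_trans[OF tau_nonneg tau_le_sigma] sigma_le_rho])

end


subsection \<open>The Dirichlet kernel on cells\<close>

text \<open>Normalised to have integral \<open>pi\<close> over a period, hence the division by
  \<open>pi\<close> in the formulas for the partial sums.\<close>

definition dirichlet_kernel :: "nat \<Rightarrow> real \<Rightarrow> real" where
  "dirichlet_kernel n t = 1 / 2 + (\<Sum>k=1..n. cos (real k * t))"

definition cell :: "nat \<Rightarrow> real" where
  "cell n = 2 * pi / (2 * real n + 1)"

lemma cell_pos: "0 < cell n"
  by (simp add: cell_def add_nonneg_pos)

lemma cell_mult: "(2 * real n + 1) * cell n = 2 * pi"
  by (simp add: cell_def add_nonneg_eq_0_iff)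

lemma cell_mult': "(real n + 1 / 2) * cell n = pi"
  using cell_mult[of n] by (simp add: algebra_simps)

lemma continuous_on_dirichlet_kernel [continuous_intros]:
  fixes g :: "'a::t2_space \<Rightarrow> real"
  shows "continuous_on A g \<Longrightarrow> continuous_on A (\<lambda>t. dirichlet_kernel n (g t))"
  unfolding dirichlet_kernel_def by (auto intro!: continuous_intros)

text \<open>The sum telescopes after multiplication by \<open>2 * sin (t / 2)\<close>. The product
  form stays valid where this factor vanishes.\<close>

lemma dirichlet_kernel_mult: "2 * sin (t / 2) * dirichlet_kernel n t = sin ((real n + 1 / 2) * t)"
proof (induction n)
  case (Suc n)
  have "2 * sin (t / 2) * cos (real (Suc n) * t) = sin ((real (Suc n) + 1 / 2) * t) - sin ((real n + 1 / 2) * t)"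
  proof -
    have "(real (Suc n) + 1 / 2) * t = real (Suc n) * t + t / 2" "(real n + 1 / 2) * t = real (Suc n) * t - t / 2"
      by (simp_all add: algebra_simps)
    then show ?thesis by (simp add: sin_add sin_diff del: of_nat_Suc)
  qed
  with Suc show ?case
    by (simp add: dirichlet_kernel_def algebra_simps)
qed (simp add: dirichlet_kernel_def)

lemma abs_dirichlet_kernel_le: "\<bar>dirichlet_kernel n t\<bar> \<le> real n + 1 / 2"
proof -
  have "\<bar>\<Sum>k=1..n. cos (real k * t)\<bar> \<le> (\<Sum>k=1..n. 1)"
    by (intro order_trans[OF sum_abs] sum_mono) auto
  then show ?thesis by (simp add: dirichlet_kernel_def)
qed

section \<open>Periodic functions and integration over cells\<close>

lemma integral_shift_real:
  fixes g :: "real \<Rightarrow> real"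
  shows "integral {a..b} (\<lambda>t. g (c + t)) = integral {a+c..b+c} g"
  using integral_shift_Icc_real[of a b g c] by (simp add: o_def)

lemma periodic_2pi_int:
  assumes "periodic_2pi f"
  shows "f (x + 2 * pi * of_int m) = f x"
proof -
  have nat: "f (x + 2 * pi * real k) = f x" for k x
  proof (induction k)
    case (Suc k)
    have "f (x + 2 * pi * real (Suc k)) = f ((x + 2 * pi * real k) + 2 * pi)"
      by (simp add: algebra_simps)
    with Suc assms show ?case by (simp add: periodic_2pi_def)
  qed simp
  show ?thesis
  proof (cases "0 \<le> m")
    case True
    then show ?thesis using nat[of x "nat m"] by simp
  next
    case False
    then show ?thesis using nat[of "x + 2 * pi * of_int m" "nat (- m)"] by simp
  qed
qed

lemma periodic_2pi_reduce:
  obtains m :: int and z where "0 \<le> z" "z < 2 * pi" "x = z + 2 * pi * of_int m"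
proof
  show "0 \<le> x - 2 * pi * of_int \<lfloor>x / (2 * pi)\<rfloor>"
    using of_int_floor_le[of "x / (2 * pi)"] by (subst (asm) pos_le_divide_eq) (auto simp: mult_ac)
  show "x - 2 * pi * of_int \<lfloor>x / (2 * pi)\<rfloor> < 2 * pi"
    using floor_correct[of "x / (2 * pi)"] by (simp add: field_simps)
qed simp

lemma integral_periodic_shift:
  fixes g :: "real \<Rightarrow> real"
  assumes cont: "continuous_on UNIV g" and per: "periodic_2pi g"
  shows "integral {0..2*pi} (\<lambda>t. g (x + t)) = integral {0..2*pi} g"
proof -
  have int: "g integrable_on {a..b}" for a b
    using cont by (intro integrable_continuous_real) (rule continuous_on_subset, auto)
  obtain m :: int and z where z: "0 \<le> z" "z < 2 * pi" "x = z + 2 * pi * of_int m"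
    by (rule periodic_2pi_reduce)
  have "g (x + t) = g (z + t)" for t
    using periodic_2pi_int[OF per, of "z + t" m] z(3) by (simp add: algebra_simps)
  then have "integral {0..2*pi} (\<lambda>t. g (x + t)) = integral {z..2*pi+z} g"
    using integral_shift_real[of 0 "2 * pi" g z] by simp
  also have "\<dots> = integral {z..2*pi} g + integral {2*pi..2*pi+z} g"
    using z by (intro Henstock_Kurzweil_Integration.integral_combine[symmetric] int) auto
  also have "integral {2*pi..2*pi+z} g = integral {0..z} (\<lambda>t. g (2 * pi + t))"
    using integral_shift_real[of 0 z g "2 * pi"] by (simp add: add.commute)
  also have "(\<lambda>t. g (2 * pi + t)) = g"
    using per by (simp add: periodic_2pi_def add.commute)
  also have "integral {z..2*pi} g + integral {0..z} g = integral {0..2*pi} g"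
    using z Henstock_Kurzweil_Integration.integral_combine[of 0 z "2 * pi" g] int by simp
  finally show ?thesis .
qed

text \<open>Folding all cells onto the first one leaves a finite sum under the integral, so that
  cancellation between cells can be exploited for each fixed \<open>s\<close>.\<close>

lemma integral_split_cells:
  fixes g :: "real \<Rightarrow> real"
  assumes cont: "continuous_on UNIV g" and h: "0 \<le> h"
  shows "integral {0..real m * h} g = integral {0..h} (\<lambda>s. \<Sum>k<m. g (s + real k * h))"
proof -
  have int: "g integrable_on {a..b}" for a b
    using cont by (intro integrable_continuous_real) (rule continuous_on_subset, auto)
  have int': "(\<lambda>s. g (s + c)) integrable_on {a..b}" for a b c
    by (intro integrable_continuous_real continuous_on_compose2[OF cont] continuous_intros) auto
  have "integral {0..real m * h} g = (\<Sum>k<m. integral {0..h} (\<lambda>s. g (s + real k * h)))"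
  proof (induction m)
    case (Suc m)
    have "integral {0..real (Suc m) * h} g
      = integral {0..real m * h} g + integral {real m * h..real (Suc m) * h} g"
      using h by (intro Henstock_Kurzweil_Integration.integral_combine[symmetric] int) (auto simp: mult_right_mono)
    also have "integral {real m * h..real (Suc m) * h} g = integral {0..h} (\<lambda>s. g (s + real m * h))"
      using integral_shift_real[of 0 h g "real m * h"] by (simp add: algebra_simps)
    finally show ?case using Suc by simp
  qed simp
  also have "\<dots> = integral {0..h} (\<lambda>s. \<Sum>k<m. g (s + real k * h))"
    using int' by (subst integral_sum) auto
  finally show ?thesis .
qed

section \<open>Partial sums as integrals against the kernel\<close>

lemma fourier_partial_sum_eq_integral:
  assumes cont: "continuous_on UNIV f"
  shows "fourier_partial_sum f n x = integral {0..2*pi} (\<lambda>t. f t * dirichlet_kernel n (t - x)) / pi"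
proof -
  have int: "(\<lambda>t. f t * g t) integrable_on {0..2*pi}" if "continuous_on UNIV g" for g
    using that cont by (intro integrable_continuous_real) (rule continuous_on_subset, auto intro!: continuous_intros)
  have int': "(\<lambda>t. f t * cos (real k * (t - x))) integrable_on {0..2*pi}" for k
    by (intro int continuous_intros)
  have coeff: "fourier_a f k * cos (real k * x) + fourier_b f k * sin (real k * x)
    = integral {0..2*pi} (\<lambda>t. f t * cos (real k * (t - x))) / pi" for k
  proof -
    have "integral {0..2*pi} (\<lambda>t. f t * cos (real k * (t - x)))
      = integral {0..2*pi} (\<lambda>t. (f t * cos (real k * t)) * cos (real k * x) + (f t * sin (real k * t)) * sin (real k * x))"
      by (simp add: right_diff_distrib cos_diff distrib_left mult.assoc)
    also have "\<dots> = integral {0..2*pi} (\<lambda>t. f t * cos (real k * t)) * cos (real k * x)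
      + integral {0..2*pi} (\<lambda>t. f t * sin (real k * t)) * sin (real k * x)"
      by (subst Henstock_Kurzweil_Integration.integral_add)
        (auto intro!: integrable_on_mult_left int continuous_intros)
    finally show ?thesis
      by (simp add: fourier_a_def fourier_b_def add_divide_distrib)
  qed
  have "integral {0..2*pi} (\<lambda>t. f t * dirichlet_kernel n (t - x))
    = integral {0..2*pi} (\<lambda>t. f t * (1 / 2) + (\<Sum>k=1..n. f t * cos (real k * (t - x))))"
    by (simp add: dirichlet_kernel_def distrib_left sum_distrib_left)
  also have "\<dots> = integral {0..2*pi} (\<lambda>t. f t * (1 / 2))
      + (\<Sum>k=1..n. integral {0..2*pi} (\<lambda>t. f t * cos (real k * (t - x))))"
    using int[of "\<lambda>_. 1 / 2"] int'
    by (subst Henstock_Kurzweil_Integration.integral_add)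
      (auto intro!: integrable_sum Henstock_Kurzweil_Integration.integral_sum simp del: integral_mult_left integral_divide)
  finally show ?thesis
    unfolding fourier_partial_sum_def coeff
    by (simp add: fourier_a_def sum_divide_distrib add_divide_distrib)
qed

lemma dirichlet_kernel_periodic: "dirichlet_kernel n (t + 2 * pi) = dirichlet_kernel n t"
proof -
  have "cos (real k * (t + 2 * pi)) = cos (real k * t)" for k
    using cos.plus_of_nat[of "real k * t" k] by (simp add: algebra_simps)
  then show ?thesis by (simp add: dirichlet_kernel_def)
qed

lemma fourier_partial_sum_eq_cells:
  assumes cont: "continuous_on UNIV f" and per: "periodic_2pi f"
  shows "fourier_partial_sum f n x = integral {0..cell n}
    (\<lambda>s. \<Sum>k<2*n+1. f (x + (s + real k * cell n)) * dirichlet_kernel n (s + real k * cell n)) / pi"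
proof -
  define g where "g t = f t * dirichlet_kernel n (t - x)" for t
  have g: "continuous_on UNIV g" "periodic_2pi g"
    using cont per dirichlet_kernel_periodic[of n "_ - x"]
    by (auto simp: g_def[abs_def] periodic_2pi_def algebra_simps intro!: continuous_intros)
  have "fourier_partial_sum f n x = integral {0..2*pi} g / pi"
    unfolding g_def by (rule fourier_partial_sum_eq_integral[OF cont])
  also have "integral {0..2*pi} g = integral {0..2*pi} (\<lambda>t. g (x + t))"
    by (rule integral_periodic_shift[OF g, symmetric])
  also have "2 * pi = real (2 * n + 1) * cell n"
    using cell_mult[of n] by (simp add: add.commute)
  also have "integral {0..real (2*n+1) * cell n} (\<lambda>t. g (x + t))
    = integral {0..cell n} (\<lambda>s. \<Sum>k<2*n+1. g (x + (s + real k * cell n)))"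
    using cell_pos[of n]
    by (intro integral_split_cells continuous_on_compose2[OF g(1)] continuous_intros) auto
  finally show ?thesis by (simp add: g_def)
qed

lemma fourier_partial_sum_add:
  assumes "continuous_on UNIV f" "continuous_on UNIV g"
  shows "fourier_partial_sum (\<lambda>t. f t + g t) n x = fourier_partial_sum f n x + fourier_partial_sum g n x"
proof -
  have int: "(\<lambda>t. u t * dirichlet_kernel n (t - x)) integrable_on {0..2*pi}" if "continuous_on UNIV u" for u
    using that by (intro integrable_continuous_real) (rule continuous_on_subset, auto intro!: continuous_intros)
  have "continuous_on UNIV (\<lambda>t. f t + g t)"
    using assms by (intro continuous_intros)
  then show ?thesis
    using assms int
    by (simp add: fourier_partial_sum_eq_integral distrib_right Henstock_Kurzweil_Integration.integral_add add_divide_distrib)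
qed

text \<open>Reproduction of constants allows the value \<open>f x\<close> to be moved under the
  integral of the deviation.\<close>

lemma fourier_partial_sum_const: "fourier_partial_sum (\<lambda>_. c) n x = c"
proof -
  have "integral {0..2*pi} (\<lambda>t. cos (real k * t)) = 0" "integral {0..2*pi} (\<lambda>t. sin (real k * t)) = 0" if "k \<ge> 1" for k
  proof -
    have "((\<lambda>t. cos (real k * t)) has_integral (sin (real k * (2 * pi)) / real k - sin (real k * 0) / real k)) {0..2*pi}"
      using that by (intro fundamental_theorem_of_calculus)
        (auto intro!: derivative_eq_intros simp flip: has_real_derivative_iff_has_vector_derivative)
    moreover have "sin (real k * (2 * pi)) = 0"
      using sin_npi[of "2 * k"] by (simp add: mult_ac)
    ultimately show "integral {0..2*pi} (\<lambda>t. cos (real k * t)) = 0"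
      by (simp add: integral_unique)
    have "((\<lambda>t. sin (real k * t)) has_integral ((- cos (real k * (2 * pi))) / real k - (- cos (real k * 0)) / real k)) {0..2*pi}"
      using that by (intro fundamental_theorem_of_calculus)
        (auto intro!: derivative_eq_intros simp flip: has_real_derivative_iff_has_vector_derivative)
    moreover have "cos (real k * (2 * pi)) = 1"
      using cos_npi[of "2 * k"] by (simp add: mult_ac)
    ultimately show "integral {0..2*pi} (\<lambda>t. sin (real k * t)) = 0"
      by (simp add: integral_unique)
  qed
  then have ab: "fourier_a (\<lambda>_. c) k = 0" "fourier_b (\<lambda>_. c) k = 0" if "k \<ge> 1" for k
    using that by (simp_all add: fourier_a_def fourier_b_def)
  have "fourier_a (\<lambda>_. c) 0 = 2 * c"
    by (simp add: fourier_a_def)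
  then show ?thesis
    using ab by (simp add: fourier_partial_sum_def)
qed

text \<open>Linear instead of logarithmic growth in \<open>n\<close> is good enough: the bound is
  applied to the sum of all later trains, whose heights are chosen small compared with
  \<open>1 / (2 * real n + 1)\<close>.\<close>

lemma abs_fourier_partial_sum_le:
  assumes cont: "continuous_on UNIV f" and B: "\<And>t. \<bar>f t\<bar> \<le> B"
  shows "\<bar>fourier_partial_sum f n x\<bar> \<le> (2 * real n + 1) * B"
proof -
  have "norm (integral {0..2*pi} (\<lambda>t. f t * dirichlet_kernel n (t - x))) \<le> B * (real n + 1 / 2) * (2 * pi - 0)"
  proof (rule integral_bound)
    show "continuous_on {0..2*pi} (\<lambda>t. f t * dirichlet_kernel n (t - x))"
      by (intro continuous_intros continuous_on_subset[OF cont]) auto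
    show "norm (f t * dirichlet_kernel n (t - x)) \<le> B * (real n + 1 / 2)" for t
      using B[of t] abs_dirichlet_kernel_le[of n "t - x"] by (auto simp: abs_mult intro!: mult_mono)
  qed simp
  then show ?thesis
    unfolding fourier_partial_sum_eq_integral[OF cont] by (simp add: field_simps)
qed

text \<open>Jordan's inequality, obtained from concavity of the sine. The reciprocal blows up at
  both ends of the period; bounding it by a sum over the two ends rather than a maximum leads to the
  two weighted sums, with weights \<open>1 / j\<close> and \<open>1 / (n - j)\<close>, in the
  deviation estimate.\<close>

lemma sin_half_ge:
  fixes t :: real
  assumes "0 < t" "t < 2 * pi"
  shows "0 < sin (t / 2)" and "1 / (2 * sin (t / 2)) \<le> pi / 2 * (1 / t + 1 / (2 * pi - t))"
proof -
  have conc: "concave_on {0..pi} sin"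
    by (rule f''_le0_imp_concave[where f'=cos and f''="\<lambda>x. - sin x"])
      (auto intro!: derivative_eq_intros sin_ge_zero)
  have jordan: "2 * y / pi \<le> sin y" if "0 \<le> y" "y \<le> pi / 2" for y :: real
  proof -
    have "(1 - 2 * y / pi) * sin 0 + (2 * y / pi) * sin (pi / 2) \<le> sin ((1 - 2 * y / pi) *\<^sub>R 0 + (2 * y / pi) *\<^sub>R (pi / 2))"
      using that by (intro concave_onD[OF conc]) (auto simp: field_simps)
    then show ?thesis by simp
  qed
  have ge: "min t (2 * pi - t) / pi \<le> sin (t / 2)"
  proof (cases "t \<le> pi")
    case True
    then show ?thesis using jordan[of "t / 2"] assms by (simp add: min_def)
  next
    case False
    have "sin (t / 2) = sin (pi - t / 2)" by simp
    then show ?thesis using jordan[of "pi - t / 2"] False assms by (simp add: min_def algebra_simps)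
  qed
  show "0 < sin (t / 2)"
    using assms by (intro sin_gt_zero) auto
  have "1 / (2 * sin (t / 2)) \<le> 1 / (2 * (min t (2 * pi - t) / pi))"
    using ge assms by (intro divide_left_mono mult_left_mono mult_pos_pos \<open>0 < sin (t / 2)\<close>) auto
  also have "\<dots> = pi / 2 * (1 / min t (2 * pi - t))"
    by simp
  also have "\<dots> \<le> pi / 2 * (1 / t + 1 / (2 * pi - t))"
    using assms by (intro mult_left_mono) (auto simp: min_def)
  finally show "1 / (2 * sin (t / 2)) \<le> pi / 2 * (1 / t + 1 / (2 * pi - t))" .
qed


subsection \<open>Deviation of the partial sums\<close>

lemma sin_add_npi: "sin (x + real k * pi) = (- 1) ^ k * sin x"
proof (induction k)
  case (Suc k)
  have "sin (x + real (Suc k) * pi) = sin ((x + real k * pi) + pi)"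
    by (simp add: algebra_simps)
  with Suc show ?case by (simp only: sin_periodic_pi) simp
qed simp

text \<open>The first and the last cell touch a singularity of the reciprocal sine and cannot be
  paired. An odd number of cells remains between them, so number \<open>2 * n - 1\<close> is left
  over as well.\<close>

lemma sum_pairs:
  fixes a :: "nat \<Rightarrow> real"
  assumes "1 \<le> n"
  shows "(\<Sum>k<2*n+1. a k) = a 0 + (\<Sum>j=1..n-1. a (2*j-1) + a (2*j)) + a (2*n-1) + a (2*n)"
  using assms
proof (induction n rule: dec_induct)
  case base
  then show ?case by (simp add: eval_nat_numeral)
next
  case (step n)
  have "(\<Sum>j=1..n. a (2*j-1) + a (2*j)) = (\<Sum>j=1..n-1. a (2*j-1) + a (2*j)) + (a (2*n-1) + a (2*n))"
    using step(1) by (cases n) auto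
  with step show ?case by (simp add: eval_nat_numeral)
qed

lemma sum_inverse_squares_le: "(\<Sum>j=1..m. 1 / (real j)\<^sup>2) \<le> 2"
proof -
  have "(\<Sum>j=1..m. 1 / (real j)\<^sup>2) \<le> 2 - 1 / real m"
  proof (induction m)
    case (Suc m)
    show ?case
    proof (cases "m = 0")
      case False
      then have "1 / (real (Suc m))\<^sup>2 \<le> 1 / real m - 1 / real (Suc m)"
      proof -
        have "1 / (real (Suc m))\<^sup>2 \<le> 1 / (real m * real (Suc m))"
          using False by (intro divide_left_mono) (auto simp: power2_eq_square)
        also have "\<dots> = 1 / real m - 1 / real (Suc m)"
          using False by (simp add: field_simps)
        finally show ?thesis .
      qed
      with Suc show ?thesis by simp
    qed simp
  qed simp
  also have "\<dots> \<le> 2" by simp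
  finally show ?thesis .
qed

lemma sum_reflect_nat:
  fixes g :: "nat \<Rightarrow> real"
  assumes "1 \<le> n"
  shows "(\<Sum>j=1..n-1. g (n - j)) = (\<Sum>j=1..n-1. g j)"
  using assms by (subst (2) sum.atLeastAtMost_rev) simp

lemma sum_inverse_le_harm: "m \<le> n \<Longrightarrow> (\<Sum>j=1..m. 1 / real j) \<le> harm n"
  unfolding harm_def inverse_eq_divide by (intro sum_mono2) auto

text \<open>The numerator depends on the cell only through its sign, so for fixed \<open>s\<close>
  the sum over the cells alternates.\<close>

lemma dirichlet_kernel_cell:
  assumes "0 < s + real k * cell n" "s + real k * cell n < 2 * pi"
  shows "dirichlet_kernel n (s + real k * cell n)
    = (- 1) ^ k * sin ((real n + 1 / 2) * s) * (1 / (2 * sin ((s + real k * cell n) / 2)))"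
proof -
  have "(real n + 1 / 2) * (s + real k * cell n) = (real n + 1 / 2) * s + real k * ((real n + 1 / 2) * cell n)"
    by (simp only: algebra_simps)
  then have "2 * sin ((s + real k * cell n) / 2) * dirichlet_kernel n (s + real k * cell n)
    = (- 1) ^ k * sin ((real n + 1 / 2) * s)"
    unfolding dirichlet_kernel_mult by (simp only: cell_mult' sin_add_npi)
  then show ?thesis
    using sin_half_ge(1)[OF assms] by (simp add: field_simps)
qed

text \<open>The alternating signs of the Dirichlet kernel on consecutive cells are paired off, so that the
  deviation is controlled by increments of \<open>f\<close> over every other cell and by the slow decay of the
  kernel. The affine modulus \<open>e + K * d\<close> stands in for the modulus of continuity.\<close>

lemma fourier_deviation_le:
  assumes cont: "continuous_on UNIV f" and per: "periodic_2pi f" and n: "1 \<le> n"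
    and e: "0 \<le> e" and K: "0 \<le> K" and aff: "\<And>x y. \<bar>f x - f y\<bar> \<le> e + K * \<bar>x - y\<bar>"
    and D1: "\<And>y. (\<Sum>j=1..n-1. \<bar>f (y + real (2*j) * cell n) - f (y + real (2*j-1) * cell n)\<bar> / real j) \<le> D"
    and D2: "\<And>y. (\<Sum>j=1..n-1. \<bar>f (y + real (2*j) * cell n) - f (y + real (2*j-1) * cell n)\<bar> / real (n - j)) \<le> D"
  shows "\<bar>fourier_partial_sum f n x - f x\<bar> \<le> D + 19 * e + 36 * K * cell n * (1 + harm n)"
proof -
  define h where "h = cell n"
  define g where "g t = f (x + t) + (- f x)" for t
  define N where "N = real n + 1 / 2"
  define E where "E s = (\<Sum>k<2*n+1. (f (x + (s + real k * h)) + (- f x)) * dirichlet_kernel n (s + real k * h))" for s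
  have h: "0 < h" and hN: "N * h = pi" and h2: "(2 * real n + 1) * h = 2 * pi"
    using cell_pos cell_mult cell_mult' by (auto simp: h_def N_def)
  \<comment> \<open>Modulo the period the right end of the interval is again close to
    \<open>x\<close>, so \<open>g\<close> is small near both ends.\<close>
  have gper: "g t = f (x + (t - 2 * pi)) - f x" for t
    using per[unfolded periodic_2pi_def, rule_format, of "x + (t - 2 * pi)"] by (simp add: g_def algebra_simps)
  have gl: "\<bar>g t\<bar> \<le> e + K * t" if "0 \<le> t" for t
    using aff[of "x + t" x] that by (simp add: g_def)
  have gr: "\<bar>g t\<bar> \<le> e + K * (2 * pi - t)" if "t \<le> 2 * pi" for t
    using aff[of "x + (t - 2 * pi)" x] that by (simp add: gper)
  have Ele: "\<bar>E s\<bar> \<le> (pi / h) * (D + 19 * e + 36 * K * h * (1 + harm n))" if s: "0 \<le> s" "s \<le> h" for s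
  proof -
    define t where "t k = s + real k * h" for k
    define a where "a k = g (t k) * dirichlet_kernel n (t k)" for k
    define w where "w k = 1 / (2 * sin (t k / 2))" for k
    define q where "q j = 1 / real j + 1 / real (n - j)" for j
    define r where "r j = 1 / (real j)\<^sup>2 + 1 / (real (n - j))\<^sup>2" for j
    define d where "d j = \<bar>f (x + s + real (2*j) * h) - f (x + s + real (2*j-1) * h)\<bar>" for j
    have E: "E s = a 0 + (\<Sum>j=1..n-1. a (2*j-1) + a (2*j)) + a (2*n-1) + a (2*n)"
      unfolding E_def using n by (subst sum_pairs[symmetric]) (auto simp: a_def g_def t_def)
    have Dle: "\<bar>dirichlet_kernel n u\<bar> \<le> N" for u
      using abs_dirichlet_kernel_le by (simp add: N_def)
    \<comment> \<open>On the three unpaired cells the trivial bound \<open>N = pi / h\<close> for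
      the kernel suffices, since \<open>g\<close> is small there and the factor \<open>1 / h\<close>
      is cancelled by the length of the cell in the final integration.\<close>
    have a_le: "\<bar>a k\<bar> \<le> (e + K * c) * N" if "\<bar>g (t k)\<bar> \<le> e + K * c" for k c
      unfolding a_def abs_mult using that Dle[of "t k"] by (intro mult_mono) auto
    have a0: "\<bar>a 0\<bar> \<le> (e + K * h) * N"
    proof (rule a_le)
      have "\<bar>g (t 0)\<bar> \<le> e + K * s" using gl[of s] s by (simp add: t_def)
      also have "\<dots> \<le> e + K * h" using s K by (simp add: mult_left_mono)
      finally show "\<bar>g (t 0)\<bar> \<le> e + K * h" .
    qed
    have t2n: "2 * pi - t (2*n) = h - s"
      using h2 by (simp add: t_def algebra_simps)
    have a2n: "\<bar>a (2*n)\<bar> \<le> (e + K * h) * N"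
    proof (rule a_le)
      have "\<bar>g (t (2*n))\<bar> \<le> e + K * (h - s)" using gr[of "t (2*n)"] t2n s by simp
      also have "\<dots> \<le> e + K * h" using s K by (simp add: mult_left_mono)
      finally show "\<bar>g (t (2*n))\<bar> \<le> e + K * h" .
    qed
    have "t (2*n) = t (2*n-1) + h"
      using n by (simp add: t_def algebra_simps of_nat_diff)
    then have t2n1: "2 * pi - t (2*n-1) = 2 * h - s"
      using t2n by simp
    have a2n1: "\<bar>a (2*n-1)\<bar> \<le> (e + K * (2 * h)) * N"
    proof (rule a_le)
      have "\<bar>g (t (2*n-1))\<bar> \<le> e + K * (2 * h - s)" using gr[of "t (2*n-1)"] t2n1 s h by simp
      also have "\<dots> \<le> e + K * (2 * h)" using s K by (intro add_left_mono mult_left_mono) auto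
      finally show "\<bar>g (t (2*n-1))\<bar> \<le> e + K * (2 * h)" .
    qed
    have pair: "\<bar>a (2*j-1) + a (2*j)\<bar> \<le> (pi / (2 * h)) * (d j * q j) + (pi\<^sup>2 / (4 * h)) * (4 * e * r j + 16 * K * h * q j)"
      if j: "j \<in> {1..n-1}" for j
    proof -
      have nj: "real (n - j) = real n - real j" "1 \<le> real j" "1 \<le> real n - real j"
        using j by auto
      have q0: "0 \<le> q j" by (simp add: q_def)
      have tdiff: "t (2*j) = t (2*j-1) + h"
        using j by (simp add: t_def algebra_simps of_nat_diff)
      have t1: "real j * h \<le> t (2*j-1)"
      proof -
        have "real j * h \<le> (2 * real j - 1) * h"
          using nj h by (intro mult_right_mono) auto
        then show ?thesis using s j by (simp add: t_def of_nat_diff)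
      qed
      have t2: "2 * pi - t (2*j) \<ge> 2 * (real (n - j) * h)"
        using s unfolding nj h2[symmetric] t_def by (simp add: algebra_simps)
      have pos: "0 < real j * h" "0 < real (n - j) * h"
        using nj h by auto
      have wle: "0 < w k" "w k \<le> (pi / (2 * h)) * q j" "0 < t k" "t k < 2 * pi" if "k = 2*j-1 \<or> k = 2*j" for k
      proof -
        have tk: "real j * h \<le> t k" "real (n - j) * h \<le> 2 * pi - t k"
          using that t1 t2 tdiff h pos by (auto simp del: of_nat_diff)
        show tk': "0 < t k" "t k < 2 * pi" using tk pos by (auto simp del: of_nat_diff)
        show "0 < w k" using sin_half_ge(1)[OF tk'] by (simp add: w_def)
        have "w k \<le> pi / 2 * (1 / t k + 1 / (2 * pi - t k))"
          unfolding w_def by (rule sin_half_ge(2)[OF tk'])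
        also have "\<dots> \<le> pi / 2 * (1 / (real j * h) + 1 / (real (n - j) * h))"
          by (intro mult_left_mono add_mono frac_le pos tk) auto
        also have "\<dots> = (pi / (2 * h)) * q j"
          using h by (simp add: q_def field_simps)
        finally show "w k \<le> (pi / (2 * h)) * q j" .
      qed
      have Dk: "dirichlet_kernel n (t k) = (- 1) ^ k * sin (N * s) * w k" if "k = 2*j-1 \<or> k = 2*j" for k
        using dirichlet_kernel_cell[of s k n] wle(3,4)[OF that] by (simp add: t_def h_def N_def w_def)
      have "odd (2*j-1)" using j by auto
      then have "a (2*j-1) + a (2*j) = sin (N * s) * (g (t (2*j)) * w (2*j) - g (t (2*j-1)) * w (2*j-1))"
        unfolding a_def by (simp add: Dk algebra_simps)
      \<comment> \<open>Increment of \<open>g\<close> times a weight, plus a value of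
        \<open>g\<close> times an increment of the weight: the first part is controlled by the
        variation of \<open>f\<close>, the second by the smoothness of the kernel.\<close>
      also have "\<dots> = sin (N * s) * ((g (t (2*j)) - g (t (2*j-1))) * w (2*j) + g (t (2*j-1)) * (w (2*j) - w (2*j-1)))"
        by (simp add: algebra_simps)
      also have "\<bar>\<dots>\<bar> \<le> 1 * (\<bar>g (t (2*j)) - g (t (2*j-1))\<bar> * w (2*j) + \<bar>g (t (2*j-1))\<bar> * \<bar>w (2*j) - w (2*j-1)\<bar>)"
      proof -
        have "\<bar>(g (t (2*j)) - g (t (2*j-1))) * w (2*j) + g (t (2*j-1)) * (w (2*j) - w (2*j-1))\<bar>
          \<le> \<bar>g (t (2*j)) - g (t (2*j-1))\<bar> * w (2*j) + \<bar>g (t (2*j-1))\<bar> * \<bar>w (2*j) - w (2*j-1)\<bar>"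
          using wle(1)[of "2*j"] by (intro order_trans[OF abs_triangle_ineq]) (simp add: abs_mult)
        then show ?thesis
          unfolding abs_mult[of "sin (N * s)"] by (intro mult_mono) auto
      qed
      finally have 1: "\<bar>a (2*j-1) + a (2*j)\<bar> \<le> \<bar>g (t (2*j)) - g (t (2*j-1))\<bar> * w (2*j) + \<bar>g (t (2*j-1))\<bar> * \<bar>w (2*j) - w (2*j-1)\<bar>"
        by simp
      have dj: "\<bar>g (t (2*j)) - g (t (2*j-1))\<bar> = d j"
        by (simp add: g_def t_def d_def add.assoc)
      have 2: "\<bar>g (t (2*j)) - g (t (2*j-1))\<bar> * w (2*j) \<le> (pi / (2 * h)) * (d j * q j)"
        unfolding dj using mult_left_mono[OF wle(2)[of "2*j"], of "d j"] by (simp add: d_def mult_ac)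
      \<comment> \<open>A difference of reciprocals gains a product of two weights, hence decay of
        second order in the distance to the ends. The factor \<open>h\<close> comes from sines of
        half angles differing by at most \<open>h / 2\<close>, together with the 2 in
        \<open>wd\<close>.\<close>
      have wdiff: "\<bar>w (2*j) - w (2*j-1)\<bar> \<le> h * (w (2*j) * w (2*j-1))"
      proof -
        let ?A = "sin (t (2*j) / 2)" and ?B = "sin (t (2*j-1) / 2)"
        have AB: "0 < ?A" "0 < ?B"
          using wle(3,4) by (auto intro!: sin_half_ge)
        have wd: "w (2*j) - w (2*j-1) = (?B - ?A) * (2 * (w (2*j) * w (2*j-1)))"
          using AB by (simp add: w_def field_simps)
        have bd: "\<bar>?B - ?A\<bar> \<le> h / 2"
        proof -
          have half: "(t (2*j-1) / 2 - t (2*j) / 2) / 2 = - (h / 4)"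
            unfolding tdiff by (simp only: diff_divide_distrib add_divide_distrib)
          have "?B - ?A = 2 * sin ((t (2*j-1) / 2 - t (2*j) / 2) / 2) * cos ((t (2*j-1) / 2 + t (2*j) / 2) / 2)"
            by (rule sin_diff_sin)
          also have "\<bar>\<dots>\<bar> \<le> 2 * \<bar>(t (2*j-1) / 2 - t (2*j) / 2) / 2\<bar> * 1"
            unfolding abs_mult
            using abs_sin_x_le_abs_x[of "(t (2*j-1) / 2 - t (2*j) / 2) / 2"] by (intro mult_mono) auto
          also have "\<dots> = h / 2"
            unfolding half using h by simp
          finally show ?thesis .
        qed
        have "\<bar>w (2*j) - w (2*j-1)\<bar> \<le> h / 2 * \<bar>2 * (w (2*j) * w (2*j-1))\<bar>"
          unfolding wd abs_mult[of "?B - ?A"] by (intro mult_right_mono bd) simp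
        then show ?thesis
          using wle(1) by (simp add: abs_mult less_imp_le abs_of_pos)
      qed
      have ww: "w (2*j) * w (2*j-1) \<le> ((pi / (2 * h)) * q j) * ((pi / (2 * h)) * q j)"
        using wle q0 h by (intro mult_mono) (auto intro!: less_imp_le mult_nonneg_nonneg)
      \<comment> \<open>With \<open>i\<close> the index distance to the nearer end, \<open>g\<close>
        is at most \<open>e + K * (4 * (i * h))\<close> and \<open>q j\<close> at most
        \<open>2 / i\<close>. The \<open>e\<close>-part becomes a convergent series of inverse
        squares, the \<open>K\<close>-part a harmonic sum with the small factor
        \<open>h\<close>.\<close>
      have Gq: "\<bar>g (t (2*j-1))\<bar> * (q j)\<^sup>2 \<le> 4 * e * r j + 16 * K * h * q j"
      proof -
        define i where "i = min (real j) (real (n - j))"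
        have i: "0 < i" using nj by (auto simp: i_def)
        have "\<bar>g (t (2*j-1))\<bar> \<le> e + K * (4 * (i * h))"
        proof (cases "real j \<le> real (n - j)")
          case True
          have "t (2*j-1) \<le> 2 * (real j * h)"
            using s j by (simp add: t_def of_nat_diff algebra_simps)
          then have "K * t (2*j-1) \<le> K * (4 * (i * h))"
            using True pos K by (intro mult_left_mono) (auto simp: i_def min_def)
          then show ?thesis using gl[of "t (2*j-1)"] wle(3)[of "2*j-1"] by simp
        next
          case False
          have "2 * pi - t (2*j-1) \<le> 2 * (real (n - j) * h) + 2 * h"
            using s j unfolding h2[symmetric] t_def nj(1) by (simp add: of_nat_diff algebra_simps)
          also have "2 * h \<le> 2 * (real (n - j) * h)"
            using nj h by (simp add: mult_le_cancel_right1)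
          finally have "K * (2 * pi - t (2*j-1)) \<le> K * (4 * (i * h))"
            using False K by (intro mult_left_mono) (auto simp: i_def min_def mult.commute)
          then show ?thesis using gr[of "t (2*j-1)"] wle(4)[of "2*j-1"] by simp
        qed
        moreover have "q j \<le> 2 / i"
        proof -
          have "1 / real j \<le> 1 / i" "1 / real (n - j) \<le> 1 / i"
            using i nj by (auto simp: i_def intro!: divide_left_mono mult_pos_pos)
          then show ?thesis by (simp add: q_def)
        qed
        ultimately have "\<bar>g (t (2*j-1))\<bar> * (q j)\<^sup>2 \<le> (e + K * (4 * (i * h))) * (2 / i)\<^sup>2"
          using q0 e K i h by (intro mult_mono power_mono) auto
        also have "\<dots> = 4 * e * (1 / i\<^sup>2) + 16 * K * h * (1 / i)"
          using i by (simp add: field_simps power2_eq_square)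
        also have "\<dots> \<le> 4 * e * r j + 16 * K * h * q j"
          using e K h nj by (intro add_mono mult_left_mono) (auto simp: i_def min_def r_def q_def)
        finally show ?thesis .
      qed
      have "\<bar>g (t (2*j-1))\<bar> * \<bar>w (2*j) - w (2*j-1)\<bar>
        \<le> \<bar>g (t (2*j-1))\<bar> * (h * (((pi / (2 * h)) * q j) * ((pi / (2 * h)) * q j)))"
        using order_trans[OF wdiff mult_left_mono[OF ww less_imp_le[OF h]]] by (intro mult_left_mono) auto
      also have "\<dots> = (pi\<^sup>2 / (4 * h)) * (\<bar>g (t (2*j-1))\<bar> * (q j)\<^sup>2)"
        using h by (simp add: field_simps power2_eq_square)
      also have "\<dots> \<le> (pi\<^sup>2 / (4 * h)) * (4 * e * r j + 16 * K * h * q j)"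
        using Gq h by (intro mult_left_mono) auto
      finally show ?thesis using 1 2 by linarith
    qed
    have sumdq: "(\<Sum>j=1..n-1. d j * q j) \<le> 2 * D"
      using D1[of "x + s"] D2[of "x + s"]
      by (simp add: d_def q_def distrib_left sum.distrib h_def)
    have sumr: "(\<Sum>j=1..n-1. r j) \<le> 4"
      using sum_inverse_squares_le[of "n - 1"] sum_reflect_nat[OF n, of "\<lambda>j. 1 / (real j)\<^sup>2"]
      by (simp add: r_def sum.distrib)
    have sumq: "(\<Sum>j=1..n-1. q j) \<le> 2 * harm n"
      using sum_inverse_le_harm[of "n - 1" n] sum_reflect_nat[OF n, of "\<lambda>j. 1 / real j"]
      by (simp add: q_def sum.distrib)
    have "\<bar>\<Sum>j=1..n-1. a (2*j-1) + a (2*j)\<bar>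
      \<le> (\<Sum>j=1..n-1. (pi / (2 * h)) * (d j * q j) + (pi\<^sup>2 / (4 * h)) * (4 * e * r j + 16 * K * h * q j))"
      by (intro order_trans[OF sum_abs] sum_mono pair)
    also have "\<dots> = (pi / (2 * h)) * (\<Sum>j=1..n-1. d j * q j)
      + (pi\<^sup>2 / (4 * h)) * (4 * e * (\<Sum>j=1..n-1. r j) + 16 * K * h * (\<Sum>j=1..n-1. q j))"
      by (simp only: sum.distrib distrib_left sum_distrib_left)
    also have "\<dots> \<le> (pi / (2 * h)) * (2 * D) + (pi\<^sup>2 / (4 * h)) * (4 * e * 4 + 16 * K * h * (2 * harm n))"
      using sumdq sumr sumq h e K by (intro add_mono mult_left_mono) auto
    also have "\<dots> = (pi / h) * (D + pi * (4 * e + 8 * K * h * harm n))"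
      using h by (simp add: field_simps power2_eq_square)
    finally have mid: "\<bar>\<Sum>j=1..n-1. a (2*j-1) + a (2*j)\<bar> \<le> (pi / h) * (D + pi * (4 * e + 8 * K * h * harm n))" .
    have N: "N = pi / h" using hN h by (simp add: field_simps)
    have "\<bar>E s\<bar> \<le> \<bar>a 0\<bar> + \<bar>\<Sum>j=1..n-1. a (2*j-1) + a (2*j)\<bar> + \<bar>a (2*n-1)\<bar> + \<bar>a (2*n)\<bar>"
      unfolding E by linarith
    also have "\<dots> \<le> (e + K * h) * N + (pi / h) * (D + pi * (4 * e + 8 * K * h * harm n)) + (e + K * (2 * h)) * N + (e + K * h) * N"
      using a0 mid a2n1 a2n by linarith
    also have "\<dots> = (pi / h) * (D + 3 * e + 4 * K * h + pi * (4 * e + 8 * K * h * harm n))"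
      unfolding N by (simp add: algebra_simps)
    also have "\<dots> \<le> (pi / h) * (D + 3 * e + 4 * K * h + 4 * (4 * e + 8 * K * h * harm n))"
      using h e K pi_less_4 harm_nonneg[of n, where 'a=real] by (intro mult_left_mono add_left_mono mult_right_mono) auto
    \<comment> \<open>Here 19 = 3 + 16, three from the unpaired cells and sixteen from the pairs
      with \<open>pi\<close> bounded by 4; likewise 36 = 4 + 32 for the terms with
      \<open>K * h\<close>.\<close>
    also have "\<dots> \<le> (pi / h) * (D + 19 * e + 36 * K * h * (1 + harm n))"
      using h K harm_nonneg[of n, where 'a=real] by (intro mult_left_mono) (auto simp: algebra_simps)
    finally show ?thesis .
  qed
  have cont': "continuous_on UNIV (\<lambda>t. f t + (- f x))"
    using cont by (intro continuous_intros)
  have per': "periodic_2pi (\<lambda>t. f t + (- f x))"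
    using per by (simp add: periodic_2pi_def)
  have "fourier_partial_sum f n x - f x = fourier_partial_sum (\<lambda>t. f t + (- f x)) n x"
    using fourier_partial_sum_add[OF cont, of "\<lambda>_. - f x" n x] by (simp add: fourier_partial_sum_const)
  also have "\<dots> = integral {0..h} E / pi"
    unfolding fourier_partial_sum_eq_cells[OF cont' per'] E_def h_def by simp
  finally have eq: "fourier_partial_sum f n x - f x = integral {0..h} E / pi" .
  have "norm (integral {0..h} E) \<le> ((pi / h) * (D + 19 * e + 36 * K * h * (1 + harm n))) * (h - 0)"
  proof (rule integral_bound)
    show "continuous_on {0..h} E"
      unfolding E_def by (intro continuous_intros continuous_on_compose2[OF cont]) auto
  qed (use h Ele in auto)
  also have "\<dots> = pi * (D + 19 * e + 36 * K * h * (1 + harm n))"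
    using h by simp
  finally show ?thesis
    unfolding eq h_def by (simp add: divide_le_eq mult.commute)
qed

text \<open>\<open>harm n\<close> exceeds \<open>ln n\<close> by a convergent quantity and
  \<open>cell n\<close> is at most \<open>pi / n\<close>, so the product has the order of log n /
  n.\<close>

lemma cell_harm_tendsto_0: "(\<lambda>n. cell n * (1 + harm n)) \<longlonglongrightarrow> 0"
proof -
  obtain L where L: "(\<lambda>n. harm n - ln (real n)) \<longlonglongrightarrow> L"
    using euler_mascheroni_convergent by (auto simp: convergent_def)
  have "(\<lambda>n. ((1 + (harm n - ln (real n))) * (1 / real n) + ln (real n) / real n)) \<longlonglongrightarrow> (1 + L) * 0 + 0"
    by (intro tendsto_add tendsto_mult L tendsto_const lim_1_over_n
        filterlim_compose[OF ln_x_over_x_tendsto_0 filterlim_real_sequentially])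
  then have upper: "(\<lambda>n. pi * ((1 + (harm n - ln (real n))) * (1 / real n) + ln (real n) / real n)) \<longlonglongrightarrow> 0"
    by (auto intro: tendsto_mult_right_zero)
  have le: "eventually (\<lambda>n. cell n * (1 + harm n)
      \<le> pi * ((1 + (harm n - ln (real n))) * (1 / real n) + ln (real n) / real n)) sequentially"
  proof (rule eventually_sequentiallyI[of 1])
    fix n :: nat assume n: "1 \<le> n"
    have "cell n \<le> pi / real n"
      using n by (simp add: cell_def field_simps)
    then have "cell n * (1 + harm n) \<le> pi / real n * (1 + harm n)"
      using harm_nonneg[of n, where 'a=real] by (intro mult_right_mono) auto
    also have "\<dots> = pi * ((1 + (harm n - ln (real n))) * (1 / real n) + ln (real n) / real n)"
      using n by (simp add: field_simps)
    finally show "cell n * (1 + harm n)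
      \<le> pi * ((1 + (harm n - ln (real n))) * (1 / real n) + ln (real n) / real n)" .
  qed
  have "eventually (\<lambda>n. 0 \<le> cell n * (1 + harm n)) sequentially"
    by (intro always_eventually allI mult_nonneg_nonneg add_nonneg_nonneg harm_nonneg less_imp_le[OF cell_pos]) simp
  then show ?thesis
    by (rule tendsto_sandwich[OF _ le tendsto_const upper])
qed

text \<open>Increments over neighbouring cells are at most \<open>K * cell n\<close>, so the
  deviation estimate applies with \<open>e = 0\<close> and \<open>D = K * cell n * harm n\<close>.
  Every single train is of this kind, which lets its later partial sums be disregarded in the
  gliding hump.\<close>

lemma lipschitz_fourier_tendsto:
  assumes per: "periodic_2pi f" and lip: "\<And>x y. \<bar>f x - f y\<bar> \<le> K * \<bar>x - y\<bar>"
  shows "(\<lambda>n. fourier_partial_sum f n x) \<longlonglongrightarrow> f x"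
proof -
  have K: "0 \<le> K" using order_trans[OF abs_ge_zero lip[of 0 1]] by simp
  have cont: "continuous_on UNIV f"
    using K lip by (intro lipschitz_on_continuous_on lipschitz_onI) (auto simp: dist_real_def)
  have bound: "\<bar>fourier_partial_sum f n x - f x\<bar> \<le> 37 * K * (cell n * (1 + harm n))" if n: "1 \<le> n" for n
  proof -
    have d: "\<bar>f (y + real (2*j) * cell n) - f (y + real (2*j-1) * cell n)\<bar> \<le> K * cell n" if "1 \<le> j" for y j
    proof -
      have "real (2*j) * cell n - real (2*j-1) * cell n = cell n"
        using that by (simp add: of_nat_diff algebra_simps)
      then show ?thesis
        using lip[of "y + real (2*j) * cell n" "y + real (2*j-1) * cell n"] cell_pos[of n] by simp
    qed
    have s: "K * cell n * (\<Sum>j=1..n-1. 1 / real j) \<le> K * cell n * harm n"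
      using K cell_pos[of n] by (intro mult_left_mono sum_inverse_le_harm) auto
    have "\<bar>fourier_partial_sum f n x - f x\<bar> \<le> K * cell n * harm n + 19 * 0 + 36 * K * cell n * (1 + harm n)"
    proof (rule fourier_deviation_le[OF cont per n _ K])
      fix y
      have "(\<Sum>j=1..n-1. \<bar>f (y + real (2*j) * cell n) - f (y + real (2*j-1) * cell n)\<bar> / real j)
        \<le> (\<Sum>j=1..n-1. K * cell n * (1 / real j))"
        using d by (intro sum_mono) (auto intro!: divide_right_mono simp del: of_nat_diff)
      also have "\<dots> \<le> K * cell n * harm n"
        using s by (simp only: sum_distrib_left)
      finally show "(\<Sum>j=1..n-1. \<bar>f (y + real (2*j) * cell n) - f (y + real (2*j-1) * cell n)\<bar> / real j) \<le> K * cell n * harm n" .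
      have "(\<Sum>j=1..n-1. \<bar>f (y + real (2*j) * cell n) - f (y + real (2*j-1) * cell n)\<bar> / real (n - j))
        \<le> (\<Sum>j=1..n-1. K * cell n * (1 / real (n - j)))"
        using d by (intro sum_mono) (auto intro!: divide_right_mono simp del: of_nat_diff)
      also have "\<dots> = K * cell n * (\<Sum>j=1..n-1. 1 / real j)"
        by (simp only: sum_reflect_nat[OF n, of "\<lambda>j. 1 / real j", symmetric] sum_distrib_left)
      finally show "(\<Sum>j=1..n-1. \<bar>f (y + real (2*j) * cell n) - f (y + real (2*j-1) * cell n)\<bar> / real (n - j)) \<le> K * cell n * harm n"
        using s by simp
    qed (use lip in auto)
    also have "\<dots> \<le> 37 * K * (cell n * (1 + harm n))"
      using K cell_pos[of n] by (simp add: algebra_simps)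
    finally show ?thesis .
  qed
  have "(\<lambda>n. fourier_partial_sum f n x - f x) \<longlonglongrightarrow> 0"
  proof (rule Lim_null_comparison)
    show "eventually (\<lambda>n. norm (fourier_partial_sum f n x - f x) \<le> 37 * K * (cell n * (1 + harm n))) sequentially"
      using bound by (auto intro: eventually_sequentiallyI[of 1])
  qed (rule tendsto_mult_right_zero[OF cell_harm_tendsto_0])
  then show ?thesis by (simp add: LIM_zero_iff)
qed


subsection \<open>Sufficiency\<close>

text \<open>A real supremum dominates its members only if the set is bounded above; boundedness of
  \<open>f\<close> guarantees this before anything is known about its variation.\<close>

lemma bdd_above_upsilon:
  fixes f :: "real \<Rightarrow> real" and n :: nat
  assumes B: "\<And>x. \<bar>f x\<bar> \<le> B" and p: "0 < p"
  shows "bdd_above ((\<lambda>ab. (\<Sum>j<n. \<bar>f (snd ab j) - f (fst ab j)\<bar> powr p) powr (1 / p)) ` S)"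
proof (rule bdd_aboveI2)
  fix ab :: "(nat \<Rightarrow> real) \<times> (nat \<Rightarrow> real)"
  have "\<bar>f x - f y\<bar> \<le> 2 * B" for x y
    using B[of x] B[of y] by linarith
  then show "(\<Sum>j<n. \<bar>f (snd ab j) - f (fst ab j)\<bar> powr p) powr (1 / p) \<le> (\<Sum>j<n. (2 * B) powr p) powr (1 / p)"
    using p by (intro powr_mono2 sum_mono sum_nonneg) auto
qed

lemma variation_le_upsilon:
  assumes "\<And>x. \<bar>f x\<bar> \<le> B" "0 < p" "nonoverlapping_intervals n a b"
  shows "(\<Sum>j<n. \<bar>f (b j) - f (a j)\<bar> powr p) powr (1 / p) \<le> upsilon p n f"
proof -
  have "(a, b) \<in> {(a, b). nonoverlapping_intervals n a b}"
    using assms by simp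
  from cSUP_upper[OF this bdd_above_upsilon[of f B p n]] show ?thesis
    using assms by (simp add: upsilon_def)
qed

context moduli
begin

lemma powr_\<nu>_mono: "j \<le> k \<Longrightarrow> real j powr (1 - 1 / p) * \<nu> j \<le> real k powr (1 - 1 / p) * \<nu> k"
  using p by (intro mult_mono powr_mono2 \<nu>_mono \<nu>_nonneg) auto

lemma sum_increments_le:
  assumes V: "\<And>m a b. 1 \<le> m \<Longrightarrow> nonoverlapping_intervals m a b \<Longrightarrow>
      (\<Sum>j<m. \<bar>f (b j) - f (a j)\<bar> powr p) powr (1 / p) \<le> C * \<nu> m"
    and A: "finite A" "card A \<le> k" and C: "0 \<le> C"
    and in2pi: "\<And>j. j \<in> A \<Longrightarrow> 0 \<le> a j \<and> a j \<le> b j \<and> b j \<le> 2 * pi"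
    and nonov: "\<And>i j. i \<in> A \<Longrightarrow> j \<in> A \<Longrightarrow> i \<noteq> j \<Longrightarrow> b i \<le> a j \<or> b j \<le> a i"
  shows "(\<Sum>j\<in>A. \<bar>f (b j) - f (a j)\<bar>) \<le> C * (real k powr (1 - 1 / p) * \<nu> k)"
proof (cases "A = {}")
  case True
  then show ?thesis using C \<nu>_nonneg by simp
next
  case False
  define m where "m = card A"
  have m: "1 \<le> m" using A False by (simp add: m_def Suc_le_eq card_gt_0_iff)
  obtain e where e: "bij_betw e {..<m} A"
    using ex_bij_betw_nat_finite[OF A(1)] by (auto simp: m_def atLeast0LessThan)
  have "nonoverlapping_intervals m (a \<circ> e) (b \<circ> e)"
    unfolding nonoverlapping_intervals_def
  proof (intro conjI allI impI)
    fix i j assume ij: "i < m" "j < m" "i \<noteq> j"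
    then have "e i \<in> A" "e j \<in> A" "e i \<noteq> e j"
      using e by (auto simp: bij_betw_def inj_on_def)
    then show "(b \<circ> e) i \<le> (a \<circ> e) j \<or> (b \<circ> e) j \<le> (a \<circ> e) i"
      using nonov by simp
  qed (use in2pi e in \<open>auto simp: bij_betw_def\<close>)
  from V[OF m this] have le: "(\<Sum>j\<in>A. \<bar>f (b j) - f (a j)\<bar> powr p) powr (1 / p) \<le> C * \<nu> m"
    using sum.reindex_bij_betw[OF e, of "\<lambda>j. \<bar>f (b j) - f (a j)\<bar> powr p"] by simp
  have "(\<Sum>j\<in>A. \<bar>f (b j) - f (a j)\<bar>)
    \<le> real m powr (1 - 1 / p) * (\<Sum>j\<in>A. \<bar>f (b j) - f (a j)\<bar> powr p) powr (1 / p)"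
    unfolding m_def by (intro sum_le_card_powr_sum p A) auto
  also have "\<dots> \<le> real m powr (1 - 1 / p) * (C * \<nu> m)"
    by (intro mult_left_mono le) auto
  also have "\<dots> = C * (real m powr (1 - 1 / p) * \<nu> m)"
    by simp
  also have "\<dots> \<le> C * (real k powr (1 - 1 / p) * \<nu> k)"
    using C A by (intro mult_left_mono powr_\<nu>_mono) (auto simp: m_def)
  finally show ?thesis .
qed

text \<open>The cells cover a period that in general straddles \<open>2 * pi\<close>. Cutting it there splits each
  increment into one increment inside \<open>[y, 2 * pi]\<close> and one inside \<open>[0, y]\<close>.\<close>

lemma sum_cell_increments_le:
  assumes V: "\<And>m a b. 1 \<le> m \<Longrightarrow> nonoverlapping_intervals m a b \<Longrightarrow>
      (\<Sum>j<m. \<bar>f (b j) - f (a j)\<bar> powr p) powr (1 / p) \<le> C * \<nu> m"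
    and per: "periodic_2pi f" and A: "A \<subseteq> {1..n-1}" "card A \<le> k" and C: "0 \<le> C"
  shows "(\<Sum>j\<in>A. \<bar>f (y + real (2*j) * cell n) - f (y + real (2*j-1) * cell n)\<bar>)
    \<le> 2 * C * (real k powr (1 - 1 / p) * \<nu> k)"
proof -
  obtain m :: int and z where z: "0 \<le> z" "z < 2 * pi" "y = z + 2 * pi * of_int m"
    by (rule periodic_2pi_reduce)
  have fy: "f (y + t) = f (z + t)" for t
    using periodic_2pi_int[OF per, of "z + t" m] z(3) by (simp add: algebra_simps)
  define a where "a j = z + real (2*j-1) * cell n" for j
  define b where "b j = z + real (2*j) * cell n" for j
  \<comment> \<open>\<open>min t (2 * pi)\<close> freezes the part beyond the period and
    \<open>cut t\<close> collapses the part before it to 0, so each piece of an increment is trivial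
    where the other one is active. Because \<open>f 0 = f (2 * pi)\<close> the two pieces add up;
    the factor 2 in the bound counts them.\<close>
  define cut where "cut t = max (t - 2 * pi) 0" for t :: real
  have split: "f t = f (min t (2 * pi)) + f (cut t) - f 0" for t
    using per[unfolded periodic_2pi_def, rule_format, of 0]
      per[unfolded periodic_2pi_def, rule_format, of "t - 2 * pi"]
    by (auto simp: cut_def min_def max_def)
  have mono: "min s (2 * pi) \<le> min t (2 * pi)" "cut s \<le> cut t" if "s \<le> t" for s t
    using that by (auto simp: cut_def)
  have ab: "0 \<le> a j" "a j \<le> b j" "b j \<le> z + 2 * pi" if "j \<in> A" for j
  proof -
    have j: "1 \<le> j" "j \<le> n - 1" using that A by auto
    show "0 \<le> a j" using z cell_pos[of n] by (simp add: a_def)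
    show "a j \<le> b j" using cell_pos[of n] by (simp add: a_def b_def mult_right_mono)
    have "real (2*j) * cell n \<le> (2 * real n + 1) * cell n"
      using j cell_pos[of n] by (intro mult_right_mono) auto
    then show "b j \<le> z + 2 * pi"
      unfolding cell_mult by (simp add: b_def)
  qed
  have ord: "b i \<le> a j" if "i \<in> A" "j \<in> A" "i < j" for i j
    using that cell_pos[of n] by (auto simp: a_def b_def intro!: mult_right_mono)
  have fin: "finite A" using A finite_subset by auto
  have "(\<Sum>j\<in>A. \<bar>f (y + real (2*j) * cell n) - f (y + real (2*j-1) * cell n)\<bar>) = (\<Sum>j\<in>A. \<bar>f (b j) - f (a j)\<bar>)"
    by (simp only: fy a_def b_def)
  also have "\<dots> \<le> (\<Sum>j\<in>A. \<bar>f (min (b j) (2 * pi)) - f (min (a j) (2 * pi))\<bar> + \<bar>f (cut (b j)) - f (cut (a j))\<bar>)"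
  proof (rule sum_mono)
    fix j
    show "\<bar>f (b j) - f (a j)\<bar> \<le> \<bar>f (min (b j) (2 * pi)) - f (min (a j) (2 * pi))\<bar> + \<bar>f (cut (b j)) - f (cut (a j))\<bar>"
      using split[of "b j"] split[of "a j"] by linarith
  qed
  also have "\<dots> = (\<Sum>j\<in>A. \<bar>f (min (b j) (2 * pi)) - f (min (a j) (2 * pi))\<bar>) + (\<Sum>j\<in>A. \<bar>f (cut (b j)) - f (cut (a j))\<bar>)"
    by (rule sum.distrib)
  also have "\<dots> \<le> C * (real k powr (1 - 1 / p) * \<nu> k) + C * (real k powr (1 - 1 / p) * \<nu> k)"
  proof (rule add_mono; rule sum_increments_le[OF V fin A(2) C])
    fix j assume j: "j \<in> A"
    show "0 \<le> min (a j) (2 * pi) \<and> min (a j) (2 * pi) \<le> min (b j) (2 * pi) \<and> min (b j) (2 * pi) \<le> 2 * pi"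
      using ab[OF j] mono by auto
    show "0 \<le> cut (a j) \<and> cut (a j) \<le> cut (b j) \<and> cut (b j) \<le> 2 * pi"
      using ab[OF j] mono z by (auto simp: cut_def)
  next
    fix i j assume "i \<in> A" "j \<in> A" "i \<noteq> j"
    then have "b i \<le> a j \<or> b j \<le> a i"
      using ord[of i j] ord[of j i] by (cases i j rule: linorder_cases) auto
    then show "min (b i) (2 * pi) \<le> min (a j) (2 * pi) \<or> min (b j) (2 * pi) \<le> min (a i) (2 * pi)"
      and "cut (b i) \<le> cut (a j) \<or> cut (b j) \<le> cut (a i)"
      using mono by blast+
  qed auto
  finally show ?thesis by (simp add: mult_ac)
qed

text \<open>Summation by parts on the tail: the growth \<open>k powr (1 - 1 / p) * \<nu> k\<close>
  of the partial sums meets differences of \<open>1 / k\<close>, which are at most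
  \<open>1 / (k * k)\<close>, and yields exactly the terms of \<open>rho\<close>. Starting the
  partial sums after \<open>r\<close> removes the lower boundary term.\<close>

lemma sum_weighted_le:
  fixes d :: "nat \<Rightarrow> real"
  assumes r: "1 \<le> r" "r \<le> m" and C: "0 \<le> C"
    and small: "\<And>j. 1 \<le> j \<Longrightarrow> j \<le> r \<Longrightarrow> d j \<le> M"
    and T: "\<And>k. r < k \<Longrightarrow> k \<le> m \<Longrightarrow> (\<Sum>j=r+1..k. d j) \<le> C * (real k powr (1 - 1 / p) * \<nu> k)"
  shows "(\<Sum>j=1..m. d j / real j)
    \<le> M * (\<Sum>k=1..r. 1 / real k) + C * (\<Sum>k=r+1..m. \<nu> k / real k powr (1 + 1 / p)) + C * (\<nu> m / real m powr (1 / p))"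
proof -
  define S where "S k = (\<Sum>j=r+1..k. d j)" for k
  have T': "S k \<le> C * (real k powr (1 - 1 / p) * \<nu> k)" if "r \<le> k" "k \<le> m" for k
    using T[of k] that C \<nu>_nonneg[of k] by (cases "r = k") (auto simp: S_def)
  have pk: "real k powr (1 - 1 / p) = real k / real k powr (1 / p)" if "1 \<le> k" for k
    using that by (simp add: powr_diff)
  have "{1..m} = {1..r} \<union> {r+1..m}" "{1..r} \<inter> {r+1..m} = {}"
    using r by auto
  then have "(\<Sum>j=1..m. d j / real j) = (\<Sum>j=1..r. d j / real j) + (\<Sum>j=r+1..m. d j / real j)"
    by (simp add: sum.union_disjoint)
  moreover have "(\<Sum>j=1..r. d j / real j) \<le> M * (\<Sum>k=1..r. 1 / real k)"
    unfolding sum_distrib_left using small by (intro sum_mono) (auto intro: divide_right_mono)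
  moreover have "(\<Sum>j=r+1..m. d j / real j)
    \<le> C * (\<Sum>k=r+1..m. \<nu> k / real k powr (1 + 1 / p)) + C * (\<nu> m / real m powr (1 / p))"
  proof -
    have "(\<Sum>j=r+1..m. d j / real j) = (\<Sum>j=r+1..m. (S j - S (j - 1)) * (1 / real j))"
    proof (intro sum.cong refl)
      fix j assume "j \<in> {r+1..m}"
      then have "S j = S (j - 1) + d j"
        by (cases j) (auto simp: S_def)
      then show "d j / real j = (S j - S (j - 1)) * (1 / real j)" by simp
    qed
    also have "\<dots> = (\<Sum>k=r+1..m. S k * (1 / real k - 1 / real (k + 1))) + S m * (1 / real (m + 1)) - S r * (1 / real (r + 1))"
      using sum_by_parts_nat[OF r(2), of S "\<lambda>k. 1 / real k"] by simp
    also have "S r = 0" by (simp add: S_def)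
    also have "(\<Sum>k=r+1..m. S k * (1 / real k - 1 / real (k + 1))) \<le> (\<Sum>k=r+1..m. C * (\<nu> k / real k powr (1 + 1 / p)))"
    proof (rule sum_mono)
      fix k assume k: "k \<in> {r+1..m}"
      have "S k * (1 / real k - 1 / real (k + 1)) \<le> C * (real k powr (1 - 1 / p) * \<nu> k) * (1 / real k - 1 / real (k + 1))"
        using k T'[of k] by (intro mult_right_mono) (auto simp: field_simps)
      also have "\<dots> \<le> C * (real k powr (1 - 1 / p) * \<nu> k) * (1 / (real k * real k))"
      proof (intro mult_left_mono mult_nonneg_nonneg C \<nu>_nonneg)
        have "1 / real k - 1 / real (k + 1) = 1 / (real k * real (k + 1))"
          using k by (simp add: field_simps)
        also have "\<dots> \<le> 1 / (real k * real k)"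
          using k by (intro divide_left_mono mult_left_mono) auto
        finally show "1 / real k - 1 / real (k + 1) \<le> 1 / (real k * real k)" .
      qed simp
      also have "\<dots> = C * (\<nu> k / real k powr (1 + 1 / p))"
        using k by (simp add: pk powr_add)
      finally show "S k * (1 / real k - 1 / real (k + 1)) \<le> C * (\<nu> k / real k powr (1 + 1 / p))" .
    qed
    also have "S m * (1 / real (m + 1)) \<le> C * (\<nu> m / real m powr (1 / p))"
    proof -
      have "S m * (1 / real (m + 1)) \<le> C * (real m powr (1 - 1 / p) * \<nu> m) * (1 / real (m + 1))"
        using T'[of m] r by (intro mult_right_mono) auto
      also have "\<dots> \<le> C * (real m powr (1 - 1 / p) * \<nu> m) * (1 / real m)"
        using r C \<nu>_nonneg[of m] by (intro mult_left_mono mult_nonneg_nonneg) (auto simp: field_simps)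
      also have "\<dots> = C * (\<nu> m / real m powr (1 / p))"
        using r by (simp add: pk)
      finally show ?thesis .
    qed
    finally show ?thesis by (simp add: sum_distrib_left)
  qed
  ultimately show ?thesis by linarith
qed

section \<open>Uniform convergence from membership in both classes\<close>

lemma H_omega_bound:
  assumes "f \<in> H_omega \<omega>"
  obtains C \<delta> where "0 < \<delta>" "0 \<le> C" "\<And>x y. \<bar>x - y\<bar> \<le> \<delta> \<Longrightarrow> \<bar>f x - f y\<bar> \<le> C * \<omega> \<bar>x - y\<bar>"
proof -
  obtain C \<delta> where \<delta>: "0 < \<delta>" and C: "\<And>d h x. 0 < d \<Longrightarrow> d \<le> \<delta> \<Longrightarrow> 0 \<le> h \<Longrightarrow> h \<le> d \<Longrightarrow> \<bar>f (x + h) - f x\<bar> \<le> C * \<omega> d"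
    using assms unfolding H_omega_def by blast
  have "\<bar>f x - f y\<bar> \<le> \<bar>C\<bar> * \<omega> \<bar>x - y\<bar>" if "\<bar>x - y\<bar> \<le> \<delta>" for x y
  proof -
    have *: "\<bar>f v - f u\<bar> \<le> \<bar>C\<bar> * \<omega> \<bar>v - u\<bar>" if uv: "u < v" "v - u \<le> \<delta>" for u v
    proof -
      have "\<bar>f v - f u\<bar> \<le> C * \<omega> (v - u)"
        using C[of "v - u" "v - u" u] uv by simp
      also have "\<dots> \<le> \<bar>C\<bar> * \<omega> (v - u)"
        using uv \<omega>_nonneg[of "v - u"] by (intro mult_right_mono) auto
      finally show ?thesis using uv by simp
    qed
    show ?thesis
      using *[of x y] *[of y x] that by (cases x y rule: linorder_cases) (auto simp: abs_minus_commute)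
  qed
  with \<delta> show thesis using that[of \<delta> "\<bar>C\<bar>"] by auto
qed

text \<open>Below a scale \<open>1 / n\<close> on which \<open>C * \<omega> (1 / n) < e\<close> the
  oscillation is below \<open>e\<close>; above that scale the trivial bound \<open>2 * B\<close> is
  at most \<open>2 * B * n\<close> times the distance.\<close>

lemma H_omega_affine_bound:
  assumes f: "f \<in> H_omega \<omega>" and B: "\<And>x. \<bar>f x\<bar> \<le> B" and e: "0 < e"
  obtains K where "0 \<le> K" "\<And>x y. \<bar>f x - f y\<bar> \<le> e + K * \<bar>x - y\<bar>"
proof -
  obtain C \<delta> where \<delta>: "0 < \<delta>" "0 \<le> C" and C: "\<And>x y. \<bar>x - y\<bar> \<le> \<delta> \<Longrightarrow> \<bar>f x - f y\<bar> \<le> C * \<omega> \<bar>x - y\<bar>"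
    using H_omega_bound[OF f] by metis
  have "(\<lambda>n. C * \<omega> (1 / real n)) \<longlonglongrightarrow> 0"
    by (rule tendsto_mult_right_zero[OF \<omega>_tendsto_0])
  then have "eventually (\<lambda>n. C * \<omega> (1 / real n) < e) sequentially"
    using e by (rule order_tendstoD)
  moreover have "eventually (\<lambda>n. 1 / real n < \<delta>) sequentially"
    using order_tendstoD(2)[OF lim_1_over_n \<delta>(1)] by simp
  ultimately have "eventually (\<lambda>n. C * \<omega> (1 / real n) < e \<and> 1 / real n < \<delta> \<and> 1 \<le> n) sequentially"
    using eventually_ge_at_top[of 1] by eventually_elim auto
  then obtain n where n: "C * \<omega> (1 / real n) < e" "1 / real n < \<delta>" "1 \<le> n"
    using eventually_happens by force
  have B0: "0 \<le> B" using order_trans[OF abs_ge_zero B[of 0]] .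
  have "\<bar>f x - f y\<bar> \<le> e + (2 * B * real n) * \<bar>x - y\<bar>" for x y
  proof (cases "\<bar>x - y\<bar> \<le> 1 / real n")
    case True
    have "\<bar>f x - f y\<bar> \<le> C * \<omega> \<bar>x - y\<bar>"
      using C[of x y] True n by linarith
    also have "\<dots> \<le> C * \<omega> (1 / real n)"
      using True \<delta> by (intro mult_left_mono \<omega>_mono) auto
    finally have "\<bar>f x - f y\<bar> \<le> e" using n by simp
    moreover have "0 \<le> (2 * B * real n) * \<bar>x - y\<bar>" using B0 by simp
    ultimately show ?thesis by linarith
  next
    case False
    then have "1 \<le> real n * \<bar>x - y\<bar>"
      using n by (simp add: field_simps)
    then have "2 * B * 1 \<le> 2 * B * (real n * \<bar>x - y\<bar>)"
      using B0 by (intro mult_left_mono) auto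
    then show ?thesis using B[of x] B[of y] e by (simp add: mult.assoc)
  qed
  then show thesis using that[of "2 * B * real n"] B0 by auto
qed

lemma affine_bound_continuous:
  fixes f :: "real \<Rightarrow> real"
  assumes "\<And>e. 0 < e \<Longrightarrow> \<exists>K. \<forall>x y. \<bar>f x - f y\<bar> \<le> e + K * \<bar>x - y\<bar>"
  shows "continuous_on UNIV f"
  unfolding continuous_on_iff
proof (intro ballI allI impI)
  fix x e :: real assume e: "0 < e"
  obtain K where K: "\<And>x y. \<bar>f x - f y\<bar> \<le> e / 2 + K * \<bar>x - y\<bar>"
    using assms[of "e / 2"] e by auto
  define d where "d = e / (2 * (\<bar>K\<bar> + 1))"
  have "dist (f y) (f x) < e" if "dist y x < d" for y
  proof -
    have "K * \<bar>y - x\<bar> \<le> (\<bar>K\<bar> + 1) * \<bar>y - x\<bar>"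
      by (intro mult_right_mono) auto
    also have "\<dots> < (\<bar>K\<bar> + 1) * d"
      using that by (intro mult_strict_left_mono) (auto simp: dist_real_def)
    also have "\<dots> = e / 2"
    proof -
      have "\<bar>K\<bar> + 1 \<noteq> 0" by linarith
      then show ?thesis by (simp add: d_def field_simps)
    qed
    finally show ?thesis using K[of y x] by (simp add: dist_real_def)
  qed
  moreover have "0 < d" using e by (simp add: d_def add_nonneg_pos)
  ultimately show "\<exists>d>0. \<forall>x'\<in>UNIV. dist x' x < d \<longrightarrow> dist (f x') (f x) < e"
    by blast
qed

theorem rho_tendsto_0_imp_uniform_convergence:
  assumes rho: "rho \<omega> \<nu> p \<longlonglongrightarrow> 0" and fH: "f \<in> H_omega \<omega>" and fV: "f \<in> V_p p \<nu>"
  shows "uniform_limit UNIV (\<lambda>n. fourier_partial_sum f n) f sequentially"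
proof -
  have per: "periodic_2pi f" using fH by (simp add: H_omega_def)
  obtain B where B: "\<And>x. \<bar>f x\<bar> \<le> B"
    using fV by (auto simp: V_p_def bounded_iff)
  obtain C0 where C0: "\<And>n. 1 \<le> n \<Longrightarrow> upsilon p n f \<le> C0 * \<nu> n"
    using fV by (auto simp: V_p_def)
  define C where "C = \<bar>C0\<bar>"
  have C: "0 \<le> C" by (simp add: C_def)
  have V: "(\<Sum>j<m. \<bar>f (b j) - f (a j)\<bar> powr p) powr (1 / p) \<le> C * \<nu> m"
    if m: "1 \<le> m" and ab: "nonoverlapping_intervals m a b" for m a b
  proof -
    have "(\<Sum>j<m. \<bar>f (b j) - f (a j)\<bar> powr p) powr (1 / p) \<le> upsilon p m f"
      by (rule variation_le_upsilon[OF B p_pos ab])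
    also have "\<dots> \<le> C0 * \<nu> m" by (rule C0[OF m])
    also have "\<dots> \<le> C * \<nu> m" using \<nu>_nonneg[of m] by (intro mult_right_mono) (auto simp: C_def)
    finally show ?thesis .
  qed
  obtain C1 \<delta> where \<delta>: "0 < \<delta>" "0 \<le> C1" and C1: "\<And>x y. \<bar>x - y\<bar> \<le> \<delta> \<Longrightarrow> \<bar>f x - f y\<bar> \<le> C1 * \<omega> \<bar>x - y\<bar>"
    using H_omega_bound[OF fH] by metis
  have cont: "continuous_on UNIV f"
    using H_omega_affine_bound[OF fH B] by (intro affine_bound_continuous) metis
  \<comment> \<open>\<open>4 * C1\<close> stems from \<open>cell n \<le> 4 / n\<close> and
    subadditivity of \<omega>, \<open>2 * C\<close> from cutting the cells at the end of the period.
    Nothing in \<open>D n\<close> depends on the point, which makes the convergence uniform.\<close>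
  define D where "D n = (4 * C1 + 2 * C) * rho \<omega> \<nu> p n + 2 * C * (\<nu> (n - 1) / real (n - 1) powr (1 / p))" for n
  have D0: "D \<longlonglongrightarrow> 0"
  proof -
    have "(\<lambda>n. (4 * C1 + 2 * C) * rho \<omega> \<nu> p n + 2 * C * (\<nu> (n - 1) / real (n - 1) powr (1 / p))) \<longlonglongrightarrow> 0 + 0"
      by (intro tendsto_add tendsto_mult_right_zero rho \<nu>_pred_ratio_tendsto_0)
    then show ?thesis by (simp add: D_def[abs_def])
  qed
  \<comment> \<open>Formulated for an abstract sequence \<open>d\<close> whose hypotheses are
    invariant under \<open>j \<mapsto> n - j\<close>, so that it serves the weights
    \<open>1 / j\<close> and \<open>1 / (n - j)\<close> alike.\<close>
  have weighted: "(\<Sum>j=1..n-1. d j / real j) \<le> D n"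
    if n: "2 \<le> n" and small: "\<And>j. 1 \<le> j \<Longrightarrow> j \<le> n - 1 \<Longrightarrow> d j \<le> 4 * C1 * \<omega> (1 / real n)"
      and T: "\<And>A k. A \<subseteq> {1..n-1} \<Longrightarrow> card A \<le> k \<Longrightarrow> (\<Sum>j\<in>A. d j) \<le> 2 * C * (real k powr (1 - 1 / p) * \<nu> k)"
    for n and d :: "nat \<Rightarrow> real"
  proof -
    define r where "r = \<theta> n"
    have r: "1 \<le> r" "r \<le> n - 1"
      using theta_ge[OF n] theta_le[OF n] by (auto simp: r_def)
    define S1 where "S1 = \<omega> (1 / real n) * (\<Sum>k=1..r. 1 / real k)"
    define S2 where "S2 = (\<Sum>k=r+1..n-1. \<nu> k / real k powr (1 + 1 / p))"
    have S0: "0 \<le> S1" "0 \<le> S2"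
      by (auto simp: S1_def S2_def intro!: mult_nonneg_nonneg \<omega>_nonneg sum_nonneg divide_nonneg_nonneg \<nu>_nonneg)
    have rhoS: "rho \<omega> \<nu> p n = S1 + S2"
      by (simp add: rho_eq[OF n] rho_term_def r_def S1_def S2_def)
    have "(\<Sum>j=1..n-1. d j / real j) \<le> 4 * C1 * \<omega> (1 / real n) * (\<Sum>k=1..r. 1 / real k)
      + 2 * C * (\<Sum>k=r+1..n-1. \<nu> k / real k powr (1 + 1 / p)) + 2 * C * (\<nu> (n - 1) / real (n - 1) powr (1 / p))"
    proof (rule sum_weighted_le[OF r])
      fix k assume "r < k" "k \<le> n - 1"
      then show "(\<Sum>j=r+1..k. d j) \<le> 2 * C * (real k powr (1 - 1 / p) * \<nu> k)"
        by (intro T) auto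
    qed (use C small r in auto)
    also have "\<dots> = 4 * C1 * S1 + 2 * C * S2 + 2 * C * (\<nu> (n - 1) / real (n - 1) powr (1 / p))"
      by (simp add: S1_def S2_def)
    also have "\<dots> \<le> D n"
      using S0 C \<delta> by (simp add: D_def rhoS algebra_simps)
    finally show ?thesis .
  qed
  have bound: "\<bar>fourier_partial_sum f n x - f x\<bar> \<le> D n + 19 * e + 36 * K * cell n * (1 + harm n)"
    if n: "2 \<le> n" "4 / real n \<le> \<delta>" and e: "0 \<le> e" and K: "0 \<le> K" "\<And>x y. \<bar>f x - f y\<bar> \<le> e + K * \<bar>x - y\<bar>"
    for n e K x
  proof (rule fourier_deviation_le[OF cont per _ e K])
    fix y
    define d where "d j = \<bar>f (y + real (2*j) * cell n) - f (y + real (2*j-1) * cell n)\<bar>" for j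
    have cn: "cell n \<le> 4 / real n"
    proof -
      have "cell n \<le> (2 * pi) / (2 * real n)"
        unfolding cell_def using n by (intro divide_left_mono) auto
      also have "\<dots> = pi / real n" by simp
      also have "\<dots> \<le> 4 / real n"
        using pi_less_4 by (intro divide_right_mono) auto
      finally show ?thesis .
    qed
    have d_small: "d j \<le> 4 * C1 * \<omega> (1 / real n)" if "1 \<le> j" for j
    proof -
      have eq: "(y + real (2*j) * cell n) - (y + real (2*j-1) * cell n) = cell n"
        using that by (simp add: of_nat_diff algebra_simps)
      have "d j \<le> C1 * \<omega> (cell n)"
        using C1[of "y + real (2*j) * cell n" "y + real (2*j-1) * cell n"] cell_pos[of n] cn n
        unfolding eq d_def by simp
      also have "\<dots> \<le> C1 * \<omega> (4 * (1 / real n))"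
        using \<delta> cn cell_pos[of n] by (intro mult_left_mono \<omega>_mono) auto
      also have "\<dots> \<le> C1 * (4 * \<omega> (1 / real n))"
        using \<delta> \<omega>_mult[of "1 / real n" 4] by (intro mult_left_mono) auto
      finally show ?thesis by simp
    qed
    have d_sum: "(\<Sum>j\<in>A. d j) \<le> 2 * C * (real k powr (1 - 1 / p) * \<nu> k)" if "A \<subseteq> {1..n-1}" "card A \<le> k" for A k
      unfolding d_def by (rule sum_cell_increments_le[OF V per that C])
    show "(\<Sum>j=1..n-1. \<bar>f (y + real (2*j) * cell n) - f (y + real (2*j-1) * cell n)\<bar> / real j) \<le> D n"
      using weighted[OF n(1), of d] d_small d_sum unfolding d_def by blast
    have "(\<Sum>j=1..n-1. d (n - j) / real j) \<le> D n"
    proof (rule weighted[OF n(1)])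
      fix A k assume A: "A \<subseteq> {1..n-1}" "card A \<le> k"
      have inj: "inj_on (\<lambda>j. n - j) A"
        using A(1) by (fastforce simp: inj_on_def)
      have "(\<Sum>j\<in>A. d (n - j)) = (\<Sum>j\<in>(\<lambda>j. n - j) ` A. d j)"
        by (simp add: sum.reindex[OF inj])
      also have "\<dots> \<le> 2 * C * (real k powr (1 - 1 / p) * \<nu> k)"
      proof (rule d_sum)
        show "(\<lambda>j. n - j) ` A \<subseteq> {1..n-1}"
          using A(1) n by fastforce
      qed (simp add: card_image[OF inj] A)
      finally show "(\<Sum>j\<in>A. d (n - j)) \<le> 2 * C * (real k powr (1 - 1 / p) * \<nu> k)" .
    qed (use n in \<open>auto intro!: d_small\<close>)
    also have "(\<Sum>j=1..n-1. d (n - j) / real j) = (\<Sum>j=1..n-1. d j / real (n - j))"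
    proof -
      have "(\<Sum>j=1..n-1. d j / real (n - j)) = (\<Sum>j=1..n-1. d (n - j) / real (n - (n - j)))"
        using n sum_reflect_nat[of n "\<lambda>j. d j / real (n - j)"] by simp
      also have "\<dots> = (\<Sum>j=1..n-1. d (n - j) / real j)"
        by (intro sum.cong refl) auto
      finally show ?thesis by simp
    qed
    finally show "(\<Sum>j=1..n-1. \<bar>f (y + real (2*j) * cell n) - f (y + real (2*j-1) * cell n)\<bar> / real (n - j)) \<le> D n"
      unfolding d_def .
  qed (use n in auto)
  show ?thesis
    unfolding uniform_limit_iff
  proof (intro allI impI)
    fix \<epsilon> :: real assume \<epsilon>: "0 < \<epsilon>"
    \<comment> \<open>The deviation bound carries \<open>19 * e\<close>, and 19/40 is below 1/2.
      \<open>K\<close> is fixed here, before \<open>n\<close> grows.\<close>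
    obtain K where K: "0 \<le> K" "\<And>x y. \<bar>f x - f y\<bar> \<le> \<epsilon> / 40 + K * \<bar>x - y\<bar>"
      using H_omega_affine_bound[OF fH B, of "\<epsilon> / 40"] \<epsilon> by auto
    have "(\<lambda>n. D n + 36 * K * (cell n * (1 + harm n))) \<longlonglongrightarrow> 0 + 0"
      by (intro tendsto_add D0 tendsto_mult_right_zero cell_harm_tendsto_0)
    then have "eventually (\<lambda>n. D n + 36 * K * (cell n * (1 + harm n)) < \<epsilon> / 2) sequentially"
      using \<epsilon> by (intro order_tendstoD) auto
    moreover have "eventually (\<lambda>n. 4 * (1 / real n) < \<delta>) sequentially"
      using \<delta> by (intro order_tendstoD(2)[OF tendsto_mult_right_zero[OF lim_1_over_n]])
    ultimately show "\<forall>\<^sub>F n in sequentially. \<forall>x\<in>UNIV. dist (fourier_partial_sum f n x) (f x) < \<epsilon>"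
      using eventually_ge_at_top[of 2]
    proof eventually_elim
      case (elim n)
      show ?case
      proof
        fix x
        have "\<bar>fourier_partial_sum f n x - f x\<bar> \<le> D n + 19 * (\<epsilon> / 40) + 36 * K * cell n * (1 + harm n)"
          using elim \<epsilon> by (intro bound K) auto
        also have "\<dots> = (D n + 36 * K * (cell n * (1 + harm n))) + 19 * (\<epsilon> / 40)"
          by simp
        also have "\<dots> < \<epsilon> / 2 + \<epsilon> / 2"
          using \<epsilon> by (intro add_strict_mono elim(1)) simp
        finally show "dist (fourier_partial_sum f n x) (f x) < \<epsilon>"
          by (simp add: dist_real_def)
      qed
    qed
  qed
qed

end


subsection \<open>Trains of bumps\<close>

text \<open>Induction removing the interval with the largest left endpoint: the others then end
  before it begins.\<close>

lemma sum_mono_increments_le: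
  fixes G :: "real \<Rightarrow> real"
  assumes "finite A" "mono G" "lo \<le> hi"
    and "\<And>j. j \<in> A \<Longrightarrow> lo \<le> a j \<and> a j \<le> b j \<and> b j \<le> hi"
    and "\<And>i j. i \<in> A \<Longrightarrow> j \<in> A \<Longrightarrow> i \<noteq> j \<Longrightarrow> b i \<le> a j \<or> b j \<le> a i"
  shows "(\<Sum>j\<in>A. G (b j) - G (a j)) \<le> G hi - G lo"
  using assms(1,3,4,5)
proof (induction "card A" arbitrary: A hi)
  case 0
  then show ?case using assms(2) by (simp add: monoD)
next
  case (Suc n)
  then have "A \<noteq> {}" by auto
  have "Max (a ` A) \<in> a ` A"
    using \<open>A \<noteq> {}\<close> \<open>finite A\<close> by (intro Max_in) auto
  then obtain l where "l \<in> A" and l_Max: "Max (a ` A) = a l"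
    by (rule imageE)
  then have l: "l \<in> A" "\<And>j. j \<in> A \<Longrightarrow> a j \<le> a l"
    using Max_ge[of "a ` A"] \<open>finite A\<close> by (auto simp flip: l_Max)
  have card: "n = card (A - {l})" using Suc l by simp
  have split: "(\<Sum>j\<in>A. G (b j) - G (a j)) = (G (b l) - G (a l)) + (\<Sum>j\<in>A - {l}. G (b j) - G (a j))"
    using Suc l by (simp add: sum.remove)
  show ?case
  \<comment> \<open>A degenerate interval may share its left endpoint with a proper one that extends
    further right; it contributes nothing and is dropped without shrinking
    \<open>hi\<close>.\<close>
  proof (cases "a l = b l")
    case True
    have "(\<Sum>j\<in>A - {l}. G (b j) - G (a j)) \<le> G hi - G lo"
      using Suc.prems by (intro Suc.hyps(1) card) auto
    then show ?thesis using True split by simp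
  next
    case False
    have "(\<Sum>j\<in>A - {l}. G (b j) - G (a j)) \<le> G (a l) - G lo"
    proof (rule Suc.hyps(1)[OF card])
      fix j assume j: "j \<in> A - {l}"
      then have "b j \<le> a l \<or> b l \<le> a j" using Suc.prems l by blast
      then show "lo \<le> a j \<and> a j \<le> b j \<and> b j \<le> a l"
        using Suc.prems(3)[of j] Suc.prems(3)[of l] j l False by force
    qed (use Suc.prems l in auto)
    moreover have "G (b l) \<le> G hi"
      using Suc.prems l assms(2) by (simp add: monoD)
    ultimately show ?thesis using split by simp
  qed
qed

text \<open>Together with \<open>fall\<close> this is the Jordan decomposition of the bump
  \<open>\<phi> (sin x)\<close> over \<open>[0, pi]\<close>. Clamping the argument makes both parts
  monotone on the whole line, so that the bumps of different cells can be added.\<close>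

definition rise :: "(real \<Rightarrow> real) \<Rightarrow> real \<Rightarrow> real" where
  "rise \<phi> x = \<phi> (sin (max 0 (min x (pi / 2))))"

definition fall :: "(real \<Rightarrow> real) \<Rightarrow> real \<Rightarrow> real" where
  "fall \<phi> x = \<phi> 1 - \<phi> (sin (max (pi / 2) (min x pi)))"

lemma rise_fall:
  assumes \<phi>: "mono_on {0..1} \<phi>" and \<phi>0: "\<phi> 0 = 0"
  shows mono_rise: "mono (rise \<phi>)" and mono_fall: "mono (fall \<phi>)"
    and rise_bounds: "0 \<le> rise \<phi> x" "rise \<phi> x \<le> \<phi> 1"
    and fall_bounds: "0 \<le> fall \<phi> x" "fall \<phi> x \<le> \<phi> 1"
    and rise_minus_fall: "rise \<phi> x - fall \<phi> x = \<phi> (sin (max 0 (min x pi)))"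
proof -
  have mono: "\<phi> s \<le> \<phi> t" if "0 \<le> s" "s \<le> t" "t \<le> 1" for s t
    using \<phi> that by (auto simp: mono_on_def)
  have up: "sin s \<le> sin t" if "0 \<le> s" "s \<le> t" "t \<le> pi / 2" for s t
    using that by (intro sin_monotone_2pi_le) auto
  have down: "sin t \<le> sin s" if "pi / 2 \<le> s" "s \<le> t" "t \<le> pi" for s t
    using up[of "pi - t" "pi - s"] that by simp
  have sin01: "0 \<le> sin s \<and> sin s \<le> 1" if "0 \<le> s" "s \<le> pi" for s
    using that by (simp add: sin_ge_zero)
  have clamp1: "0 \<le> max 0 (min y (pi / 2)) \<and> max 0 (min y (pi / 2)) \<le> pi / 2" for y :: real
    using pi_gt_zero by (auto simp: max_def min_def)
  have clamp2: "pi / 2 \<le> max (pi / 2) (min y pi) \<and> max (pi / 2) (min y pi) \<le> pi" for y :: real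
    using pi_gt_zero by (auto simp: max_def min_def)
  have s1: "0 \<le> sin (max 0 (min y (pi / 2))) \<and> sin (max 0 (min y (pi / 2))) \<le> 1" for y :: real
    using clamp1[of y] by (intro sin01) auto
  have s2: "0 \<le> sin (max (pi / 2) (min y pi)) \<and> sin (max (pi / 2) (min y pi)) \<le> 1" for y :: real
    using clamp2[of y] pi_gt_zero by (intro sin01; linarith)
  show "mono (rise \<phi>)"
  proof (rule monoI)
    fix y z :: real assume "y \<le> z"
    then have "max 0 (min y (pi / 2)) \<le> max 0 (min z (pi / 2))" by auto
    then show "rise \<phi> y \<le> rise \<phi> z"
      unfolding rise_def using clamp1[of y] clamp1[of z] s1[of y] s1[of z] by (intro mono up) blast+
  qed
  show "mono (fall \<phi>)"
  proof (rule monoI)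
    fix y z :: real assume "y \<le> z"
    then have "max (pi / 2) (min y pi) \<le> max (pi / 2) (min z pi)" by auto
    then show "fall \<phi> y \<le> fall \<phi> z"
      unfolding fall_def using clamp2[of y] clamp2[of z] s2[of y] s2[of z]
      by (intro diff_left_mono mono down) blast+
  qed
  show "0 \<le> rise \<phi> x" "rise \<phi> x \<le> \<phi> 1"
    using mono[of 0 "sin (max 0 (min x (pi / 2)))"] mono[of "sin (max 0 (min x (pi / 2)))" 1] s1[of x] \<phi>0
    by (auto simp: rise_def)
  show "0 \<le> fall \<phi> x" "fall \<phi> x \<le> \<phi> 1"
    using mono[of 0 "sin (max (pi / 2) (min x pi))"] mono[of "sin (max (pi / 2) (min x pi))" 1] s2[of x] \<phi>0
    by (auto simp: fall_def)
  show "rise \<phi> x - fall \<phi> x = \<phi> (sin (max 0 (min x pi)))"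
  proof (cases "x \<le> pi / 2")
    case True
    then have "x \<le> pi"
      using pi_gt_zero by linarith
    with True have "max 0 (min x (pi / 2)) = max 0 (min x pi)" "max (pi / 2) (min x pi) = pi / 2"
      by (auto simp: min_def)
    then show ?thesis by (simp add: rise_def fall_def)
  next
    case False
    then have e: "max 0 (min x (pi / 2)) = pi / 2" "max (pi / 2) (min x pi) = max 0 (min x pi)"
      using pi_gt_zero by (auto simp: min_def max_def)
    show ?thesis unfolding rise_def fall_def e by simp
  qed
qed

lemma abs_sin_diff_le:
  fixes c x y :: real
  shows "\<bar>\<bar>sin (c * x)\<bar> - \<bar>sin (c * y)\<bar>\<bar> \<le> \<bar>c\<bar> * \<bar>x - y\<bar>"
proof -
  have "sin (c * x) - sin (c * y) = 2 * sin ((c * x - c * y) / 2) * cos ((c * x + c * y) / 2)"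
    by (rule sin_diff_sin)
  also have "\<bar>\<dots>\<bar> \<le> 2 * \<bar>(c * x - c * y) / 2\<bar> * 1"
    unfolding abs_mult using abs_sin_x_le_abs_x[of "(c * x - c * y) / 2"] by (intro mult_mono) auto
  also have "\<dots> = \<bar>c\<bar> * \<bar>x - y\<bar>"
    by (simp flip: abs_mult add: right_diff_distrib)
  finally show ?thesis by linarith
qed

definition cell_height :: "(nat \<Rightarrow> real) \<Rightarrow> nat \<Rightarrow> real" where
  "cell_height H k = (if even k then H (k div 2) else 0)"

text \<open>A \<open>2 * pi\<close>-periodic train of bumps, one over every other cell, where the Dirichlet kernel of
  order \<open>n\<close> is positive; the bump over cell number \<open>2 * j\<close> has height \<open>H j\<close>.\<close>

definition bumps :: "nat \<Rightarrow> (nat \<Rightarrow> real) \<Rightarrow> real \<Rightarrow> real" where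
  "bumps n H t = cell_height H (nat (\<lfloor>t / cell n\<rfloor> mod (2 * int n + 1))) * \<bar>sin ((real n + 1 / 2) * t)\<bar>"

lemma sum_cell_height:
  assumes n: "1 \<le> n" and g0: "\<And>k. g k 0 = 0" and H: "H 0 = 0" "H n = 0"
  shows "(\<Sum>k<2*n+1. g k (cell_height H k)) = (\<Sum>j=1..n-1. g (2 * j) (H j :: real) :: real)"
proof -
  have "(\<Sum>j=1..n-1. g (2*j-1) (cell_height H (2*j-1)) + g (2*j) (cell_height H (2*j))) = (\<Sum>j=1..n-1. g (2 * j) (H j))"
    by (intro sum.cong) (auto simp: cell_height_def g0)
  moreover have "odd (2*n-1)" using n by simp
  ultimately show ?thesis
    using n H by (subst sum_pairs) (auto simp: cell_height_def g0)
qed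

text \<open>A period contains an odd number of half waves, so the sine changes sign; the absolute
  value in the definition absorbs this.\<close>

lemma bumps_periodic: "periodic_2pi (bumps n H)"
  unfolding periodic_2pi_def
proof
  fix t
  have "(t + 2 * pi) / cell n = t / cell n + of_int (2 * int n + 1)"
    using cell_pos[of n] cell_mult[of n] by (simp add: field_simps)
  then have "\<lfloor>(t + 2 * pi) / cell n\<rfloor> = \<lfloor>t / cell n\<rfloor> + (2 * int n + 1)"
    by (simp only: floor_add_int)
  moreover have "sin ((real n + 1 / 2) * (t + 2 * pi)) = (- 1) ^ (2 * n + 1) * sin ((real n + 1 / 2) * t)"
    unfolding sin_add_npi[symmetric] by (simp add: algebra_simps)
  ultimately show "bumps n H (t + 2 * pi) = bumps n H t"
    by (simp add: bumps_def)
qed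

lemma cell_decomp:
  obtains i :: int and s where "0 \<le> s" "s < cell n" "t = s + of_int i * cell n" "i = \<lfloor>t / cell n\<rfloor>"
proof
  have "of_int \<lfloor>t / cell n\<rfloor> * cell n \<le> t"
    using mult_right_mono[OF of_int_floor_le[of "t / cell n"], of "cell n"] cell_pos[of n] by simp
  then show "0 \<le> t - of_int \<lfloor>t / cell n\<rfloor> * cell n" by simp
  have "t < (of_int \<lfloor>t / cell n\<rfloor> + 1) * cell n"
    using mult_strict_right_mono[OF real_of_int_floor_add_one_gt[of "t / cell n"] cell_pos[of n]] cell_pos[of n] by simp
  then show "t - of_int \<lfloor>t / cell n\<rfloor> * cell n < cell n" by (simp add: algebra_simps)
qed auto

text \<open>Holds on the closed cell although the floor jumps at its right end, because the sine
  vanishes there.\<close>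

lemma bumps_cell:
  assumes "0 \<le> s" "s \<le> cell n" "k < 2 * n + 1"
  shows "bumps n H (s + real k * cell n) = cell_height H k * \<bar>sin ((real n + 1 / 2) * s)\<bar>"
proof -
  have "(real n + 1 / 2) * (s + real k * cell n) = (real n + 1 / 2) * s + real k * ((real n + 1 / 2) * cell n)"
    by (simp only: algebra_simps)
  then have sin: "\<bar>sin ((real n + 1 / 2) * (s + real k * cell n))\<bar> = \<bar>sin ((real n + 1 / 2) * s)\<bar>"
    by (simp only: cell_mult' sin_add_npi) (simp add: abs_mult)
  show ?thesis
  proof (cases "s = cell n")
    case True
    then have "sin ((real n + 1 / 2) * s) = 0" by (simp add: cell_mult' del: distrib_right_numeral)
    then show ?thesis using sin by (simp add: bumps_def)
  next
    case False
    then have "s / cell n < 1" "0 \<le> s / cell n"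
      using assms cell_pos[of n] by auto
    moreover have "(s + real k * cell n) / cell n = s / cell n + real k"
      using cell_pos[of n] by (simp add: field_simps)
    ultimately have "\<lfloor>(s + real k * cell n) / cell n\<rfloor> = int k"
      by (intro floor_unique) auto
    then show ?thesis using sin assms(3) by (simp add: bumps_def)
  qed
qed

context
  fixes n :: nat and H :: "nat \<Rightarrow> real" and M :: real
  assumes n: "1 \<le> n" and H0: "H 0 = 0" and Hn: "\<And>j. n \<le> j \<Longrightarrow> H j = 0"
    and H_nonneg: "\<And>j. 0 \<le> H j" and H_le: "\<And>j. H j \<le> M"
begin

lemma cell_height_bounds: "0 \<le> cell_height H k" "cell_height H k \<le> M"
  using H_nonneg H_le order_trans[OF H_nonneg H_le] by (auto simp: cell_height_def)

lemma bumps_bounds: "0 \<le> bumps n H t" "bumps n H t \<le> M"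
proof -
  show "0 \<le> bumps n H t"
    using cell_height_bounds by (simp add: bumps_def)
  have "bumps n H t \<le> M * 1"
    unfolding bumps_def using cell_height_bounds order_trans[OF H_nonneg H_le] by (intro mult_mono) auto
  then show "bumps n H t \<le> M" by simp
qed

text \<open>Inside a cell the sine decides. Points in different cells are each compared with a zero
  at a cell boundary between them; as the function is nonnegative, the larger of the two values
  bounds the difference and no factor 2 arises.\<close>

lemma bumps_lipschitz: "\<bar>bumps n H x - bumps n H y\<bar> \<le> M * (real n + 1 / 2) * \<bar>x - y\<bar>"
proof -
  define N where "N = real n + 1 / 2"
  have N: "0 < N" by (simp add: N_def add_nonneg_pos)
  have M: "0 \<le> M" using order_trans[OF H_nonneg H_le] .
  have zero: "sin (N * (of_int i * cell n)) = 0" for i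
  proof -
    have "N * (of_int i * cell n) = of_int i * pi"
      unfolding cell_mult'[of n, symmetric] N_def by simp
    then show ?thesis unfolding sin_zero_iff_int2 by blast
  qed
  have near: "bumps n H t \<le> M * (N * \<bar>t - of_int i * cell n\<bar>)" for t i
  proof -
    have "\<bar>sin (N * t)\<bar> \<le> N * \<bar>t - of_int i * cell n\<bar>"
      using abs_sin_diff_le[of N t "of_int i * cell n"] N zero[of i] by simp
    then show ?thesis
      unfolding bumps_def N_def[symmetric] using cell_height_bounds M by (intro mult_mono) auto
  qed
  have main: "\<bar>bumps n H x - bumps n H y\<bar> \<le> M * N * (y - x)" if "x \<le> y" for x y
  proof -
    obtain i s where i: "0 \<le> s" "s < cell n" "x = s + of_int i * cell n" "i = \<lfloor>x / cell n\<rfloor>"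
      by (rule cell_decomp)
    obtain j r where j: "0 \<le> r" "r < cell n" "y = r + of_int j * cell n" "j = \<lfloor>y / cell n\<rfloor>"
      by (rule cell_decomp)
    show ?thesis
    proof (cases "i = j")
      case True
      then have "\<bar>bumps n H x - bumps n H y\<bar>
        = cell_height H (nat (i mod (2 * int n + 1))) * \<bar>\<bar>sin (N * x)\<bar> - \<bar>sin (N * y)\<bar>\<bar>"
        using cell_height_bounds(1) i(4) j(4)
        by (simp add: bumps_def N_def[symmetric] abs_mult flip: right_diff_distrib)
      also have "\<dots> \<le> M * (N * \<bar>x - y\<bar>)"
        using cell_height_bounds M N abs_sin_diff_le[of N x y] by (intro mult_mono) auto
      finally show ?thesis using that by simp
    next
      case False
      have "i \<le> j" using that cell_pos[of n] i(4) j(4) by (simp add: floor_mono divide_right_mono)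
      then have "i + 1 \<le> j" using False by simp
      then have "of_int (i + 1) * cell n \<le> of_int j * cell n"
        using cell_pos[of n] by (intro mult_right_mono) auto
      then have "x \<le> of_int (i + 1) * cell n" "of_int (i + 1) * cell n \<le> y" "of_int (i + 1) * cell n \<le> of_int j * cell n" "of_int j * cell n \<le> y"
        using i(1-3) j(1-3) by (auto simp: algebra_simps)
      then have "N * \<bar>x - of_int (i + 1) * cell n\<bar> \<le> N * (y - x)" "N * \<bar>y - of_int j * cell n\<bar> \<le> N * (y - x)"
        using N by (intro mult_left_mono; linarith)+
      then have "bumps n H x \<le> M * (N * (y - x))" "bumps n H y \<le> M * (N * (y - x))"
        using order_trans[OF near[of x "i + 1"] mult_left_mono[OF _ M]]
          order_trans[OF near[of y j] mult_left_mono[OF _ M]] by blast+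
      then show ?thesis
        using bumps_bounds(1)[of x] bumps_bounds(1)[of y] by (simp add: abs_le_iff mult.assoc)
    qed
  qed
  show ?thesis
    using main[of x y] main[of y x] by (cases "x \<le> y") (auto simp: N_def abs_minus_commute)
qed

lemma bumps_continuous: "continuous_on UNIV (bumps n H)"
  using bumps_lipschitz order_trans[OF H_nonneg H_le]
  by (intro lipschitz_on_continuous_on[of "M * (real n + 1 / 2)"] lipschitz_onI) (auto simp: dist_real_def)

text \<open>Bumps sit only where the kernel is positive, so nothing cancels, and the product of the
  two sines is a square. On cell \<open>2 * j\<close> one has
  \<open>2 * sin (t / 2) \<le> t \<le> 3 * j * h\<close>, and the squared sine integrates to
  \<open>h / 2\<close> over a cell: the factors \<open>1 / (3 * h)\<close>, \<open>h / 2\<close> and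
  \<open>1 / pi\<close> give \<open>1 / (6 * pi)\<close>.\<close>

lemma bumps_partial_sum_ge: "(\<Sum>j=1..n-1. H j / real j) / (6 * pi) \<le> fourier_partial_sum (bumps n H) n 0"
proof -
  define N where "N = real n + 1 / 2"
  define h where "h = cell n"
  have h: "0 < h" and hN: "N * h = pi" and h2: "(2 * real n + 1) * h = 2 * pi"
    using cell_pos cell_mult cell_mult' by (auto simp: h_def N_def)
  have N: "0 < N" by (simp add: N_def add_nonneg_pos)
  define E where "E s = (\<Sum>k<2*n+1. bumps n H (0 + (s + real k * h)) * dirichlet_kernel n (s + real k * h))" for s
  define S where "S = (\<Sum>j=1..n-1. H j / real j)"
  have ge: "S / (3 * h) * (sin (N * s))\<^sup>2 \<le> E s" if s: "s \<in> {0..h}" for s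
  proof -
    have "N * s \<le> N * h" using s N by (intro mult_left_mono) auto
    then have sin0: "0 \<le> sin (N * s)"
      using s N hN by (intro sin_ge_zero) auto
    have "E s = (\<Sum>k<2*n+1. cell_height H k * (\<bar>sin (N * s)\<bar> * dirichlet_kernel n (s + real k * h)))"
      unfolding E_def using s by (intro sum.cong refl) (simp add: bumps_cell h_def N_def)
    also have "\<dots> = (\<Sum>j=1..n-1. H j * (\<bar>sin (N * s)\<bar> * dirichlet_kernel n (s + real (2 * j) * h)))"
      using n H0 Hn by (intro sum_cell_height[where g="\<lambda>k c. c * (\<bar>sin (N * s)\<bar> * dirichlet_kernel n (s + real k * h))"]) auto
    also have "\<dots> \<ge> (\<Sum>j=1..n-1. H j / real j * ((sin (N * s))\<^sup>2 / (3 * h)))"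
    proof (rule sum_mono)
      fix j assume j: "j \<in> {1..n-1}"
      define t where "t = s + real (2 * j) * h"
      have t0: "0 < t" using j s h by (simp add: t_def add_nonneg_pos)
      have "t \<le> (2 * real j + 1) * h" using s by (simp add: t_def algebra_simps)
      also have "\<dots> \<le> 3 * (real j * h)" using j h by (simp add: algebra_simps mult_le_cancel_left1)
      finally have t3: "t \<le> 3 * (real j * h)" .
      have "t \<le> (2 * real j + 1) * h" using s by (simp add: t_def algebra_simps)
      also have "\<dots> < (2 * real n + 1) * h" using j h by (intro mult_strict_right_mono) auto
      finally have t2: "t < 2 * pi" using h2 by simp
      have "dirichlet_kernel n t = sin (N * s) * (1 / (2 * sin (t / 2)))"
        using dirichlet_kernel_cell[of s "2 * j" n] t0 t2 unfolding t_def h_def N_def by simp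
      moreover have "1 / (3 * (real j * h)) \<le> 1 / (2 * sin (t / 2))"
        using sin_half_ge(1)[OF t0 t2] t0 t3 j h sin_x_le_x[of "t / 2"] by (intro divide_left_mono) (auto intro!: mult_pos_pos)
      ultimately have "sin (N * s) * (1 / (3 * (real j * h))) \<le> dirichlet_kernel n t"
        using sin0 by (simp only: mult_left_mono)
      then have "\<bar>sin (N * s)\<bar> * (sin (N * s) * (1 / (3 * (real j * h)))) \<le> \<bar>sin (N * s)\<bar> * dirichlet_kernel n t"
        by (intro mult_left_mono) auto
      then have "H j * (\<bar>sin (N * s)\<bar> * (sin (N * s) * (1 / (3 * (real j * h))))) \<le> H j * (\<bar>sin (N * s)\<bar> * dirichlet_kernel n t)"
        by (rule mult_left_mono) (rule H_nonneg)
      then show "H j / real j * ((sin (N * s))\<^sup>2 / (3 * h)) \<le> H j * (\<bar>sin (N * s)\<bar> * dirichlet_kernel n (s + real (2 * j) * h))"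
        using sin0 by (simp add: t_def power2_eq_square mult_ac)
    qed
    finally show ?thesis
      by (simp add: S_def sum_divide_distrib sum_distrib_right)
  qed
  have sin2: "((\<lambda>s. (sin (N * s))\<^sup>2) has_integral (h / 2 - sin (2 * (N * h)) / (4 * N) - (0 / 2 - sin (2 * (N * 0)) / (4 * N)))) {0..h}"
    using h N
    by (intro fundamental_theorem_of_calculus)
      (auto intro!: derivative_eq_intros simp: cos_double_sin diff_divide_distrib simp flip: has_real_derivative_iff_has_vector_derivative)
  have contE: "continuous_on {0..h} E"
    unfolding E_def by (intro continuous_intros continuous_on_compose2[OF bumps_continuous]) auto
  have "((\<lambda>s. S / (3 * h) * (sin (N * s))\<^sup>2) has_integral (S / (3 * h) * (h / 2))) {0..h}"
    using has_integral_mult_right[OF sin2, of "S / (3 * h)"] by (simp add: hN)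
  then have "S / (3 * h) * (h / 2) \<le> integral {0..h} E"
    using integrable_integral[OF integrable_continuous_real[OF contE]] ge by (rule has_integral_le)
  then have "S / 6 \<le> integral {0..h} E"
    using h by simp
  then have "S / 6 / pi \<le> integral {0..h} E / pi"
    by (intro divide_right_mono) auto
  also have "integral {0..h} E / pi = fourier_partial_sum (bumps n H) n 0"
    unfolding E_def h_def by (rule fourier_partial_sum_eq_cells[OF bumps_continuous bumps_periodic, symmetric])
  finally show ?thesis by (simp add: S_def)
qed

text \<open>Truncating \<open>u\<^sup>p\<close> at the level \<open>H m powr p\<close> costs at most that level per interval, and the
  truncated function, made of at most \<open>m\<close> unimodal bumps, has finite total variation.\<close>

lemma bumps_variation_le:
  assumes p: "1 \<le> p" and m: "1 \<le> m" and anti: "\<And>i j. 1 \<le> i \<Longrightarrow> i \<le> j \<Longrightarrow> H j \<le> H i"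
    and ab: "nonoverlapping_intervals m a b"
  shows "(\<Sum>j<m. \<bar>bumps n H (b j) - bumps n H (a j)\<bar> powr p) \<le> 2 * (\<Sum>k=1..m. H k powr p)"
proof -
  define N where "N = real n + 1 / 2"
  define \<Lambda> where "\<Lambda> = H m powr p"
  define \<phi> where "\<phi> k y = max ((cell_height H k * y) powr p - \<Lambda>) 0" for k y
  define U where "U t = max (bumps n H t powr p - \<Lambda>) 0" for t
  \<comment> \<open>The sum of the monotone parts, in contrast to their difference that makes up
    \<open>U\<close>: its increments dominate those of \<open>U\<close> in absolute value and add up
    over nonoverlapping intervals.\<close>
  define G where "G k t = rise (\<phi> k) (N * t - real k * pi) + fall (\<phi> k) (N * t - real k * pi)" for k t
  have N: "0 < N" by (simp add: N_def add_nonneg_pos)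
  have ab': "0 \<le> a j \<and> a j \<le> b j \<and> b j \<le> 2 * pi" if "j < m" for j
    using ab that by (simp add: nonoverlapping_intervals_def)
  have \<phi>_mono: "mono_on {0..1} (\<phi> k)" for k
  proof (rule mono_onI)
    fix r s :: real assume "r \<in> {0..1}" "s \<in> {0..1}" "r \<le> s"
    then have "(cell_height H k * r) powr p \<le> (cell_height H k * s) powr p"
      using p cell_height_bounds(1)[of k] by (intro powr_mono2 mult_left_mono) auto
    then show "\<phi> k r \<le> \<phi> k s" by (auto simp: \<phi>_def)
  qed
  have \<phi>0: "\<phi> k 0 = 0" for k by (simp add: \<phi>_def \<Lambda>_def)
  note rf = rise_fall[OF \<phi>_mono \<phi>0]
  have U: "U t = (\<Sum>k<2*n+1. rise (\<phi> k) (N * t - real k * pi) - fall (\<phi> k) (N * t - real k * pi))"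
    if t: "0 \<le> t" "t \<le> 2 * pi" for t
  proof -
    \<comment> \<open>At \<open>t = 2 * pi\<close> the floor would give the index
      \<open>2 * n + 1\<close>, outside the range; the right endpoint of the last cell is taken
      instead.\<close>
    obtain i s where i: "i < 2 * n + 1" "0 \<le> s" "s \<le> cell n" "t = s + real i * cell n"
    proof (cases "t = 2 * pi")
      case True
      then have "t = cell n + real (2 * n) * cell n"
        using cell_mult[of n] by (simp add: algebra_simps)
      then show thesis using that[of "2 * n" "cell n"] cell_pos[of n] by auto
    next
      case False
      obtain i s where i: "0 \<le> s" "s < cell n" "t = s + of_int i * cell n" "i = \<lfloor>t / cell n\<rfloor>"
        by (rule cell_decomp)
      have "0 \<le> i" using i(4) t cell_pos[of n] by simp
      moreover have "of_int i * cell n < (2 * real n + 1) * cell n"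
        using i t False by (simp only: cell_mult)
      then have "of_int i < 2 * real n + 1" using cell_pos[of n] by (simp add: mult_less_cancel_right)
      then have "i < 2 * int n + 1" by linarith
      ultimately show thesis using that[of "nat i" s] i(1-3) by simp
    qed
    have Nt: "N * t - real k * pi = N * s + (real i - real k) * pi" for k
    proof -
      have "N * t = N * s + real i * (N * cell n)"
        unfolding i(4) by (simp only: algebra_simps)
      then show ?thesis
        using cell_mult'[of n] by (simp add: N_def left_diff_distrib)
    qed
    have "N * s \<le> N * cell n" using i N by (intro mult_left_mono) auto
    then have Ns: "0 \<le> N * s" "N * s \<le> pi" using i N cell_mult'[of n] by (auto simp: N_def)
    have "(\<Sum>k<2*n+1. rise (\<phi> k) (N * t - real k * pi) - fall (\<phi> k) (N * t - real k * pi))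
      = (\<Sum>k<2*n+1. if k = i then \<phi> i (sin (N * s)) else 0)"
    proof (intro sum.cong refl)
      fix k
      have "\<phi> k (sin (max 0 (min (N * t - real k * pi) pi))) = (if k = i then \<phi> i (sin (N * s)) else 0)"
      proof (cases k i rule: linorder_cases)
        case less
        then have "1 * pi \<le> (real i - real k) * pi" by (intro mult_right_mono) auto
        then have "pi \<le> N * t - real k * pi" using Ns unfolding Nt by linarith
        then have "max 0 (min (N * t - real k * pi) pi) = pi" by simp
        then show ?thesis using less by (simp add: \<phi>0)
      next
        case equal
        then show ?thesis using Ns by (simp add: Nt)
      next
        case greater
        then have "(real i - real k) * pi \<le> (- 1) * pi" by (intro mult_right_mono) auto
        then have "N * t - real k * pi \<le> 0" using Ns unfolding Nt by linarith
        then have "max 0 (min (N * t - real k * pi) pi) = 0" by simp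
        then show ?thesis using greater by (simp add: \<phi>0)
      qed
      then show "rise (\<phi> k) (N * t - real k * pi) - fall (\<phi> k) (N * t - real k * pi) = (if k = i then \<phi> i (sin (N * s)) else 0)"
        by (simp only: rf)
    qed
    also have "\<dots> = \<phi> i (sin (N * s))" using i by simp
    also have "\<dots> = U t"
      using bumps_cell[OF i(2,3,1)] Ns i(4) sin_ge_zero[OF Ns] by (simp add: U_def \<phi>_def N_def)
    finally show ?thesis by simp
  qed
  have G_mono: "mono (G k)" for k
  proof (rule monoI)
    fix s t :: real assume "s \<le> t"
    then have "N * s - real k * pi \<le> N * t - real k * pi" using N by (simp add: mult_left_mono)
    then show "G k s \<le> G k t" unfolding G_def by (intro add_mono monoD[OF rf(1)] monoD[OF rf(2)])
  qed
  have G_total: "G k (2 * pi) - G k 0 \<le> 2 * \<phi> k 1" for k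
    unfolding G_def using rf(3)[of k] rf(4)[of k] rf(5)[of k] rf(6)[of k] by (smt (verit))
  have step: "\<bar>bumps n H (b j) - bumps n H (a j)\<bar> powr p \<le> \<Lambda> + (\<Sum>k<2*n+1. G k (b j) - G k (a j))"
    if j: "j < m" for j
  proof -
    have powr_abs: "\<bar>x - y\<bar> powr p \<le> \<bar>x powr p - y powr p\<bar>" if "0 \<le> x" "0 \<le> y" for x y :: real
      using powr_diff_superadditive[OF p, of x y] powr_diff_superadditive[OF p, of y x] that
      by (cases "x \<le> y") (auto simp: abs_minus_commute)
    have "\<bar>bumps n H (b j) - bumps n H (a j)\<bar> powr p \<le> \<bar>bumps n H (b j) powr p - bumps n H (a j) powr p\<bar>"
      by (intro powr_abs bumps_bounds)
    also have "\<dots> \<le> \<Lambda> + \<bar>U (b j) - U (a j)\<bar>"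
    proof -
      have "0 \<le> \<Lambda>" "0 \<le> bumps n H (b j) powr p" "0 \<le> bumps n H (a j) powr p" by (auto simp: \<Lambda>_def)
      then show ?thesis unfolding U_def by linarith
    qed
    also have "\<bar>U (b j) - U (a j)\<bar> \<le> (\<Sum>k<2*n+1. G k (b j) - G k (a j))"
    proof -
      have abs4: "\<bar>(r' - q') - (r - q)\<bar> \<le> (r' + q') - (r + q)" if "r \<le> r'" "q \<le> q'" for r r' q q' :: real
        using that by linarith
      have "N * a j \<le> N * b j" using ab'[OF j] N by (simp add: mult_left_mono)
      have U_diff: "U (b j) - U (a j) = (\<Sum>k<2*n+1. (rise (\<phi> k) (N * b j - real k * pi) - fall (\<phi> k) (N * b j - real k * pi))
          - (rise (\<phi> k) (N * a j - real k * pi) - fall (\<phi> k) (N * a j - real k * pi)))"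
        using ab'[OF j] by (simp add: U sum_subtractf)
      show ?thesis
        unfolding U_diff
      proof (intro order_trans[OF sum_abs] sum_mono)
        fix k
        have le: "N * a j - real k * pi \<le> N * b j - real k * pi" using \<open>N * a j \<le> N * b j\<close> by simp
        show "\<bar>rise (\<phi> k) (N * b j - real k * pi) - fall (\<phi> k) (N * b j - real k * pi)
          - (rise (\<phi> k) (N * a j - real k * pi) - fall (\<phi> k) (N * a j - real k * pi))\<bar> \<le> G k (b j) - G k (a j)"
          unfolding G_def by (rule abs4[OF monoD[OF rf(1) le] monoD[OF rf(2) le]])
      qed
    qed
    finally show ?thesis by simp
  qed
  have "(\<Sum>j<m. \<bar>bumps n H (b j) - bumps n H (a j)\<bar> powr p) \<le> (\<Sum>j<m. \<Lambda> + (\<Sum>k<2*n+1. G k (b j) - G k (a j)))"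
    by (intro sum_mono step) auto
  also have "\<dots> = real m * \<Lambda> + (\<Sum>k<2*n+1. \<Sum>j<m. G k (b j) - G k (a j))"
    by (subst sum.swap) (simp add: sum.distrib)
  also have "\<dots> \<le> real m * \<Lambda> + (\<Sum>k<2*n+1. 2 * \<phi> k 1)"
  proof (intro add_left_mono sum_mono)
    fix k
    have "(\<Sum>j<m. G k (b j) - G k (a j)) \<le> G k (2 * pi) - G k 0"
      using ab ab' by (intro sum_mono_increments_le G_mono) (auto simp: nonoverlapping_intervals_def)
    then show "(\<Sum>j<m. G k (b j) - G k (a j)) \<le> 2 * \<phi> k 1" using G_total[of k] by linarith
  qed
  also have "(\<Sum>k<2*n+1. 2 * \<phi> k 1) = (\<Sum>j=1..n-1. 2 * max (H j powr p - \<Lambda>) 0)"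
  proof -
    have "(\<Sum>k<2*n+1. 2 * max (cell_height H k powr p - \<Lambda>) 0) = (\<Sum>j=1..n-1. 2 * max (H j powr p - \<Lambda>) 0)"
      by (rule sum_cell_height[OF n _ H0 Hn[OF order_refl], where g="\<lambda>k c. 2 * max (c powr p - \<Lambda>) 0"])
        (simp add: \<Lambda>_def)
    then show ?thesis by (simp only: \<phi>_def mult_1_right)
  qed
  also have "\<dots> \<le> (\<Sum>j=1..m. 2 * (H j powr p - \<Lambda>))"
  proof -
    have big: "H j powr p \<le> \<Lambda>" if "m \<le> j" for j
      unfolding \<Lambda>_def using p anti[OF m that] H_nonneg by (intro powr_mono2) auto
    have small: "\<Lambda> \<le> H j powr p" if "1 \<le> j" "j \<le> m" for j
      unfolding \<Lambda>_def using p anti[OF that] H_nonneg by (intro powr_mono2) auto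
    have "(\<Sum>j=1..n-1. 2 * max (H j powr p - \<Lambda>) 0) = (\<Sum>j\<in>{1..n-1} \<inter> {1..m}. 2 * max (H j powr p - \<Lambda>) 0)"
      using big by (intro sum.mono_neutral_right) (auto simp: max_def)
    also have "\<dots> \<le> (\<Sum>j=1..m. 2 * max (H j powr p - \<Lambda>) 0)"
      by (intro sum_mono2) auto
    also have "\<dots> = (\<Sum>j=1..m. 2 * (H j powr p - \<Lambda>))"
      by (intro sum.cong refl) (simp add: small max_absorb1)
    finally show ?thesis .
  qed
  \<comment> \<open>Heights being nonincreasing, at most the first \<open>m\<close> bumps survive
    the truncation, and each loses \<open>2 * \<Lambda>\<close>. This more than absorbs the cost
    \<open>\<Lambda>\<close> paid for each of the \<open>m\<close> intervals.\<close>
  also have "real m * \<Lambda> + (\<Sum>j=1..m. 2 * (H j powr p - \<Lambda>)) = 2 * (\<Sum>j=1..m. H j powr p) - real m * \<Lambda>"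
    by (simp add: sum_subtractf right_diff_distrib flip: sum_distrib_left)
  also have "\<dots> \<le> 2 * (\<Sum>j=1..m. H j powr p)"
    by (simp add: \<Lambda>_def)
  finally show ?thesis by simp
qed

end


subsection \<open>The gliding hump\<close>

lemma fourier_partial_sum_sum:
  fixes g :: "nat \<Rightarrow> real \<Rightarrow> real"
  assumes "\<And>i. i < m \<Longrightarrow> continuous_on UNIV (g i)"
  shows "fourier_partial_sum (\<lambda>t. \<Sum>i<m. g i t) n x = (\<Sum>i<m. fourier_partial_sum (g i) n x)"
  using assms
proof (induction m)
  case 0
  then show ?case using fourier_partial_sum_const[of 0] by simp
next
  case (Suc m)
  have "continuous_on UNIV (\<lambda>t. \<Sum>i<m. g i t)"
    using Suc.prems by (intro continuous_on_sum) auto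
  then show ?case
    using Suc fourier_partial_sum_add[of "\<lambda>t. \<Sum>i<m. g i t" "g m" n x] by simp
qed

lemma sum_half_powers_le: "(\<Sum>k<m. (1 / 2) ^ k) \<le> (2 :: real)"
  using sum_gp_strict[of "1/2::real" m] by simp

context moduli
begin

section \<open>Test functions with bounds uniform in \<open>n\<close>\<close>

definition bump_height :: "nat \<Rightarrow> nat \<Rightarrow> real" where
  "bump_height n j = (if 1 \<le> j \<and> j \<le> \<theta> n then \<omega> (1 / real n)
     else if \<theta> n < j \<and> j < n then eps_p \<nu> p j else 0)"

definition test_fun :: "nat \<Rightarrow> real \<Rightarrow> real" where
  "test_fun n = bumps n (bump_height n)"

context
  fixes n :: nat
  assumes n: "2 \<le> n" and \<omega>_small: "\<omega> (1 / real n) \<le> \<nu> 1"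
begin

text \<open>Beyond \<open>\<theta> n\<close> the height \<open>eps_p \<nu> p j\<close> is at most
  \<open>\<nu> j / j powr (1 / p)\<close>, which has dropped below \<open>\<omega> (1 / n)\<close>.
  Hence the heights do not jump up at \<open>\<theta> n\<close>.\<close>

lemma bump_height_facts:
  shows "bump_height n 0 = 0" "n \<le> j \<Longrightarrow> bump_height n j = 0" "0 \<le> bump_height n j"
    and bump_height_le: "bump_height n j \<le> \<omega> (1 / real n)"
proof -
  show "bump_height n 0 = 0" by (simp add: bump_height_def)
  show "n \<le> j \<Longrightarrow> bump_height n j = 0"
    using theta_le[OF n] n by (auto simp: bump_height_def)
  show "0 \<le> bump_height n j"
    by (auto simp: bump_height_def eps_p_nonneg \<omega>_nonneg)
  show "bump_height n j \<le> \<omega> (1 / real n)"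
    using order_trans[OF eps_p_le[of j] \<nu>_ratio_le_\<omega>[OF n, of j]] \<omega>_nonneg[of "1 / real n"]
    by (auto simp: bump_height_def)
qed

lemma bump_height_antimono:
  assumes "1 \<le> i" "i \<le> j"
  shows "bump_height n j \<le> bump_height n i"
proof (cases "i \<le> \<theta> n")
  case True
  then show ?thesis
    using bump_height_le[of j] assms by (simp add: bump_height_def)
next
  case False
  then show ?thesis
    using assms eps_p_antimono[of i j] by (auto simp: bump_height_def eps_p_nonneg)
qed

text \<open>Up to \<open>\<theta> n\<close> the equal heights cost
  \<open>i * \<omega> (1 / n) powr p\<close>, at most \<open>\<nu> i powr p\<close> by the position
  of \<open>\<theta> n\<close>; beyond it the powers of \<open>eps_p\<close> telescope. The minimum
  records that the total stops growing once all bumps are counted.\<close>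

lemma sum_bump_height_powr_le: "(\<Sum>k=1..m. bump_height n k powr p) \<le> \<nu> (min m (n - 1)) powr p"
proof -
  have "(\<Sum>k=1..m. bump_height n k powr p) = (\<Sum>k=1..min m (n-1). bump_height n k powr p)"
    using bump_height_facts(2) n by (intro sum.mono_neutral_right) auto
  also have "\<dots> \<le> \<nu> (min m (n - 1)) powr p"
  proof -
    define l where "l = min m (n - 1)"
    have ln: "l < n" using n by (simp add: l_def)
    have low: "real i * \<omega> (1 / real n) powr p \<le> \<nu> i powr p" if "i \<le> \<theta> n" for i
    proof (cases "i = 0")
      case False
      then have "\<omega> (1 / real n) powr p \<le> (\<nu> i / real i powr (1 / p)) powr p"
        using that p \<omega>_le_\<nu>_ratio[OF n _ that \<omega>_small] \<omega>_nonneg[of "1 / real n"] by (intro powr_mono2) auto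
      also have "\<dots> = \<nu> i powr p / real i"
        using p \<nu>_nonneg by (simp add: powr_divide powr_powr)
      finally show ?thesis using False by (simp add: field_simps)
    qed simp
    have "(\<Sum>k=1..l. bump_height n k powr p) \<le> \<nu> l powr p"
    proof (cases "l \<le> \<theta> n")
      case True
      then have "(\<Sum>k=1..l. bump_height n k powr p) = (\<Sum>k=1..l. \<omega> (1 / real n) powr p)"
        by (intro sum.cong) (auto simp: bump_height_def)
      then show ?thesis using low[OF True] by simp
    next
      case False
      have "{1..l} = {1..\<theta> n} \<union> {\<theta> n+1..l}" "{1..\<theta> n} \<inter> {\<theta> n+1..l} = {}"
        using False theta_ge[OF n] by auto
      then have "(\<Sum>k=1..l. bump_height n k powr p)
        = (\<Sum>k=1..\<theta> n. bump_height n k powr p) + (\<Sum>k=\<theta> n+1..l. bump_height n k powr p)"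
        by (simp add: sum.union_disjoint)
      also have "(\<Sum>k=1..\<theta> n. bump_height n k powr p) = (\<Sum>k=1..\<theta> n. \<omega> (1 / real n) powr p)"
        by (intro sum.cong) (auto simp: bump_height_def)
      also have "(\<Sum>k=\<theta> n+1..l. bump_height n k powr p) = (\<Sum>k=\<theta> n+1..l. eps_p \<nu> p k powr p)"
        using ln by (intro sum.cong) (auto simp: bump_height_def)
      also have "\<dots> = \<nu> l powr p - \<nu> (\<theta> n) powr p"
        using False by (intro sum_eps_p_powr) auto
      finally show ?thesis using low[of "\<theta> n"] by simp
    qed
    then show ?thesis by (simp add: l_def)
  qed
  finally show ?thesis .
qed

lemma n_ge_1: "1 \<le> n"
  using n by simp

lemmas bumps_bump_height = n_ge_1 bump_height_facts(1-3)

lemma test_fun_periodic: "periodic_2pi (test_fun n)"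
  unfolding test_fun_def by (rule bumps_periodic)

lemma test_fun_continuous: "continuous_on UNIV (test_fun n)"
  unfolding test_fun_def by (rule bumps_continuous[where H="bump_height n", OF bumps_bump_height bump_height_le])

lemma test_fun_bounds: "0 \<le> test_fun n t" "test_fun n t \<le> \<omega> (1 / real n)"
  unfolding test_fun_def
  using bumps_bounds[where H="bump_height n", OF bumps_bump_height bump_height_le] by blast+

lemma test_fun_diff_le: "\<bar>test_fun n x - test_fun n y\<bar> \<le> \<omega> (1 / real n)"
  using test_fun_bounds[of x] test_fun_bounds[of y] by linarith

lemma test_fun_0: "test_fun n 0 = 0"
  by (simp add: test_fun_def bumps_def)

lemma test_fun_lipschitz: "\<bar>test_fun n x - test_fun n y\<bar> \<le> 2 * real n * \<omega> (1 / real n) * \<bar>x - y\<bar>"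
proof -
  have "\<bar>test_fun n x - test_fun n y\<bar> \<le> \<omega> (1 / real n) * (real n + 1 / 2) * \<bar>x - y\<bar>"
    unfolding test_fun_def by (rule bumps_lipschitz[where H="bump_height n", OF bumps_bump_height bump_height_le])
  also have "\<dots> \<le> \<omega> (1 / real n) * (2 * real n) * \<bar>x - y\<bar>"
    using n \<omega>_nonneg[of "1 / real n"] by (intro mult_right_mono mult_left_mono) auto
  finally show ?thesis by (simp add: mult_ac)
qed

text \<open>At scales below \<open>1 / n\<close> the factor 4 is the 2 of the Lipschitz constant
  times the 2 of \<open>\<omega>_ratio_le\<close>; at larger scales the height alone
  suffices.\<close>

lemma test_fun_\<omega>: "\<bar>test_fun n x - test_fun n y\<bar> \<le> 4 * \<omega> \<bar>x - y\<bar>"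
proof (cases "\<bar>x - y\<bar> \<le> 1 / real n")
  case True
  show ?thesis
  proof (cases "x = y")
    case False
    then have "\<bar>x - y\<bar> * \<omega> (1 / real n) \<le> 2 * (1 / real n) * \<omega> \<bar>x - y\<bar>"
      using True by (intro \<omega>_ratio_le) auto
    then have "2 * real n * (\<bar>x - y\<bar> * \<omega> (1 / real n)) \<le> 2 * real n * (2 * (1 / real n) * \<omega> \<bar>x - y\<bar>)"
      by (intro mult_left_mono) auto
    also have "\<dots> = 4 * \<omega> \<bar>x - y\<bar>" using n by simp
    finally show ?thesis using test_fun_lipschitz[of x y] by (simp add: mult_ac)
  qed simp
next
  case False
  then have "\<omega> (1 / real n) \<le> \<omega> \<bar>x - y\<bar>" by (intro \<omega>_mono) auto
  moreover have "0 \<le> \<omega> \<bar>x - y\<bar>" by (intro \<omega>_nonneg) simp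
  ultimately show ?thesis using test_fun_diff_le[of x y] by linarith
qed

lemma test_fun_partial_sum_ge: "sigma \<omega> \<nu> p n / (6 * pi) \<le> fourier_partial_sum (test_fun n) n 0"
proof -
  have "{1..n-1} = {1..\<theta> n} \<union> {\<theta> n+1..n-1}" "{1..\<theta> n} \<inter> {\<theta> n+1..n-1} = {}"
    using theta_ge[OF n] theta_le[OF n] by auto
  then have "(\<Sum>j=1..n-1. bump_height n j / real j)
    = (\<Sum>j=1..\<theta> n. bump_height n j / real j) + (\<Sum>j=\<theta> n+1..n-1. bump_height n j / real j)"
    by (simp add: sum.union_disjoint)
  also have "(\<Sum>j=1..\<theta> n. bump_height n j / real j) = (\<Sum>j=1..\<theta> n. \<omega> (1 / real n) * (1 / real j))"
    by (intro sum.cong) (auto simp: bump_height_def)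
  also have "(\<Sum>j=\<theta> n+1..n-1. bump_height n j / real j) = (\<Sum>j=\<theta> n+1..n-1. eps_p \<nu> p j / real j)"
    using n by (intro sum.cong) (auto simp: bump_height_def)
  finally have "sigma \<omega> \<nu> p n = (\<Sum>j=1..n-1. bump_height n j / real j)"
    unfolding sigma_def by (simp only: sum_distrib_left)
  then show ?thesis
    using bumps_partial_sum_ge[where H="bump_height n", OF bumps_bump_height bump_height_le] by (simp add: test_fun_def)
qed

text \<open>The first bound saturates in \<open>m\<close> and makes an early train negligible for
  many intervals; the second uses only the height and makes a late train negligible for few.\<close>

lemma test_fun_variation:
  assumes m: "1 \<le> m" and ab: "nonoverlapping_intervals m a b"
  shows "(\<Sum>j<m. \<bar>test_fun n (b j) - test_fun n (a j)\<bar> powr p) powr (1 / p) \<le> 2 * \<nu> (min m (n - 1))"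
    and "(\<Sum>j<m. \<bar>test_fun n (b j) - test_fun n (a j)\<bar> powr p) powr (1 / p) \<le> real m powr (1 / p) * \<omega> (1 / real n)"
proof -
  have two: "2 powr (1 / p) \<le> (2 :: real)"
    using p powr_mono[of "1 / p" 1 "2 :: real"] by simp
  have "(\<Sum>j<m. \<bar>test_fun n (b j) - test_fun n (a j)\<bar> powr p) \<le> 2 * (\<Sum>k=1..m. bump_height n k powr p)"
    unfolding test_fun_def by (rule bumps_variation_le[where H="bump_height n", OF bumps_bump_height bump_height_le p m bump_height_antimono ab])
  also have "\<dots> \<le> 2 * \<nu> (min m (n - 1)) powr p"
    using sum_bump_height_powr_le[of m] by simp
  finally have "(\<Sum>j<m. \<bar>test_fun n (b j) - test_fun n (a j)\<bar> powr p) powr (1 / p) \<le> (2 * \<nu> (min m (n - 1)) powr p) powr (1 / p)"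
    using p by (intro powr_mono2 sum_nonneg) auto
  also have "\<dots> = 2 powr (1 / p) * \<nu> (min m (n - 1))"
    using p \<nu>_nonneg by (simp add: powr_mult powr_powr)
  also have "\<dots> \<le> 2 * \<nu> (min m (n - 1))"
    using two \<nu>_nonneg by (intro mult_right_mono)
  finally show "(\<Sum>j<m. \<bar>test_fun n (b j) - test_fun n (a j)\<bar> powr p) powr (1 / p) \<le> 2 * \<nu> (min m (n - 1))" .
  have "(\<Sum>j<m. \<bar>test_fun n (b j) - test_fun n (a j)\<bar> powr p) \<le> (\<Sum>j<m. \<omega> (1 / real n) powr p)"
    using p test_fun_diff_le by (intro sum_mono powr_mono2) auto
  then have "(\<Sum>j<m. \<bar>test_fun n (b j) - test_fun n (a j)\<bar> powr p) powr (1 / p) \<le> (real m * \<omega> (1 / real n) powr p) powr (1 / p)"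
    using p by (intro powr_mono2 sum_nonneg) auto
  also have "\<dots> = real m powr (1 / p) * \<omega> (1 / real n)"
    using p \<omega>_nonneg[of "1 / real n"] by (simp add: powr_mult powr_powr)
  finally show "(\<Sum>j<m. \<bar>test_fun n (b j) - test_fun n (a j)\<bar> powr p) powr (1 / p) \<le> real m powr (1 / p) * \<omega> (1 / real n)" .
qed

lemma test_fun_partial_sums_tendsto: "(\<lambda>N. fourier_partial_sum (test_fun n) N 0) \<longlonglongrightarrow> 0"
  using lipschitz_fourier_tendsto[OF test_fun_periodic test_fun_lipschitz, of 0] by (simp add: test_fun_0)

end

text \<open>No scale \<open>t\<close> and no number \<open>m\<close> of intervals sees more than one of the test functions number
  \<open>a\<close> (chosen \<open>k\<close>-th) and \<open>b\<close> (chosen \<open>i\<close>-th), up to the fractions \<open>(1 / 2) ^ k\<close> and \<open>(1 / 2) ^ i\<close>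
  of \<open>\<omega> t\<close> and \<open>\<nu> m\<close>, and neither disturbs the partial sum at \<open>0\<close> belonging to the other.\<close>

definition separated :: "real \<Rightarrow> nat \<Rightarrow> nat \<Rightarrow> nat \<Rightarrow> nat \<Rightarrow> bool" where
  "separated \<eta> i k a b \<longleftrightarrow>
     (\<forall>t>0. \<omega> t < 2 ^ k * (2 * real a * \<omega> (1 / real a) * t) \<longrightarrow> 2 ^ i * \<omega> (1 / real b) \<le> \<omega> t) \<and>
     (\<forall>m\<ge>1. \<nu> m < 2 ^ k * (2 * \<nu> a) \<longrightarrow> 2 ^ i * (real m powr (1 / p) * \<omega> (1 / real b)) \<le> \<nu> m) \<and>
     \<bar>fourier_partial_sum (test_fun a) b 0\<bar> \<le> \<eta> * (1 / 2) ^ k \<and>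
     (2 * real a + 1) * \<omega> (1 / real b) \<le> \<eta> * (1 / 2) ^ i"

text \<open>With \<open>a\<close> fixed, the first premise fails for all small \<open>t\<close> and
  the second for all large \<open>m\<close>. What remains keeps \<open>\<omega> t\<close> bounded
  below and \<open>m\<close> bounded above, and there \<open>\<omega> (1 / b)\<close> tending to 0
  is enough. The third condition is convergence for the fixed Lipschitz function
  \<open>test_fun a\<close>.\<close>

lemma eventually_separated:
  assumes a: "2 \<le> a" "\<omega> (1 / real a) \<le> \<nu> 1" and \<eta>: "0 < \<eta>"
  shows "eventually (\<lambda>b. separated \<eta> i k a b) sequentially"
proof -
  have small: "eventually (\<lambda>b. c * \<omega> (1 / real b) \<le> e) sequentially" if "0 < e" for c e :: real
    using order_tendstoD(2)[OF tendsto_mult_right_zero[OF \<omega>_tendsto_0, of c] that]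
    by (rule eventually_mono) simp
  obtain d where d: "0 < d" "\<And>t. 0 < t \<Longrightarrow> t \<le> d \<Longrightarrow> 2 ^ k * (2 * real a * \<omega> (1 / real a)) * t \<le> \<omega> t"
    using \<omega>_ge_linear[of "2 ^ k * (2 * real a * \<omega> (1 / real a))"] by blast
  have 1: "eventually (\<lambda>b. \<forall>t>0. \<omega> t < 2 ^ k * (2 * real a * \<omega> (1 / real a) * t) \<longrightarrow> 2 ^ i * \<omega> (1 / real b) \<le> \<omega> t) sequentially"
    using small[OF \<omega>_pos[OF d(1)], of "2 ^ i"]
  proof eventually_elim
    case (elim b)
    show ?case
    proof (intro allI impI)
      fix t :: real assume t: "0 < t" "\<omega> t < 2 ^ k * (2 * real a * \<omega> (1 / real a) * t)"
      then have "\<not> t \<le> d" using d(2)[of t] by (auto simp: mult.assoc)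
      then have "\<omega> d \<le> \<omega> t" using d(1) by (intro \<omega>_mono) auto
      then show "2 ^ i * \<omega> (1 / real b) \<le> \<omega> t" using elim by linarith
    qed
  qed
  have "eventually (\<lambda>m. 2 ^ k * (2 * \<nu> a) \<le> \<nu> m) sequentially"
    using \<nu>_inf by (simp add: filterlim_at_top)
  then obtain m0 where m0: "\<And>m. m0 \<le> m \<Longrightarrow> 2 ^ k * (2 * \<nu> a) \<le> \<nu> m"
    by (auto simp: eventually_sequentially)
  have 2: "eventually (\<lambda>b. \<forall>m\<ge>1. \<nu> m < 2 ^ k * (2 * \<nu> a) \<longrightarrow> 2 ^ i * (real m powr (1 / p) * \<omega> (1 / real b)) \<le> \<nu> m) sequentially"
    using small[OF \<nu>_pos[OF order_refl], of "2 ^ i * real m0 powr (1 / p)"]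
  proof eventually_elim
    case (elim b)
    show ?case
    proof (intro allI impI)
      fix m :: nat assume m: "1 \<le> m" "\<nu> m < 2 ^ k * (2 * \<nu> a)"
      then have "\<not> m0 \<le> m" using m0[of m] by auto
      then have "2 ^ i * (real m powr (1 / p) * \<omega> (1 / real b)) \<le> 2 ^ i * (real m0 powr (1 / p) * \<omega> (1 / real b))"
        using p \<omega>_nonneg[of "1 / real b"] by (intro mult_left_mono mult_right_mono powr_mono2) auto
      also have "\<dots> \<le> \<nu> 1" using elim by (simp add: mult.assoc)
      also have "\<dots> \<le> \<nu> m" using m by (intro \<nu>_mono)
      finally show "2 ^ i * (real m powr (1 / p) * \<omega> (1 / real b)) \<le> \<nu> m" .
    qed
  qed
  have "(\<lambda>b. \<bar>fourier_partial_sum (test_fun a) b 0\<bar>) \<longlonglongrightarrow> 0"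
    using test_fun_partial_sums_tendsto[OF a] by (rule tendsto_rabs_zero)
  then have 3: "eventually (\<lambda>b. \<bar>fourier_partial_sum (test_fun a) b 0\<bar> < \<eta> * (1 / 2) ^ k) sequentially"
    using \<eta> by (intro order_tendstoD(2)) auto
  have 4: "eventually (\<lambda>b. (2 * real a + 1) * \<omega> (1 / real b) \<le> \<eta> * (1 / 2) ^ i) sequentially"
    using \<eta> by (intro small) auto
  from 1 2 3 4 show ?thesis
    unfolding separated_def by eventually_elim simp
qed

text \<open>\<open>G\<close> holds infinitely often, and separation from finitely many earlier
  choices holds for all large indices, so a next index always exists. \<open>P\<close> inspects a
  function only below \<open>i\<close>, as the choice principle demands.\<close>

lemma separated_sequence:
  assumes freq: "frequently G sequentially" and \<eta>: "0 < \<eta>"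
    and G: "\<And>n. G n \<Longrightarrow> 2 \<le> n \<and> \<omega> (1 / real n) \<le> \<nu> 1"
  obtains n :: "nat \<Rightarrow> nat" where "\<And>i. G (n i)" "strict_mono n" "\<And>i k. k < i \<Longrightarrow> separated \<eta> i k (n k) (n i)"
proof -
  define P where "P f i r \<longleftrightarrow> G r \<and> (\<forall>k<i. f k < r \<and> separated \<eta> i k (f k) r)" for f :: "nat \<Rightarrow> nat" and i r :: nat
  have "\<exists>n. \<forall>i. P n i (n i)"
  proof (rule dependent_wellorder_choice)
    show "P f i r = P g i r" if "\<And>k. k < i \<Longrightarrow> f k = g k" for r f g i
      using that by (simp add: P_def)
    fix i and f :: "nat \<Rightarrow> nat" assume "\<And>k. k < i \<Longrightarrow> P f k (f k)"
    then have "\<forall>k<i. eventually (\<lambda>r. f k < r \<and> separated \<eta> i k (f k) r) sequentially"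
      using G \<eta> by (auto simp: P_def intro!: eventually_conj eventually_gt_at_top eventually_separated)
    then have "eventually (\<lambda>r. \<forall>k\<in>{..<i}. f k < r \<and> separated \<eta> i k (f k) r) sequentially"
      by (intro eventually_ball_finite) auto
    with freq have "frequently (\<lambda>r. G r \<and> (\<forall>k\<in>{..<i}. f k < r \<and> separated \<eta> i k (f k) r)) sequentially"
      by (rule frequently_eventually_frequently)
    then show "\<exists>r. P f i r"
      unfolding P_def by (blast dest: frequently_ex)
  qed
  then obtain n where n: "\<And>i. P n i (n i)" by blast
  show thesis
  proof (rule that[of n])
    show "strict_mono n" using n by (auto simp: strict_mono_def P_def)
  qed (use n in \<open>auto simp: P_def\<close>)
qed

text \<open>All trains vanish at 0, so the series of their sum \<open>F\<close> would converge to 0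
  there; yet its partial sums of orders \<open>n i\<close> stay above a positive constant.\<close>

theorem sigma_tendsto_0_if_uniform_convergence:
  assumes conv: "\<And>f. f \<in> H_omega \<omega> \<Longrightarrow> f \<in> V_p p \<nu> \<Longrightarrow>
    uniform_limit UNIV (\<lambda>n. fourier_partial_sum f n) f sequentially"
  shows "sigma \<omega> \<nu> p \<longlonglongrightarrow> 0"
proof (rule ccontr)
  assume "\<not> sigma \<omega> \<nu> p \<longlonglongrightarrow> 0"
  then obtain c where c: "0 < c" "\<not> eventually (\<lambda>n. dist (sigma \<omega> \<nu> p n) 0 < c) sequentially"
    by (auto simp: tendsto_iff)
  have sigma_nonneg: "0 \<le> sigma \<omega> \<nu> p n" for n
    using order_trans[OF tau_nonneg tau_le_sigma] .
  have "frequently (\<lambda>n. c \<le> sigma \<omega> \<nu> p n) sequentially"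
    using c(2) sigma_nonneg by (simp add: frequently_def not_le)
  moreover have "eventually (\<lambda>n. \<omega> (1 / real n) < \<nu> 1) sequentially"
    using \<nu>_pos[of 1] by (intro order_tendstoD(2)[OF \<omega>_tendsto_0]) simp
  ultimately have "frequently (\<lambda>n. c \<le> sigma \<omega> \<nu> p n \<and> (\<omega> (1 / real n) < \<nu> 1 \<and> 2 \<le> n)) sequentially"
    using eventually_ge_at_top[of "2::nat"] by (intro frequently_eventually_frequently eventually_conj)
  then have freq: "frequently (\<lambda>n. c \<le> sigma \<omega> \<nu> p n \<and> 2 \<le> n \<and> \<omega> (1 / real n) \<le> \<nu> 1) sequentially"
    by (rule frequently_elim1) auto
  \<comment> \<open>The current train contributes at least \<open>c / 24\<close>, because
    \<open>6 * pi < 24\<close>. Earlier and later trains disturb by at most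
    \<open>2 * \<eta>\<close> each, together \<open>c / 48\<close>, which leaves
    \<open>c / 48\<close>.\<close>
  define \<eta> where "\<eta> = c / 192"
  have \<eta>: "0 < \<eta>" using c by (simp add: \<eta>_def)
  obtain n where n: "\<And>i. c \<le> sigma \<omega> \<nu> p (n i) \<and> 2 \<le> n i \<and> \<omega> (1 / real (n i)) \<le> \<nu> 1"
    and sm: "strict_mono n" and sep: "\<And>i k. k < i \<Longrightarrow> separated \<eta> i k (n k) (n i)"
    using separated_sequence[OF freq \<eta>] by blast
  define g where "g i = test_fun (n i)" for i
  define w where "w i = \<omega> (1 / real (n i))" for i
  \<comment> \<open>The first train has no predecessor and is bounded only by
    \<open>\<nu> 1\<close>, the later ones by \<open>\<eta> * (1 / 2) ^ i\<close>; the sum of both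
    constants gives one geometric majorant.\<close>
  define B where "B = \<nu> 1 + \<eta>"
  have n2: "2 \<le> n i" and nw: "\<omega> (1 / real (n i)) \<le> \<nu> 1" for i
    using n by auto
  note tf = test_fun_periodic[OF n2 nw] test_fun_continuous[OF n2 nw]
  have w0: "0 \<le> w i" for i by (simp add: w_def \<omega>_nonneg)
  have w_sep: "(2 * real (n k) + 1) * w i \<le> \<eta> * (1 / 2) ^ i" if "k < i" for k i
    using sep[OF that] by (simp add: separated_def w_def)
  have B: "0 \<le> B" using \<eta> \<nu>_nonneg[of 1] by (simp add: B_def)
  have w_le: "w i \<le> B * (1 / 2) ^ i" for i
  proof (cases "i = 0")
    case True
    then show ?thesis using n[of 0] \<eta> by (simp add: w_def B_def)
  next
    case False
    have "w i \<le> (2 * real (n 0) + 1) * w i"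
      using w0[of i] by (simp add: mult_le_cancel_right1)
    also have "\<dots> \<le> \<eta> * (1 / 2) ^ i" using False by (intro w_sep) simp
    also have "\<dots> \<le> B * (1 / 2) ^ i" using \<nu>_nonneg[of 1] by (intro mult_right_mono) (auto simp: B_def)
    finally show ?thesis .
  qed
  have g_bounds: "0 \<le> g i t" "g i t \<le> w i" for i t
    using test_fun_bounds[OF n2 nw] by (auto simp: g_def w_def)
  have g_diff: "\<bar>g i x - g i y\<bar> \<le> w i" for i x y
    unfolding g_def w_def by (rule test_fun_diff_le[OF n2 nw])
  have g_cont: "continuous_on UNIV (g i)" for i
    unfolding g_def by (rule tf(2))
  have w_summable: "summable w"
    using w_le w0 by (intro summable_comparison_test'[OF summable_mult[OF summable_geometric[of "1/2::real"], of B], of 0]) auto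
  have g_summable: "summable (\<lambda>i. g i t)" for t
    using g_bounds by (intro summable_comparison_test'[OF w_summable, of 0]) auto
  define F where "F t = (\<Sum>i. g i t)" for t
  have F_lim: "(\<lambda>M. \<Sum>i<M. g i t) \<longlonglongrightarrow> F t" for t
    unfolding F_def by (rule summable_LIMSEQ[OF g_summable])
  have F_per: "periodic_2pi F"
    using tf(1) unfolding F_def periodic_2pi_def g_def by simp
  have F_0: "F 0 = 0"
    using test_fun_0[OF n2 nw] by (simp add: F_def g_def)
  have F_bound: "\<bar>F t\<bar> \<le> B * 2" for t
  proof (rule LIMSEQ_le_const2[OF tendsto_rabs[OF F_lim]], intro exI allI impI)
    fix M :: nat
    have "\<bar>\<Sum>i<M. g i t\<bar> \<le> (\<Sum>i<M. B * (1 / 2) ^ i)"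
      using g_bounds by (intro order_trans[OF sum_abs] sum_mono order_trans[OF _ w_le]) auto
    also have "\<dots> \<le> B * 2"
      unfolding sum_distrib_left[symmetric] using B by (intro mult_left_mono sum_half_powers_le)
    finally show "\<bar>\<Sum>i<M. g i t\<bar> \<le> B * 2" .
  qed
  have F_mod: "\<bar>F x - F y\<bar> \<le> 6 * \<omega> \<bar>x - y\<bar>" for x y
  proof (cases "x = y")
    case False
    define t where "t = \<bar>x - y\<bar>"
    have t: "0 < t" using False by (simp add: t_def)
    have \<omega>t: "0 < \<omega> t" by (rule \<omega>_pos[OF t])
    have sums: "(\<Sum>i<M. \<bar>g i x - g i y\<bar> / \<omega> t) \<le> 4 + 2" for M
    \<comment> \<open>\<open>4\<close> is the constant of a single train. If train \<open>k\<close>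
      is not negligible at scale \<open>t\<close>, separation forces every later one to be.\<close>
    proof (rule sum_one_exceptional_le)
      show "0 \<le> \<bar>g i x - g i y\<bar> / \<omega> t" for i using \<omega>t by simp
      show "\<bar>g i x - g i y\<bar> / \<omega> t \<le> 4" for i
        using test_fun_\<omega>[OF n2 nw, of i x y] \<omega>t by (simp add: g_def t_def divide_le_eq)
      fix k i :: nat assume ki: "k < i"
      show "\<bar>g k x - g k y\<bar> / \<omega> t \<le> (1 / 2) ^ k \<or> \<bar>g i x - g i y\<bar> / \<omega> t \<le> (1 / 2) ^ i"
      proof (cases "\<omega> t < 2 ^ k * (2 * real (n k) * w k * t)")
        case True
        then have "2 ^ i * w i \<le> \<omega> t"
          using sep[OF ki] t by (simp add: separated_def w_def)
        then have "2 ^ i * \<bar>g i x - g i y\<bar> \<le> \<omega> t"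
          using g_diff[of i x y] by (meson mult_left_mono order_trans zero_le_numeral zero_le_power)
        then show ?thesis using \<omega>t by (simp add: field_simps)
      next
        case False
        have "2 ^ k * \<bar>g k x - g k y\<bar> \<le> 2 ^ k * (2 * real (n k) * w k * t)"
          using test_fun_lipschitz[OF n2 nw, of k x y] by (intro mult_left_mono) (auto simp: g_def w_def t_def)
        also have "\<dots> \<le> \<omega> t" using False by simp
        finally show ?thesis using \<omega>t by (simp add: field_simps)
      qed
    qed
    have "\<bar>F x - F y\<bar> \<le> 6 * \<omega> t"
    proof (rule LIMSEQ_le_const2[OF tendsto_rabs[OF tendsto_diff[OF F_lim F_lim]]], intro exI allI impI)
      fix M :: nat
      have "\<bar>(\<Sum>i<M. g i x) - (\<Sum>i<M. g i y)\<bar> \<le> (\<Sum>i<M. \<bar>g i x - g i y\<bar>)"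
        unfolding sum_subtractf[symmetric] by (rule sum_abs)
      also have "\<dots> \<le> 6 * \<omega> t"
        using sums[of M] \<omega>t unfolding sum_divide_distrib[symmetric] by (simp add: divide_le_eq)
      finally show "\<bar>(\<Sum>i<M. g i x) - (\<Sum>i<M. g i y)\<bar> \<le> 6 * \<omega> t" .
    qed
    then show ?thesis by (simp add: t_def)
  qed simp
  have F_var: "(\<Sum>j<m. \<bar>F (b j) - F (a j)\<bar> powr p) powr (1 / p) \<le> 4 * \<nu> m"
    if m: "1 \<le> m" and ab: "nonoverlapping_intervals m a b" for m a b
  proof -
    define v where "v i = (\<Sum>j<m. \<bar>g i (b j) - g i (a j)\<bar> powr p) powr (1 / p)" for i
    have \<nu>m: "0 < \<nu> m" by (rule \<nu>_pos[OF m])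
    have v1: "v i \<le> 2 * \<nu> (min m (n i - 1))" and v2: "v i \<le> real m powr (1 / p) * w i" for i
      unfolding v_def g_def w_def by (rule test_fun_variation[OF n2 nw m ab])+
    have v3: "v i \<le> 2 * \<nu> m" and v4: "v i \<le> 2 * \<nu> (n i)" for i
      using v1[of i] \<nu>_mono[of "min m (n i - 1)" m] \<nu>_mono[OF order_trans[OF min.cobounded2 diff_le_self], of m "n i" 1]
      by auto
    have sums: "(\<Sum>i<M. v i / \<nu> m) \<le> 2 + 2" for M
    proof (rule sum_one_exceptional_le)
      show "0 \<le> v i / \<nu> m" for i using \<nu>m by (simp add: v_def)
      show "v i / \<nu> m \<le> 2" for i using v3[of i] \<nu>m by (simp add: divide_le_eq)
      fix k i :: nat assume ki: "k < i"
      show "v k / \<nu> m \<le> (1 / 2) ^ k \<or> v i / \<nu> m \<le> (1 / 2) ^ i"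
      proof (cases "\<nu> m < 2 ^ k * (2 * \<nu> (n k))")
        case True
        then have "2 ^ i * (real m powr (1 / p) * w i) \<le> \<nu> m"
          using sep[OF ki] m by (simp add: separated_def w_def)
        then have "2 ^ i * v i \<le> \<nu> m"
          using v2[of i] by (meson mult_left_mono order_trans zero_le_numeral zero_le_power)
        then show ?thesis using \<nu>m by (simp add: field_simps)
      next
        case False
        have "2 ^ k * v k \<le> 2 ^ k * (2 * \<nu> (n k))"
          using v4[of k] by (intro mult_left_mono) auto
        also have "\<dots> \<le> \<nu> m" using False by simp
        finally show ?thesis using \<nu>m by (simp add: field_simps)
      qed
    qed
    \<comment> \<open>Minkowski's inequality is applied to finite partial sums. For fixed
      \<open>m\<close> the bound passes to the limit by pointwise convergence, the positive
      exponents keeping the powers continuous at 0.\<close>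
    have "(\<lambda>M. (\<Sum>j<m. \<bar>(\<Sum>i<M. g i (b j)) - (\<Sum>i<M. g i (a j))\<bar> powr p) powr (1 / p))
      \<longlonglongrightarrow> (\<Sum>j<m. \<bar>F (b j) - F (a j)\<bar> powr p) powr (1 / p)"
      using p by (intro tendsto_powr2 tendsto_sum tendsto_rabs tendsto_diff F_lim tendsto_const)
        (auto intro!: always_eventually sum_nonneg)
    then show ?thesis
    proof (rule LIMSEQ_le_const2, intro exI allI impI)
      fix M :: nat
      have "(\<Sum>j<m. \<bar>(\<Sum>i<M. g i (b j)) - (\<Sum>i<M. g i (a j))\<bar> powr p) powr (1 / p) \<le> (\<Sum>i<M. v i)"
        unfolding v_def sum_subtractf[symmetric] by (rule Minkowski_sum_sum[OF p]) simp
      also have "\<dots> \<le> 4 * \<nu> m"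
        using sums[of M] \<nu>m unfolding sum_divide_distrib[symmetric] by (simp add: divide_le_eq)
      finally show "(\<Sum>j<m. \<bar>(\<Sum>i<M. g i (b j)) - (\<Sum>i<M. g i (a j))\<bar> powr p) powr (1 / p) \<le> 4 * \<nu> m" .
    qed
  qed
  have F_H: "F \<in> H_omega \<omega>"
  proof -
    have "\<bar>F (x + h) - F x\<bar> \<le> 6 * \<omega> d" if "0 \<le> h" "h \<le> d" for d h x
      using F_mod[of "x + h" x] \<omega>_mono[of h d] that by auto
    then show ?thesis
      unfolding H_omega_def using F_per zero_less_one by blast
  qed
  have F_V: "F \<in> V_p p \<nu>"
    unfolding V_p_def
  proof (intro CollectI conjI F_per exI[of _ 4] allI impI)
    show "bounded (range F)" using F_bound by (auto simp: bounded_iff)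
    fix m :: nat assume m: "1 \<le> m"
    show "upsilon p m F \<le> 4 * \<nu> m"
      unfolding upsilon_def
    proof (rule cSUP_least)
      have "nonoverlapping_intervals m (\<lambda>_. 0) (\<lambda>_. 0)" by (simp add: nonoverlapping_intervals_def)
      then show "{(a, b). nonoverlapping_intervals m a b} \<noteq> {}" by auto
    qed (use F_var[OF m] in auto)
  qed
  have F_cont: "continuous_on UNIV F"
    using H_omega_affine_bound[OF F_H F_bound] by (intro affine_bound_continuous) metis
  have big: "c / 48 \<le> fourier_partial_sum F (n i) 0" for i
  proof -
    define L where "L t = (\<Sum>k<i. g k t)" for t
    \<comment> \<open>Written as a difference, the tail inherits continuity from \<open>F\<close>,
      which has it from its modulus; its representation as a series is needed only for its
      size.\<close>
    define R where "R t = F t + (- (L t) + - (g i t))" for t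
    have L_cont: "continuous_on UNIV L"
      unfolding L_def by (intro continuous_on_sum g_cont)
    have R_cont: "continuous_on UNIV R"
      unfolding R_def by (intro continuous_intros F_cont L_cont g_cont)
    have R_eq: "R t = (\<Sum>k. g (k + Suc i) t)" for t
      using suminf_minus_initial_segment[OF g_summable[of t], of "Suc i"] by (simp add: R_def L_def F_def)
    have R_bound: "\<bar>R t\<bar> \<le> 2 * \<eta> / (2 * real (n i) + 1)" for t
    proof -
      have sR: "summable (\<lambda>k. g (k + Suc i) t)"
        using g_summable by (subst summable_iff_shift)
      have pos: "0 < 2 * real (n i) + 1" by (simp add: add_nonneg_pos)
      show ?thesis
        unfolding R_eq
      proof (rule LIMSEQ_le_const2[OF tendsto_rabs[OF summable_LIMSEQ[OF sR]]], intro exI allI impI)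
        fix M :: nat
        have "\<bar>\<Sum>k<M. g (k + Suc i) t\<bar> \<le> (\<Sum>k<M. \<eta> / (2 * real (n i) + 1) * (1 / 2) ^ k)"
        proof (intro order_trans[OF sum_abs] sum_mono)
          fix k
          have "(2 * real (n i) + 1) * w (k + Suc i) \<le> \<eta> * (1 / 2) ^ (k + Suc i)"
            by (intro w_sep) simp
          also have "\<dots> \<le> \<eta> * (1 / 2) ^ k"
            using \<eta> by (intro mult_left_mono power_decreasing) auto
          finally have "w (k + Suc i) \<le> \<eta> / (2 * real (n i) + 1) * (1 / 2) ^ k"
            using pos by (simp add: pos_le_divide_eq mult.commute)
          then show "\<bar>g (k + Suc i) t\<bar> \<le> \<eta> / (2 * real (n i) + 1) * (1 / 2) ^ k"
            using g_bounds[of "k + Suc i" t] by linarith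
        qed
        also have "\<dots> \<le> \<eta> / (2 * real (n i) + 1) * 2"
          unfolding sum_distrib_left[symmetric] using \<eta> pos by (intro mult_left_mono sum_half_powers_le) auto
        finally show "\<bar>\<Sum>k<M. g (k + Suc i) t\<bar> \<le> 2 * \<eta> / (2 * real (n i) + 1)" by (simp add: mult.commute)
      qed
    qed
    have R_sum: "\<bar>fourier_partial_sum R (n i) 0\<bar> \<le> 2 * \<eta>"
    proof -
      have "0 < 2 * real (n i) + 1" by (simp add: add_nonneg_pos)
      then show ?thesis using abs_fourier_partial_sum_le[OF R_cont R_bound, of "n i" 0] by simp
    qed
    have L_sum: "\<bar>fourier_partial_sum L (n i) 0\<bar> \<le> 2 * \<eta>"
    proof -
      have "fourier_partial_sum L (n i) 0 = (\<Sum>k<i. fourier_partial_sum (g k) (n i) 0)"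
        unfolding L_def by (intro fourier_partial_sum_sum g_cont)
      also have "\<bar>\<dots>\<bar> \<le> (\<Sum>k<i. \<eta> * (1 / 2) ^ k)"
      proof (intro order_trans[OF sum_abs] sum_mono)
        fix k assume "k \<in> {..<i}"
        then show "\<bar>fourier_partial_sum (g k) (n i) 0\<bar> \<le> \<eta> * (1 / 2) ^ k"
          using sep[of k i] by (simp add: separated_def g_def)
      qed
      also have "\<dots> \<le> \<eta> * 2"
        unfolding sum_distrib_left[symmetric] using \<eta> by (intro mult_left_mono sum_half_powers_le) auto
      finally show ?thesis by simp
    qed
    have g_sum: "c / 24 \<le> fourier_partial_sum (g i) (n i) 0"
    proof -
      have "c / 24 \<le> c / (6 * pi)"
        using c pi_less_4 by (intro divide_left_mono) auto
      also have "\<dots> \<le> sigma \<omega> \<nu> p (n i) / (6 * pi)"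
        using n[of i] by (intro divide_right_mono) auto
      also have "\<dots> \<le> fourier_partial_sum (g i) (n i) 0"
        unfolding g_def by (rule test_fun_partial_sum_ge[OF n2 nw])
      finally show ?thesis .
    qed
    have "F = (\<lambda>t. (L t + g i t) + R t)"
      by (simp add: R_def)
    then have "fourier_partial_sum F (n i) 0 = fourier_partial_sum (\<lambda>t. (L t + g i t) + R t) (n i) 0"
      by simp
    also have "\<dots> = fourier_partial_sum (\<lambda>t. L t + g i t) (n i) 0 + fourier_partial_sum R (n i) 0"
      by (intro fourier_partial_sum_add R_cont continuous_intros L_cont g_cont)
    also have "fourier_partial_sum (\<lambda>t. L t + g i t) (n i) 0 = fourier_partial_sum L (n i) 0 + fourier_partial_sum (g i) (n i) 0"
      by (intro fourier_partial_sum_add L_cont g_cont)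
    finally show ?thesis
      using L_sum R_sum g_sum by (simp add: \<eta>_def)
  qed
  have "(\<lambda>N. fourier_partial_sum F N 0) \<longlonglongrightarrow> F 0"
    using tendsto_uniform_limitI[OF conv[OF F_H F_V]] by simp
  then have "(\<lambda>i. fourier_partial_sum F (n i) 0) \<longlonglongrightarrow> 0"
    using LIMSEQ_subseq_LIMSEQ[OF _ sm] by (simp add: F_0 o_def)
  then have "c / 48 \<le> 0"
    using big by (intro LIMSEQ_le_const) auto
  then show False using c by simp
qed

end

theorem theorem5p1:
  fixes p :: real and \<omega> :: "real \<Rightarrow> real" and \<nu> :: "nat \<Rightarrow> real"
  assumes p: "1 \<le> p"
    and \<omega>: "modulus_of_continuity \<omega>"
    and \<omega>_lim: "filterlim (\<lambda>t. \<omega> t / t) at_top (at_right 0)"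
    and \<nu>: "modulus_of_variation \<nu>"
    and \<nu>p_concave: "\<forall>k\<ge>2. \<nu> (k + 1) powr p + \<nu> (k - 1) powr p \<le> 2 * \<nu> k powr p"
    and \<nu>_inf: "filterlim \<nu> at_top sequentially"
    and \<nu>_dec: "\<forall>k\<ge>1. \<nu> (Suc k) / real (Suc k) powr (1 / p) \<le> \<nu> k / real k powr (1 / p)"
    and \<nu>_zero: "(\<lambda>k. \<nu> k / real k powr (1 / p)) \<longlonglongrightarrow> 0"
  shows "((\<forall>f \<in> H_omega \<omega> \<inter> V_p p \<nu>.
              uniform_limit UNIV (\<lambda>n. fourier_partial_sum f n) f sequentially)
            \<longleftrightarrow> sigma \<omega> \<nu> p \<longlonglongrightarrow> 0)
       \<and> (sigma \<omega> \<nu> p \<longlonglongrightarrow> 0 \<longleftrightarrow> rho \<omega> \<nu> p \<longlonglongrightarrow> 0)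
       \<and> (rho \<omega> \<nu> p \<longlonglongrightarrow> 0 \<longleftrightarrow> tau \<omega> \<nu> p \<longlonglongrightarrow> 0)
       \<and> (tau \<omega> \<nu> p \<longlonglongrightarrow> 0 \<longleftrightarrow> eta \<omega> \<nu> p \<longlonglongrightarrow> 0)"
proof -
  interpret moduli p \<omega> \<nu>
    using assms by unfold_locales
  show ?thesis
    using rho_tendsto_0_imp_uniform_convergence sigma_tendsto_0_if_uniform_convergence
      rho_tendsto_0_imp_sigma sigma_tendsto_0_imp_tau tau_tendsto_0_imp_eta eta_tendsto_0_imp_rho
    by blast
qed

end
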